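(* Let $\epsilon\in(0,1)$, $\Gamma=\frac{12}{\epsilon}$ and $\alpha=\epsilon^{(\frac{1}{\epsilon}+1)}$. Consider an instance of the unit demand CVRP on a tree $T$ (root/depot $r$, terminal set $V'$, capacity $k$) with bounded distances, i.e. $D_{\max}<\left(\frac{1}{\epsilon}\right)^{\frac{1}{\epsilon}-1}D_{\min}$, and let $\mathrm{opt}$ be its optimal cost. Let $\mathcal{C}$ be the partition of the edges of $T$ into components described in the context. Then there exist dummy terminals and a solution $\mathrm{OPT}_1$ visiting all real and dummy terminals (each tour visiting at most $k$ real and dummy terminals in total) such that: 1. for each component $c\in\mathcal{C}$, at most $\frac{2\Gamma}{\alpha}+1$ tours of $\mathrm{OPT}_1$ visit terminals in $c$; 2. for each component $c$ and each tour $t$ of $\mathrm{OPT}_1$ visiting terminals in $c$, the number of terminals in $c$ visited by $t$ is at least $\alpha k$; 3. the cost $\mathrm{opt}_1$ of $\mathrm{OPT}_1$ satisfies $\mathrm{opt}_1\le(1+\epsilon)\,\mathrm{opt}$.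
   Context: Unit demand CVRP on trees: a tree $T=(V,E)$ with $n$ vertices and nonnegative edge weights, depot $r$, terminals $V'\subseteq V$, capacity $k\le n$; a solution is a set of closed walks (tours) from $r$ with each terminal assigned to (visited by) exactly one tour passing through it and each tour visiting at most $k$ terminals; cost is total edge weight traversed. Standing assumption: every non-leaf vertex of $T$ has exactly two children and the terminals are exactly the leaves. $\mathrm{dist}(v)$ is the distance from $r$ to $v$; $D_{\min},D_{\max}$ are the min and max of $\mathrm{dist}$ over terminals. Dummy terminals are additional terminals placed at vertices of $T$ (which must also be visited, each by one tour, and count toward capacity). Components: $\mathcal{C}$ is a partition of the edges of $T$, computed in polynomial time, such that each component $c$ is connected with root $r_c$ (its vertex closest to $r$); $c$ is a leaf component if all descendants of $r_c$ lie in $c$ (then it meets other components only at $r_c$), and otherwise an internal component meeting other components only at $r_c$ and one exit vertex $e_c$; each component contains at most $2\Gamma k$ terminals; a component is big if it contains at least $\Gamma k$ terminals, and every leaf component is big; if $|\mathcal{C}|>1$ there is a map from components to big components, mapping each component to one in the subtree rooted at its root, with each big component having at most three preimages, and $|\mathcal{C}|$ is at most $3/\Gamma$ times the number of terminals. Terminals "in $c$" are terminals that are vertices of $c$. *)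

theory Defs
  imports Complex_Main "HOL-Library.Disjoint_Sets"
begin

text \<open>
  Undirected simple graphs are given by a vertex set and a set of two-element edges; a walk is
  its non-empty list of vertices. (The \<open>tree\<close> predicate of the AFP entry Graph Theory counts the
  walk a, b, a of a symmetric digraph as a cycle, so it does not describe undirected trees.)
\<close>

definition simple_graph :: "'v set \<Rightarrow> 'v set set \<Rightarrow> bool" where
  "simple_graph V E \<longleftrightarrow> finite V \<and> (\<forall>e\<in>E. e \<subseteq> V \<and> card e = 2)"

definition gwalk :: "'v set \<Rightarrow> 'v set set \<Rightarrow> 'v \<Rightarrow> 'v list \<Rightarrow> 'v \<Rightarrow> bool" where
  "gwalk V E u p v \<longleftrightarrow>
     p \<noteq> [] \<and> hd p = u \<and> last p = v \<and> set p \<subseteq> V \<and> successively (\<lambda>x y. {x, y} \<in> E) p"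

definition gpath :: "'v set \<Rightarrow> 'v set set \<Rightarrow> 'v \<Rightarrow> 'v list \<Rightarrow> 'v \<Rightarrow> bool" where
  "gpath V E u p v \<longleftrightarrow> gwalk V E u p v \<and> distinct p"

definition gcycle :: "'v set \<Rightarrow> 'v set set \<Rightarrow> 'v list \<Rightarrow> bool" where
  "gcycle V E p \<longleftrightarrow> gwalk V E (hd p) p (hd p) \<and> distinct (tl p) \<and> length p \<ge> 4"

definition gconnected :: "'v set \<Rightarrow> 'v set set \<Rightarrow> bool" where
  "gconnected V E \<longleftrightarrow> V \<noteq> {} \<and> (\<forall>u\<in>V. \<forall>v\<in>V. \<exists>p. gwalk V E u p v)"

definition tree_graph :: "'v set \<Rightarrow> 'v set set \<Rightarrow> bool" where
  "tree_graph V E \<longleftrightarrow> simple_graph V E \<and> gconnected V E \<and> (\<nexists>p. gcycle V E p)"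

definition walk_cost :: "('v set \<Rightarrow> real) \<Rightarrow> 'v list \<Rightarrow> real" where
  "walk_cost w p = (\<Sum>i<length p - 1. w {p ! i, p ! Suc i})"

definition gdist :: "'v set \<Rightarrow> 'v set set \<Rightarrow> ('v set \<Rightarrow> real) \<Rightarrow> 'v \<Rightarrow> 'v \<Rightarrow> real" where
  "gdist V E w u v = (INF p\<in>{p. gwalk V E u p v}. walk_cost w p)"


definition descendants :: "'v set \<Rightarrow> 'v set set \<Rightarrow> 'v \<Rightarrow> 'v \<Rightarrow> 'v set" where
  "descendants V E r u = {v \<in> V. \<exists>p. gpath V E r p v \<and> u \<in> set p}"

definition children :: "'v set \<Rightarrow> 'v set set \<Rightarrow> 'v \<Rightarrow> 'v \<Rightarrow> 'v set" where
  "children V E r u = {v \<in> descendants V E r u. {u, v} \<in> E}"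

definition leaves :: "'v set \<Rightarrow> 'v set set \<Rightarrow> 'v \<Rightarrow> 'v set" where
  "leaves V E r = {v \<in> V. children V E r v = {}}"

definition rooted_binary_tree :: "'v set \<Rightarrow> 'v set set \<Rightarrow> 'v \<Rightarrow> bool" where
  "rooted_binary_tree V E r \<longleftrightarrow>
     tree_graph V E \<and> r \<in> V \<and> (\<forall>v \<in> V - leaves V E r. card (children V E r v) = 2)"


text \<open>
  A tour is a closed walk from the depot together with the set of terminals assigned to it.
  Terminals are objects \<open>x \<in> X\<close> placed at vertices \<open>loc x\<close>, so that dummy terminals may share a
  vertex with each other and with real terminals. Forming a set of such pairs loses nothing:
  tours with a non-empty assignment are pairwise distinct as pairs.
\<close>

type_synonym ('v, 'x) tour = "'v list \<times> 'x set"

definition cvrp_solution ::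
  "'v set \<Rightarrow> 'v set set \<Rightarrow> 'v \<Rightarrow> nat \<Rightarrow> 'x set \<Rightarrow> ('x \<Rightarrow> 'v) \<Rightarrow> ('v, 'x) tour set \<Rightarrow> bool" where
  "cvrp_solution V E r k X loc S \<longleftrightarrow>
     finite S \<and>
     (\<forall>(p, A)\<in>S. gwalk V E r p r \<and> A \<subseteq> X \<and> loc ` A \<subseteq> set p \<and> card A \<le> k) \<and>
     (\<forall>x\<in>X. \<exists>!t. t \<in> S \<and> x \<in> snd t)"

definition cvrp_cost :: "('v set \<Rightarrow> real) \<Rightarrow> ('v, 'x) tour set \<Rightarrow> real" where
  "cvrp_cost w S = (\<Sum>t\<in>S. walk_cost w (fst t))"

definition cvrp_opt ::
  "'v set \<Rightarrow> 'v set set \<Rightarrow> ('v set \<Rightarrow> real) \<Rightarrow> 'v \<Rightarrow> nat \<Rightarrow> 'v set \<Rightarrow> real" where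
  "cvrp_opt V E w r k V' =
     (INF S \<in> {S :: ('v, 'v) tour set. cvrp_solution V E r k V' id S}. cvrp_cost w S)"

text \<open>Terminals visited by a tour that are vertices of the component \<open>c\<close> (a set of edges).\<close>

definition visited_in :: "('x \<Rightarrow> 'v) \<Rightarrow> 'v set set \<Rightarrow> ('v, 'x) tour \<Rightarrow> 'x set" where
  "visited_in loc c t = {x \<in> snd t. loc x \<in> \<Union>c}"


text \<open>
  The vertex of a component closest to the root is taken with respect to the number of edges:
  this minimiser is unique, whereas edges of weight 0 could produce ties in the weighted distance.
\<close>

definition comp_root :: "'v set \<Rightarrow> 'v set set \<Rightarrow> 'v \<Rightarrow> 'v set set \<Rightarrow> 'v" where
  "comp_root V E r c = arg_min_on (gdist V E (\<lambda>_. 1) r) (\<Union>c)"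

definition leaf_component :: "'v set \<Rightarrow> 'v set set \<Rightarrow> 'v \<Rightarrow> 'v set set \<Rightarrow> bool" where
  "leaf_component V E r c \<longleftrightarrow> descendants V E r (comp_root V E r c) \<subseteq> \<Union>c"

definition shared_vertices :: "'v set set set \<Rightarrow> 'v set set \<Rightarrow> 'v set" where
  "shared_vertices C c = {v \<in> \<Union>c. \<exists>c'\<in>C. c' \<noteq> c \<and> v \<in> \<Union>c'}"

definition big_component :: "'v set \<Rightarrow> nat \<Rightarrow> real \<Rightarrow> 'v set set \<Rightarrow> bool" where
  "big_component V' k \<Gamma> c \<longleftrightarrow> \<Gamma> * real k \<le> real (card (V' \<inter> \<Union>c))"

text \<open>
  Bigness of leaf components is only required when there are at least two components: a tree with
  fewer than \<open>\<Gamma> * k\<close> terminals has no partition in which all leaf components are big, and is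
  decomposed into a single component.
\<close>

definition component_decomposition ::
  "'v set \<Rightarrow> 'v set set \<Rightarrow> 'v \<Rightarrow> 'v set \<Rightarrow> nat \<Rightarrow> real \<Rightarrow> 'v set set set \<Rightarrow> bool" where
  "component_decomposition V E r V' k \<Gamma> C \<longleftrightarrow>
     partition_on E C \<and>
     (\<forall>c\<in>C. gconnected (\<Union>c) c) \<and>
     (\<forall>c\<in>C. leaf_component V E r c \<longrightarrow> shared_vertices C c \<subseteq> {comp_root V E r c}) \<and>
     (\<forall>c\<in>C. \<not> leaf_component V E r c \<longrightarrow>
        (\<exists>e\<in>shared_vertices C c. e \<noteq> comp_root V E r c \<and>
           shared_vertices C c \<subseteq> {comp_root V E r c, e})) \<and>
     (\<forall>c\<in>C. real (card (V' \<inter> \<Union>c)) \<le> 2 * \<Gamma> * real k) \<and>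
     (card C > 1 \<longrightarrow>
        (\<forall>c\<in>C. leaf_component V E r c \<longrightarrow> big_component V' k \<Gamma> c) \<and>
        (\<exists>\<phi>. (\<forall>c\<in>C. \<phi> c \<in> C \<and> big_component V' k \<Gamma> (\<phi> c) \<and>
                  \<Union>(\<phi> c) \<subseteq> descendants V E r (comp_root V E r c)) \<and>
             (\<forall>b\<in>C. big_component V' k \<Gamma> b \<longrightarrow> card {c \<in> C. \<phi> c = b} \<le> 3)) \<and>
        real (card C) \<le> 3 / \<Gamma> * real (card V'))"

end

theory Submission
  imports Defs
begin

text \<open>
  Only the sets \<open>L v\<close> of terminals below a vertex matter: the cheapest closed walk visiting a set of
  terminals traverses twice each edge above one of them, so a solution is a labelling \<open>q\<close> of the
  terminals by tours whose cost is twice the sum over \<open>v\<close> of the weight of the edge above \<open>v\<close> times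
  \<open>card (q ` L v)\<close>. Start from an optimal labelling, remove some pieces (the terminals of one tour in
  one component), order the removed terminals of each component depth-first and cut this sequence
  into chunks of equal size; averaging over the cutting offset bounds the edges cut repeatedly. An
  edge above the root of another component lies above at least \<open>\<Gamma> * k\<close> terminals, hence is used by at
  least \<open>\<Gamma>\<close> tours, which pays for the constantly many extra tours caused by each component.

  For \<open>\<epsilon> \<ge> 1/3\<close> each tour either keeps all of its pieces larger than \<open>\<epsilon> * k\<close> or is broken up
  entirely, whichever is cheaper, and the removed terminals of a component are served by full
  tours of their own. For \<open>\<epsilon> \<le> 1/3\<close> just the pieces smaller than \<open>\<alpha> * k\<close> are removed. By Hall's
  theorem their chunks can be given back to tours that contributed to them such that no tour receives
  more than it lost, except for at most one chunk per tour; these chunks are packed, many at a time,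
  into new tours.
\<close>


section \<open>Hall's theorem and averaging over shifts\<close>

text \<open>The obstacle is rounding: cutting into chunks costs additive constants at every edge,
  which is no small fraction where few tours pass. Edges with \<open>below v = {}\<close> escape
  because each tour has a single piece beneath them, so a removed piece frees its tour there and
  pays for a chunk. At all other edges constants are absorbed by \<Gamma> = 12 / \<epsilon>. Both
  regimes meet at 1/3. For \<epsilon> \<le> 1/3 the exponent \<open>1 / \<epsilon> + 1\<close> is at
  least 4, so \<alpha> \<le> \<epsilon>^4, which leaves room for an intermediate chunk size
  \<open>h\<close> of order \<open>\<epsilon>^2 * k\<close>: a full chunk meets more than
  \<open>1 / \<epsilon>\<close> removed pieces, yet about \<open>1 / \<epsilon>^2\<close> chunks fit
  into one tour. From 1/3 on, an arithmetic-geometric mean estimate shows instead that breaking or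
  keeping is always affordable. Chunks go back only to tours that contributed to them, because such
  a tour already uses every edge above the whole chunk.\<close>

theorem hall_marriage:
  fixes A :: "'i \<Rightarrow> 'a set"
  assumes "finite I" and "\<And>i. i \<in> I \<Longrightarrow> finite (A i)"
    and "\<And>J. J \<subseteq> I \<Longrightarrow> card J \<le> card (\<Union>(A ` J))"
  shows "\<exists>f. (\<forall>i\<in>I. f i \<in> A i) \<and> inj_on f I"
  using assms
proof (induction "card I" arbitrary: I A rule: less_induct)
  case less
  note fin = less.prems(1,2) and hall = less.prems(3)
  show ?case
  proof (cases "\<exists>J. J \<subset> I \<and> J \<noteq> {} \<and> card J = card (\<Union>(A ` J))")
    \<comment> \<open>A proper subfamily \<open>J\<close> is tight, so its representatives exhaust
      \<open>?U\<close>. The other sets keep Hall's condition after \<open>?U\<close> is deleted,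
      since adjoining \<open>J\<close> to a subfamily adds the same number on both sides.\<close>
    case True
    then obtain J where J: "J \<subset> I" "J \<noteq> {}" "card J = card (\<Union>(A ` J))" by blast
    have fJ: "finite J" using J(1) fin(1) finite_subset by blast
    let ?U = "\<Union>(A ` J)"
    have fU: "finite ?U" using fJ fin(2) J(1) by blast
    have "\<exists>f. (\<forall>i\<in>J. f i \<in> A i) \<and> inj_on f J"
    proof (rule less.hyps)
      show "card J < card I" using J(1) fin(1) by (rule psubset_card_mono[rotated])
      show "finite (A i)" if "i \<in> J" for i using that J(1) fin(2) by blast
      show "card J' \<le> card (\<Union>(A ` J'))" if "J' \<subseteq> J" for J'
        using hall that J(1) by blast
    qed (rule fJ)
    then obtain f where f: "\<forall>i\<in>J. f i \<in> A i" "inj_on f J" by blast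
    have "\<exists>g. (\<forall>i\<in>I - J. g i \<in> A i - ?U) \<and> inj_on g (I - J)"
    proof (rule less.hyps)
      show "card (I - J) < card I" using J fin(1) by (intro psubset_card_mono) auto
      show "finite (I - J)" using fin(1) by blast
      show "finite (A i - ?U)" if "i \<in> I - J" for i using that fin(2) by blast
      show "card L \<le> card (\<Union>i\<in>L. A i - ?U)" if L: "L \<subseteq> I - J" for L
      proof -
        have fL: "finite L" using L fin(1) finite_subset by blast
        have fAL: "finite (\<Union>i\<in>L. A i - ?U)" using fL fin(2) L by blast
        have "card L + card J = card (L \<union> J)"
          using fL fJ L by (subst card_Un_disjoint) auto
        also have "\<dots> \<le> card (\<Union>(A ` (L \<union> J)))" using hall L J(1) by blast
        also have "\<Union>(A ` (L \<union> J)) = (\<Union>i\<in>L. A i - ?U) \<union> ?U" by blast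
        also have "card \<dots> = card (\<Union>i\<in>L. A i - ?U) + card ?U"
          using fAL fU by (intro card_Un_disjoint) auto
        finally show ?thesis using J(3) by simp
      qed
    qed
    then obtain g where g: "\<forall>i\<in>I - J. g i \<in> A i - ?U" "inj_on g (I - J)" by blast
    define h where "h i = (if i \<in> J then f i else g i)" for i
    have "\<forall>i\<in>I. h i \<in> A i" using f(1) g(1) by (auto simp: h_def)
    moreover have "inj_on h I"
    proof (rule inj_onI)
      fix x y assume xy: "x \<in> I" "y \<in> I" "h x = h y"
      show "x = y"
      proof (cases "x \<in> J \<longleftrightarrow> y \<in> J")
        case True
        then show ?thesis
          using xy inj_onD[OF f(2)] inj_onD[OF g(2)] by (cases "x \<in> J") (auto simp: h_def)
      next
        case False
        have "f i \<noteq> g j" if "i \<in> J" "j \<in> I - J" for i j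
          using that f(1) g(1) by fastforce
        with False xy show ?thesis
          by (cases "x \<in> J") (auto simp: h_def dest: sym)
      qed
    qed
    ultimately show ?thesis by blast
  next
    \<comment> \<open>Every nonempty proper subfamily has an element to spare, so one representative
      may be chosen arbitrarily and deleted from all other sets.\<close>
    case False
    show ?thesis
    proof (cases "I = {}")
      case False': False
      then obtain i where i: "i \<in> I" by blast
      have "card {i} \<le> card (\<Union>(A ` {i}))" using hall[of "{i}"] i by blast
      then obtain a where a: "a \<in> A i" by (cases "A i = {}") auto
      have "\<exists>g. (\<forall>j\<in>I - {i}. g j \<in> A j - {a}) \<and> inj_on g (I - {i})"
      proof (rule less.hyps)
        show "card (I - {i}) < card I" using i fin(1) by (intro psubset_card_mono) auto
        show "finite (I - {i})" using fin(1) by blast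
        show "finite (A j - {a})" if "j \<in> I - {i}" for j using that fin(2) by blast
        show "card L \<le> card (\<Union>j\<in>L. A j - {a})" if L: "L \<subseteq> I - {i}" for L
        proof (cases "L = {}")
          case nonempty: False
          have "L \<subset> I" using L i by blast
          then have "card L < card (\<Union>(A ` L))"
            using False nonempty hall[of L] by (metis le_neq_implies_less psubset_imp_subset)
          moreover have "(\<Union>j\<in>L. A j - {a}) = \<Union>(A ` L) - {a}" by blast
          ultimately show ?thesis
            by (simp add: card_Diff_singleton_if, linarith)
        qed simp
      qed
      then obtain g where g: "\<forall>j\<in>I - {i}. g j \<in> A j - {a}" "inj_on g (I - {i})" by blast
      have "\<forall>j\<in>I. (g(i := a)) j \<in> A j" using g(1) a by auto
      moreover have "inj_on (g(i := a)) I"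
        using g by (auto simp: inj_on_def)
      ultimately show ?thesis by blast
    qed auto
  qed
qed

text \<open>Hermite's identity: raising \<open>n\<close> by one replaces the summand
  \<open>n div h\<close> by \<open>(n + h) div h\<close>, which is one larger.\<close>

lemma sum_div_shift:
  fixes n h :: nat
  assumes "0 < h"
  shows "(\<Sum>j<h. (n + j) div h) = n"
proof (induction n)
  case (Suc n)
  have "(\<Sum>j<h. (Suc n + j) div h) + n div h = (\<Sum>j<Suc h. (n + j) div h)"
    by (subst sum.lessThan_Suc_shift) (simp add: add.commute)
  also have "\<dots> = n + (n div h + 1)" using Suc assms by simp
  finally show ?case by simp
qed (use assms in simp)

text \<open>Some offset is no worse than the average. One offset has to serve all edges at once, so
  the weighted sum is averaged rather than each term.\<close>

lemma exists_good_shift: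
  fixes g :: "'b \<Rightarrow> nat \<Rightarrow> nat" and wt G :: "'b \<Rightarrow> real"
  assumes "0 < h" and "\<And>v. v \<in> M \<Longrightarrow> 0 \<le> wt v"
    and "\<And>v. v \<in> M \<Longrightarrow> real (\<Sum>j<h. g v j) \<le> real h * G v"
  shows "\<exists>j<h. (\<Sum>v\<in>M. wt v * real (g v j)) \<le> (\<Sum>v\<in>M. wt v * G v)"
proof (rule ccontr)
  assume "\<not> ?thesis"
  then have "(\<Sum>v\<in>M. wt v * G v) < (\<Sum>v\<in>M. wt v * real (g v j))" if "j < h" for j
    using that not_le by blast
  then have "(\<Sum>j<h. \<Sum>v\<in>M. wt v * G v) < (\<Sum>j<h. \<Sum>v\<in>M. wt v * real (g v j))"
    using assms(1) by (intro sum_strict_mono[of "{..<h}"]) (simp_all, blast)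
  also have "\<dots> = (\<Sum>v\<in>M. wt v * real (\<Sum>j<h. g v j))"
    by (subst sum.swap) (simp add: sum_distrib_left)
  also have "\<dots> \<le> (\<Sum>v\<in>M. wt v * (real h * G v))"
    using assms(2,3) by (intro sum_mono mult_left_mono) auto
  also have "\<dots> = (\<Sum>j<h. \<Sum>v\<in>M. wt v * G v)"
    by (simp add: sum_distrib_left mult.left_commute)
  finally show False by simp
qed

section \<open>Chunks of terminals in a laminar routing problem\<close>

text \<open>
  \<open>N\<close> stands for the edges, each named by its lower end \<open>v\<close>; \<open>own v\<close> is the component of that edge, so
  \<open>comp ` L v - {own v}\<close> consists of the components rooted at or below \<open>v\<close> that have terminals.
\<close>
locale laminar_routing =
  fixes X :: "'a set" and N :: "'b set" and L :: "'b \<Rightarrow> 'a set" and wt :: "'b \<Rightarrow> real"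
    and comp :: "'a \<Rightarrow> 'c" and own :: "'b \<Rightarrow> 'c" and rank :: "'a \<Rightarrow> real"
    and k :: nat and \<Gamma> :: real
  assumes finite_X: "finite X" and finite_N: "finite N"
    and L_subset: "v \<in> N \<Longrightarrow> L v \<subseteq> X"
    and wt_nonneg: "v \<in> N \<Longrightarrow> 0 \<le> wt v"
    and rank_inj: "inj_on rank X"
    and rank_convex: "\<lbrakk>v \<in> N; x \<in> L v; z \<in> L v; y \<in> X; rank x \<le> rank y; rank y \<le> rank z\<rbrakk> \<Longrightarrow> y \<in> L v"
    and below_closed: "\<lbrakk>v \<in> N; x \<in> L v; comp x \<noteq> own v; y \<in> X; comp y = comp x\<rbrakk> \<Longrightarrow> y \<in> L v"
    and below_heavy: "\<lbrakk>v \<in> N; comp ` L v - {own v} \<noteq> {}\<rbrakk> \<Longrightarrow> \<Gamma> * real k \<le> real (card (L v))"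
    and below_few: "v \<in> N \<Longrightarrow>
      \<Gamma> * real k * real (card (comp ` L v - {own v})) \<le> 3 * real (card (L v))"
    and comp_size: "real (card {x \<in> X. comp x = c}) \<le> 2 * \<Gamma> * real k"
    and k_pos: "1 \<le> k" and \<Gamma>_pos: "0 < \<Gamma>"
begin

definition pos :: "'a set \<Rightarrow> 'a \<Rightarrow> nat" where
  "pos B x = card {y \<in> B. rank y < rank x}"

text \<open>The offset \<open>s\<close> moves all cuts simultaneously; the price is that the first
  chunk may be partial as well as the last.\<close>

definition chunk :: "'a set \<Rightarrow> nat \<Rightarrow> nat \<Rightarrow> 'a \<Rightarrow> nat" where
  "chunk B h s x = (pos B x + s) div h"

lemma finite_sub: "B \<subseteq> X \<Longrightarrow> finite B"
  using finite_X finite_subset by blast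

lemma finite_L: "v \<in> N \<Longrightarrow> finite (L v)"
  using L_subset finite_sub by blast

lemma pos_less:
  assumes "B \<subseteq> X" "x \<in> B" "rank x < rank y"
  shows "pos B x < pos B y"
  unfolding pos_def using assms finite_sub by (intro psubset_card_mono) auto

lemma pos_le_iff:
  assumes "B \<subseteq> X" "x \<in> B" "y \<in> B"
  shows "pos B x \<le> pos B y \<longleftrightarrow> rank x \<le> rank y"
proof
  assume "pos B x \<le> pos B y"
  then show "rank x \<le> rank y" using pos_less[OF assms(1,3)] by (meson not_le)
next
  assume "rank x \<le> rank y"
  then have "{z \<in> B. rank z < rank x} \<subseteq> {z \<in> B. rank z < rank y}" by auto
  then show "pos B x \<le> pos B y"
    unfolding pos_def using finite_sub[OF assms(1)] by (intro card_mono) auto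
qed

lemma pos_inj: assumes "B \<subseteq> X" shows "inj_on (pos B) B"
proof (rule inj_onI)
  fix x y assume "x \<in> B" "y \<in> B" "pos B x = pos B y"
  then have "rank x = rank y" using pos_le_iff[OF assms] by (metis order.antisym order.refl)
  then show "x = y" using rank_inj \<open>x \<in> B\<close> \<open>y \<in> B\<close> assms by (meson inj_onD subsetD)
qed

lemma pos_bij: assumes "B \<subseteq> X" shows "bij_betw (pos B) B {..<card B}"
proof -
  have "pos B ` B \<subseteq> {..<card B}"
  proof
    fix n assume "n \<in> pos B ` B"
    then obtain x where x: "x \<in> B" "n = pos B x" by blast
    have "{y \<in> B. rank y < rank x} \<subset> B" using x(1) by auto
    then show "n \<in> {..<card B}"
      unfolding x(2) pos_def using finite_sub[OF assms] by (simp add: psubset_card_mono)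
  qed
  then have "pos B ` B = {..<card B}"
    using card_image[OF pos_inj[OF assms]] by (intro card_subset_eq) auto
  then show ?thesis using pos_inj[OF assms] by (simp add: bij_betw_def)
qed

text \<open>Rank-convexity of \<open>L v\<close> survives the passage to positions within any
  \<open>B\<close>. Hence an edge meets a contiguous run of chunks.\<close>

lemma pos_interval:
  assumes "B \<subseteq> X" "v \<in> N" "B \<inter> L v \<noteq> {}"
  obtains a where "pos B ` (B \<inter> L v) = {a..<a + card (B \<inter> L v)}"
proof -
  let ?D = "B \<inter> L v"
  define P where "P = pos B ` ?D"
  have fin: "finite P" "P \<noteq> {}" using assms(3) finite_sub[OF assms(1)] by (auto simp: P_def)
  have conv: "n \<in> P" if n: "l \<in> P" "u \<in> P" "l \<le> n" "n \<le> u" for l n u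
  proof -
    obtain x z where xz: "x \<in> ?D" "z \<in> ?D" "l = pos B x" "u = pos B z"
      using n(1,2) by (auto simp: P_def)
    have "pos B z < card B" using xz(2) pos_bij[OF assms(1)] by (auto simp: bij_betw_def)
    then have "n < card B" using n(4) xz(4) by simp
    then obtain y where y: "y \<in> B" "n = pos B y"
      using pos_bij[OF assms(1)] by (metis bij_betw_imp_surj_on imageE lessThan_iff)
    have "rank x \<le> rank y" "rank y \<le> rank z"
      using n(3,4) xz y pos_le_iff[OF assms(1)] by auto
    then have "y \<in> L v" using rank_convex[OF assms(2), of x z y] xz y assms(1) by auto
    then show ?thesis using y by (auto simp: P_def)
  qed
  have "P = {Min P..Max P}"
  proof (rule set_eqI)
    show "n \<in> P \<longleftrightarrow> n \<in> {Min P..Max P}" for n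
      using conv[OF Min_in[OF fin] Max_in[OF fin], of n] Min_le[OF fin(1), of n]
        Max_ge[OF fin(1), of n] by auto
  qed
  moreover have "card P = card ?D"
    unfolding P_def using pos_inj[OF assms(1)] by (meson card_image inf_le1 inj_on_subset)
  moreover have "Min P \<le> Max P" using fin by simp
  ultimately have "P = {Min P..<Min P + card ?D}"
    by (metis add_diff_inverse_nat atLeastLessThanSuc_atLeastAtMost card_atLeastAtMost
        le_SucI not_le)
  then show ?thesis using that P_def by blast
qed

lemma chunk_mono: "\<lbrakk>B \<subseteq> X; x \<in> B; y \<in> B; rank x \<le> rank y\<rbrakk> \<Longrightarrow> chunk B h s x \<le> chunk B h s y"
  unfolding chunk_def using pos_le_iff by (simp add: div_le_mono)

text \<open>An interval of \<open>d\<close> positions from \<open>a\<close> meets at most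
  \<open>(a + d - 1 + s) div h - (a + s) div h + 1\<close> chunks. Summed over \<open>s\<close>,
  Hermite's identity turns the quotients into \<open>a + d - 1\<close> and \<open>a\<close>.\<close>

lemma chunk_hits:
  assumes "B \<subseteq> X" "v \<in> N" "0 < h"
  shows "(\<Sum>s<h. card (chunk B h s ` (B \<inter> L v))) \<le>
         (if B \<inter> L v = {} then 0 else h + card (B \<inter> L v))"
proof (cases "B \<inter> L v = {}")
  case False
  let ?d = "card (B \<inter> L v)"
  obtain a where a: "pos B ` (B \<inter> L v) = {a..<a + ?d}"
    using pos_interval[OF assms(1,2) False] .
  have d: "?d > 0" using False finite_sub[OF assms(1)] by (simp add: card_gt_0_iff)
  have "card (chunk B h s ` (B \<inter> L v)) + (a + s) div h \<le> (a + ?d - 1 + s) div h + 1" for s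
  proof -
    have "chunk B h s ` (B \<inter> L v) = (\<lambda>i. (i + s) div h) ` {a..<a + ?d}"
      unfolding a[symmetric] by (auto simp: chunk_def image_image)
    also have "\<dots> \<subseteq> {(a + s) div h..(a + ?d - 1 + s) div h}"
      by (auto intro!: div_le_mono)
    finally have "card (chunk B h s ` (B \<inter> L v)) \<le> card {(a + s) div h..(a + ?d - 1 + s) div h}"
      by (intro card_mono) auto
    moreover have "(a + s) div h \<le> (a + ?d - 1 + s) div h" using d by (intro div_le_mono) simp
    ultimately show ?thesis by simp
  qed
  then have "(\<Sum>s<h. card (chunk B h s ` (B \<inter> L v)) + (a + s) div h)
      \<le> (\<Sum>s<h. (a + ?d - 1 + s) div h + 1)" by (intro sum_mono)
  then have "(\<Sum>s<h. card (chunk B h s ` (B \<inter> L v))) + a \<le> a + ?d - 1 + h"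
    unfolding sum.distrib sum_div_shift[OF assms(3)] by simp
  then show ?thesis using False d by simp
qed simp

lemma good_shift:
  assumes "B \<subseteq> X" "M \<subseteq> N" "0 < h"
  obtains s where "s < h"
    "(\<Sum>v\<in>M. wt v * real (card (chunk B h s ` (B \<inter> L v)))) \<le>
     (\<Sum>v\<in>M. wt v * (if B \<inter> L v = {} then 0 else 1 + real (card (B \<inter> L v)) / real h))"
proof -
  have "\<exists>s<h. (\<Sum>v\<in>M. wt v * real (card (chunk B h s ` (B \<inter> L v)))) \<le>
     (\<Sum>v\<in>M. wt v * (if B \<inter> L v = {} then 0 else 1 + real (card (B \<inter> L v)) / real h))"
  proof (rule exists_good_shift[OF assms(3)])
    show "0 \<le> wt v" if "v \<in> M" for v using that assms(2) wt_nonneg by blast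
    show "real (\<Sum>s<h. card (chunk B h s ` (B \<inter> L v))) \<le>
        real h * (if B \<inter> L v = {} then 0 else 1 + real (card (B \<inter> L v)) / real h)"
      if "v \<in> M" for v
    proof -
      have "real (\<Sum>s<h. card (chunk B h s ` (B \<inter> L v))) \<le>
          real (if B \<inter> L v = {} then 0 else h + card (B \<inter> L v))"
        using chunk_hits[OF assms(1) _ assms(3), of v] that assms(2) of_nat_mono by blast
      also have "\<dots> = real h * (if B \<inter> L v = {} then 0 else 1 + real (card (B \<inter> L v)) / real h)"
        using assms(3) by (simp add: field_simps)
      finally show ?thesis .
    qed
  qed
  then show ?thesis using that by blast
qed

text \<open>Each edge belongs to one component, so the sum splits into independent sums and every
  component takes its own best offset.\<close>

lemma good_shifts:
  assumes "\<And>c. B c \<subseteq> X" "M \<subseteq> N" "0 < h"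
  obtains s where
    "(\<Sum>v\<in>M. wt v * real (card (chunk (B (own v)) h (s (own v)) ` (B (own v) \<inter> L v)))) \<le>
     (\<Sum>v\<in>M. wt v * (if B (own v) \<inter> L v = {} then 0
                   else 1 + real (card (B (own v) \<inter> L v)) / real h))"
proof -
  define e where "e s v = wt v * real (card (chunk (B (own v)) h s ` (B (own v) \<inter> L v)))" for s v
  define a where "a v = wt v * (if B (own v) \<inter> L v = {} then 0
    else 1 + real (card (B (own v) \<inter> L v)) / real h)" for v
  have finM: "finite M" using assms(2) finite_N finite_subset by blast
  have "\<exists>s. (\<Sum>v | v \<in> M \<and> own v = c. e s v) \<le> (\<Sum>v | v \<in> M \<and> own v = c. a v)" for c
  proof -
    have sub: "{v \<in> M. own v = c} \<subseteq> N" using assms(2) by blast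
    obtain s where s: "(\<Sum>v | v \<in> M \<and> own v = c. wt v * real (card (chunk (B c) h s ` (B c \<inter> L v)))) \<le>
       (\<Sum>v | v \<in> M \<and> own v = c. wt v * (if B c \<inter> L v = {} then 0
                   else 1 + real (card (B c \<inter> L v)) / real h))"
      using good_shift[OF assms(1)[of c] sub assms(3)] by blast
    have "(\<Sum>v | v \<in> M \<and> own v = c. e s v) =
        (\<Sum>v | v \<in> M \<and> own v = c. wt v * real (card (chunk (B c) h s ` (B c \<inter> L v))))"
      by (rule sum.cong) (auto simp: e_def)
    also note s
    also have "(\<Sum>v | v \<in> M \<and> own v = c. wt v * (if B c \<inter> L v = {} then 0
        else 1 + real (card (B c \<inter> L v)) / real h)) = (\<Sum>v | v \<in> M \<and> own v = c. a v)"
      by (rule sum.cong) (auto simp: a_def)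
    finally show ?thesis by blast
  qed
  then obtain s where s: "\<And>c. (\<Sum>v | v \<in> M \<and> own v = c. e (s c) v) \<le> (\<Sum>v | v \<in> M \<and> own v = c. a v)"
    by metis
  have "(\<Sum>v\<in>M. e (s (own v)) v) = (\<Sum>c\<in>own ` M. \<Sum>v | v \<in> M \<and> own v = c. e (s (own v)) v)"
    by (rule sum.image_gen[OF finM])
  also have "\<dots> = (\<Sum>c\<in>own ` M. \<Sum>v | v \<in> M \<and> own v = c. e (s c) v)"
    by (intro sum.cong) auto
  also have "\<dots> \<le> (\<Sum>c\<in>own ` M. \<Sum>v | v \<in> M \<and> own v = c. a v)" by (intro sum_mono s)
  also have "\<dots> = (\<Sum>v\<in>M. a v)" by (rule sum.image_gen[OF finM, symmetric])
  finally show ?thesis using that unfolding e_def a_def by blast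
qed

lemma chunk_card_le:
  assumes "B \<subseteq> X" "0 < h"
  shows "card {x \<in> B. chunk B h s x = j} \<le> h"
proof -
  have "card {x \<in> B. chunk B h s x = j} \<le> card {j * h..<j * h + h}"
  proof (rule card_inj_on_le[where f = "\<lambda>x. pos B x + s"])
    show "inj_on (\<lambda>x. pos B x + s) {x \<in> B. chunk B h s x = j}"
      using pos_inj[OF assms(1)] by (auto simp: inj_on_def)
    show "(\<lambda>x. pos B x + s) ` {x \<in> B. chunk B h s x = j} \<subseteq> {j * h..<j * h + h}"
      using dividend_less_div_times[OF assms(2)] by (auto simp: chunk_def add.commute)
  qed simp
  then show ?thesis by simp
qed

text \<open>Taking chunk indices modulo the number of chunks glues the first chunk to the last one
  whenever both are partial and fit together.\<close>
lemma chunk_mod_card_le: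
  assumes "B \<subseteq> X" "0 < h" "card B \<le> n * h"
  shows "card {x \<in> B. chunk B h s x mod n = j} \<le> h"
proof -
  \<comment> \<open>By \<open>mod_mult2_eq\<close> a residue modulo \<open>h * n\<close> is
    \<open>h\<close> times the chunk index modulo \<open>n\<close> plus an offset below
    \<open>h\<close>; at most \<open>n * h\<close> consecutive positions keep distinct
    residues.\<close>
  have "card {x \<in> B. chunk B h s x mod n = j} \<le> card {h * j..<h * j + h}"
  proof (rule card_inj_on_le[where f = "\<lambda>x. (pos B x + s) mod (h * n)"])
    show "inj_on (\<lambda>x. (pos B x + s) mod (h * n)) {x \<in> B. chunk B h s x mod n = j}"
    proof (rule inj_onI)
      have eq: "a = b" if "(a + s) mod (h * n) = (b + s) mod (h * n)" "b \<le> a" "a < card B" for a b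
      proof -
        have "h * n dvd (a + s) - (b + s)" using that by (intro mod_eq_dvd_iff_nat[THEN iffD1]) auto
        then have "h * n dvd a - b" by simp
        moreover have "a - b < h * n" using that(3) assms(3) by (simp add: mult.commute)
        ultimately have "a - b = 0" using nat_dvd_not_less by blast
        then show ?thesis using that(2) by simp
      qed
      fix x y assume xy: "x \<in> {x \<in> B. chunk B h s x mod n = j}" "y \<in> {x \<in> B. chunk B h s x mod n = j}"
        "(pos B x + s) mod (h * n) = (pos B y + s) mod (h * n)"
      have "pos B x < card B" "pos B y < card B"
        using xy pos_bij[OF assms(1)] by (auto simp: bij_betw_def)
      then have "pos B x = pos B y" using eq xy(3) by (metis nle_le)
      then show "x = y" using pos_inj[OF assms(1)] xy by (auto dest: inj_onD)
    qed
    show "(\<lambda>x. (pos B x + s) mod (h * n)) ` {x \<in> B. chunk B h s x mod n = j} \<subseteq> {h * j..<h * j + h}"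
      using assms(2) by (auto simp: chunk_def mod_mult2_eq)
  qed simp
  then show ?thesis by simp
qed

text \<open>A chunk met by an interval, but different from the chunks of its two end positions, lies
  entirely between them. \<open>D\<close> is arbitrary so that both \<open>L v\<close> and
  \<open>B\<close> itself can be used.\<close>

lemma chunk_ends_aux:
  assumes "B \<subseteq> X" "0 < h" and a: "pos B ` (B \<inter> D) = {a..<a + card (B \<inter> D)}"
  obtains j1 j2 where "\<And>j. \<lbrakk>j \<in> chunk B h s ` (B \<inter> D); j \<noteq> j1; j \<noteq> j2\<rbrakk> \<Longrightarrow>
    {x \<in> B. chunk B h s x = j} \<subseteq> D \<and> card {x \<in> B. chunk B h s x = j} = h"
proof (cases "B \<inter> D = {}")
  case True
  show ?thesis by (rule that) (use True in auto)
next
  case False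
  let ?d = "card (B \<inter> D)"
  have d: "?d > 0" using False finite_sub[OF assms(1)] by (simp add: card_gt_0_iff)
  have ad: "a + ?d \<le> card B"
  proof -
    have "a + ?d - 1 \<in> pos B ` (B \<inter> D)" using a d by simp
    then have "a + ?d - 1 \<in> {..<card B}" using pos_bij[OF assms(1)] by (auto simp: bij_betw_def)
    then show ?thesis using d by simp
  qed
  show ?thesis
  proof (rule that[of "(a + s) div h" "(a + ?d - 1 + s) div h"])
    fix j assume j: "j \<in> chunk B h s ` (B \<inter> D)" "j \<noteq> (a + s) div h" "j \<noteq> (a + ?d - 1 + s) div h"
    have "chunk B h s ` (B \<inter> D) = (\<lambda>i. (i + s) div h) ` {a..<a + ?d}"
      unfolding a[symmetric] by (auto simp: chunk_def image_image)
    then obtain i where i: "a \<le> i" "i < a + ?d" "j = (i + s) div h" using j(1) by auto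
    have "(a + s) div h < j" using i j(2) by (metis add_le_cancel_right div_le_mono le_neq_implies_less)
    \<comment> \<open>In particular \<open>s < j * h\<close>, so \<open>j * h - s\<close> below is a
      genuine difference of naturals.\<close>
    then have lo: "a + s < j * h" using assms(2) by (simp add: div_less_iff_less_mult)
    have "j < (a + ?d - 1 + s) div h"
    proof -
      have "i + s \<le> a + ?d - 1 + s" using i(2) by simp
      then have "j \<le> (a + ?d - 1 + s) div h" unfolding i(3) by (rule div_le_mono)
      then show ?thesis using j(3) by simp
    qed
    then have "Suc j * h \<le> a + ?d - 1 + s"
      using assms(2) by (metis Suc_leI less_eq_div_iff_mult_less_eq)
    then have hi: "j * h + h \<le> a + ?d - 1 + s" by simp
    have iff: "chunk B h s x = j \<longleftrightarrow> pos B x \<in> {j * h - s..<j * h + h - s}" for x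
    proof -
      have "(pos B x + s) div h = j \<longleftrightarrow> j * h \<le> pos B x + s \<and> pos B x + s < j * h + h"
        using div_nat_eqI[of h j "pos B x + s"] dividend_less_div_times[OF assms(2), of "pos B x + s"]
        by (auto simp: mult.commute)
      then show ?thesis unfolding chunk_def using lo by (simp add: le_diff_conv less_diff_conv)
    qed
    have sub: "{j * h - s..<j * h + h - s} \<subseteq> {a..<a + ?d}" using lo hi by auto
    have eq: "{x \<in> B. chunk B h s x = j} = {x \<in> B. pos B x \<in> {j * h - s..<j * h + h - s}}"
      using iff by blast
    have "{x \<in> B. chunk B h s x = j} \<subseteq> D"
    proof
      fix x assume x: "x \<in> {x \<in> B. chunk B h s x = j}"
      then have "pos B x \<in> pos B ` (B \<inter> D)" using eq sub a by blast
      then show "x \<in> D" using x pos_inj[OF assms(1)] by (auto dest: inj_onD)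
    qed
    moreover have "card {x \<in> B. chunk B h s x = j} = h"
    proof -
      have "pos B ` {x \<in> B. chunk B h s x = j} = {j * h - s..<j * h + h - s}"
      proof -
        have "{j * h - s..<j * h + h - s} \<subseteq> pos B ` B"
          using sub ad pos_bij[OF assms(1)] by (auto simp: bij_betw_def)
        then show ?thesis unfolding eq by auto
      qed
      moreover have "inj_on (pos B) {x \<in> B. chunk B h s x = j}"
        using pos_inj[OF assms(1)] by (auto simp: inj_on_def)
      ultimately have "card {x \<in> B. chunk B h s x = j} = card {j * h - s..<j * h + h - s}"
        using card_image[of "pos B" "{x \<in> B. chunk B h s x = j}"] by simp
      then show ?thesis using lo by simp
    qed
    ultimately show "{x \<in> B. chunk B h s x = j} \<subseteq> D \<and> card {x \<in> B. chunk B h s x = j} = h" ..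
  qed
qed

lemma chunk_ends:
  assumes "B \<subseteq> X" "v \<in> N" "0 < h"
  obtains j1 j2 where "\<And>j. \<lbrakk>j \<in> chunk B h s ` (B \<inter> L v); j \<noteq> j1; j \<noteq> j2\<rbrakk> \<Longrightarrow>
    {x \<in> B. chunk B h s x = j} \<subseteq> L v \<and> card {x \<in> B. chunk B h s x = j} = h"
proof (cases "B \<inter> L v = {}")
  case True
  show ?thesis by (rule that) (use True in auto)
next
  case False
  then obtain a where "pos B ` (B \<inter> L v) = {a..<a + card (B \<inter> L v)}"
    using pos_interval[OF assms(1,2)] by blast
  from chunk_ends_aux[OF assms(1,3) this] that show ?thesis by blast
qed

lemma partial_chunks:
  assumes "B \<subseteq> X" "0 < h"
  obtains j1 j2 where "\<And>j. \<lbrakk>j \<in> chunk B h s ` B; j \<noteq> j1; j \<noteq> j2\<rbrakk> \<Longrightarrow>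
    card {x \<in> B. chunk B h s x = j} = h"
proof -
  have "B \<inter> B = B" by simp
  then have "pos B ` (B \<inter> B) = {0..<0 + card (B \<inter> B)}"
    using pos_bij[OF assms(1)] by (simp add: bij_betw_def atLeast0LessThan)
  from chunk_ends_aux[OF assms this] that show ?thesis by (metis Int_absorb)
qed

text \<open>Leftover chunks are later packed in groups of consecutive ones; contiguity bounds how
  many groups an edge meets.\<close>

lemma chunk_convex:
  assumes "B \<subseteq> X" "v \<in> N" "i \<in> chunk B h s ` (B \<inter> L v)" "l \<in> chunk B h s ` (B \<inter> L v)"
    "j \<in> chunk B h s ` B" "i \<le> j" "j \<le> l"
  shows "j \<in> chunk B h s ` (B \<inter> L v)"
proof -
  obtain x z y where x: "x \<in> B" "x \<in> L v" "i = chunk B h s x" and z: "z \<in> B" "z \<in> L v" "l = chunk B h s z"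
    and y: "y \<in> B" "j = chunk B h s y" using assms(3-5) by blast
  consider "rank y \<le> rank x" | "rank z \<le> rank y" | "rank x \<le> rank y" "rank y \<le> rank z" by linarith
  then show ?thesis
  proof cases
    case 1
    then have "j \<le> i" using chunk_mono[OF assms(1) y(1) x(1)] x y by simp
    then show ?thesis using assms(3,6) by (metis order.antisym)
  next
    case 2
    then have "l \<le> j" using chunk_mono[OF assms(1) z(1) y(1)] z y by simp
    then show ?thesis using assms(4,7) by (metis order.antisym)
  next
    case 3
    then have "y \<in> L v" using rank_convex[OF assms(2) x(2) z(2), of y] y assms(1) by blast
    then show ?thesis using y by blast
  qed
qed

text \<open>The capacity turns a number of terminals below an edge into a number of tours using
  it.\<close>

lemma load_le:
  assumes "\<And>t. card {x \<in> X. \<tau> x = t} \<le> k" "v \<in> N"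
  shows "card (L v) \<le> k * card (\<tau> ` L v)"
proof -
  have "card (L v) = card (\<Union>t\<in>\<tau> ` L v. {x \<in> L v. \<tau> x = t})" by (rule arg_cong[of _ _ card]) auto
  also have "\<dots> \<le> (\<Sum>t\<in>\<tau> ` L v. card {x \<in> L v. \<tau> x = t})"
    using finite_L[OF assms(2)] by (intro card_UN_le) simp
  also have "\<dots> \<le> (\<Sum>t\<in>\<tau> ` L v. k)"
  proof (rule sum_mono)
    fix t
    have "card {x \<in> L v. \<tau> x = t} \<le> card {x \<in> X. \<tau> x = t}"
      using finite_X L_subset[OF assms(2)] by (intro card_mono) auto
    then show "card {x \<in> L v. \<tau> x = t} \<le> k" using assms(1) le_trans by blast
  qed
  finally show ?thesis by (simp add: mult.commute)
qed

end

section \<open>Regrouping for \<open>\<epsilon> \<ge> 1/3\<close>\<close>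

text \<open>Double counting, for bounding the number of labels in a component when each holds at
  least \<open>m\<close> of its terminals.\<close>

lemma card_image_mult_le:
  assumes "finite S" and "\<And>x. x \<in> S \<Longrightarrow> m \<le> real (card {y \<in> S. f y = f x})"
  shows "m * real (card (f ` S)) \<le> real (card S)"
proof -
  have "m * real (card (f ` S)) = (\<Sum>t\<in>f ` S. m)" by simp
  also have "\<dots> \<le> (\<Sum>t\<in>f ` S. real (card {y \<in> S. f y = t}))"
    using assms(2) by (intro sum_mono) auto
  also have "\<dots> = real (card S)"
    using sum.image_gen[OF assms(1), of "\<lambda>_. 1::real" f] by simp
  finally show ?thesis .
qed

lemma card_eq_sum_fibres:
  assumes "finite S" "f ` {x \<in> S. P x} \<subseteq> T" "finite T"
  shows "real (card {x \<in> S. P x}) = (\<Sum>t\<in>T. real (card {x \<in> S. P x \<and> f x = t}))"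
proof -
  have "(\<Sum>t\<in>T. sum (\<lambda>_. 1::real) {x \<in> {x \<in> S. P x}. f x = t}) = sum (\<lambda>_. 1) {x \<in> S. P x}"
    using assms by (intro sum.group) auto
  then show ?thesis by (simp add: conj_commute conj_left_commute)
qed

text \<open>Here \<open>p\<close> is the weight of the edges below which a tour has big pieces, \<open>u\<close> the weight of its edges
  above component roots, and \<open>b * k\<close> the total size of its big pieces. Breaking them up costs an extra
  \<open>b * p\<close>, keeping them an extra \<open>(1 - b) * u\<close>.\<close>
lemma break_or_keep:
  fixes b \<epsilon> p u :: real
  assumes "0 \<le> p" "0 \<le> u" "b \<le> 1" "1/3 \<le> \<epsilon>" "\<epsilon> \<le> 1"
    and gt: "\<epsilon> * p + 2/3 * \<epsilon> * u < b * p"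
  shows "(1 - b - 2/3 * \<epsilon>) * u \<le> \<epsilon> * p"
proof (cases "1 - b - 2/3 * \<epsilon> \<le> 0")
  case True
  then have "(1 - b - 2/3 * \<epsilon>) * u \<le> 0" using assms(2) by (simp add: mult_nonpos_nonneg)
  also have "0 \<le> \<epsilon> * p" using assms by simp
  finally show ?thesis .
next
  case False
  let ?d = "1 - b - 2/3 * \<epsilon>"
  \<comment> \<open>The two factors sum to \<open>1 - 5/3 * \<epsilon>\<close>, so their product is
    at most a quarter of its square. For \<epsilon> between 0 and 1 the estimate
    \<open>\<bar>1 - 5/3 * \<epsilon>\<bar> \<le> 4/3 * \<epsilon>\<close> says exactly
    \<open>1/3 \<le> \<epsilon>\<close>.\<close>
  have sq: "(b - \<epsilon>) * ?d \<le> 2/3 * \<epsilon>\<^sup>2"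
  proof -
    have "4 * (x * y) \<le> (x + y)\<^sup>2" for x y :: real
      using zero_le_power2[of "x - y"] by (simp add: power2_eq_square algebra_simps)
    from this[of "b - \<epsilon>" ?d] have "4 * ((b - \<epsilon>) * ?d) \<le> (1 - 5/3 * \<epsilon>)\<^sup>2"
      by (simp add: diff_diff_eq2)
    also have "\<dots> \<le> (4/3 * \<epsilon>)\<^sup>2" 
    proof -
      have "\<bar>1 - 5/3 * \<epsilon>\<bar> \<le> 4/3 * \<epsilon>" using assms(4,5) by (intro abs_leI) linarith+
      then show ?thesis using assms(4) by (subst power2_le_iff_abs_le) auto
    qed
    finally have "4 * ((b - \<epsilon>) * ?d) \<le> 16/9 * \<epsilon>\<^sup>2" by (simp add: power2_eq_square)
    moreover have "0 \<le> \<epsilon>\<^sup>2" by simp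
    ultimately show ?thesis by linarith
  qed
  \<comment> \<open>Scaling by \<open>2/3 * \<epsilon>\<close> lets \<open>gt\<close>, read as
    \<open>2/3 * \<epsilon> * u < (b - \<epsilon>) * p\<close>, replace \<open>u\<close> by
    \<open>p\<close>.\<close>
  have "2/3 * \<epsilon> * (?d * u) = ?d * (2/3 * \<epsilon> * u)" by (simp add: algebra_simps)
  also have "\<dots> \<le> ?d * ((b - \<epsilon>) * p)"
    using False gt by (intro mult_left_mono) (auto simp: algebra_simps)
  also have "\<dots> = ((b - \<epsilon>) * ?d) * p" by (simp add: algebra_simps)
  also have "\<dots> \<le> (2/3 * \<epsilon>\<^sup>2) * p" using sq assms(1) by (rule mult_right_mono)
  also have "\<dots> = 2/3 * \<epsilon> * (\<epsilon> * p)" by (simp add: power2_eq_square)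
  finally show ?thesis using assms(4) by (simp add: mult_le_cancel_left mult.commute)
qed

context laminar_routing
begin

text \<open>A tour that stays inside one component may be small there, as it can be padded with dummies.\<close>
definition admissible :: "real \<Rightarrow> ('a \<Rightarrow> 'l) \<Rightarrow> bool" where
  "admissible \<alpha> q \<longleftrightarrow>
     (\<forall>l. card {x \<in> X. q x = l} \<le> k) \<and>
     (\<forall>l. (\<exists>c. \<forall>x\<in>X. q x = l \<longrightarrow> comp x = c) \<or>
          (\<forall>x\<in>X. q x = l \<longrightarrow> \<alpha> * real k \<le> real (card {y \<in> X. q y = l \<and> comp y = comp x}))) \<and>
     (\<forall>c. real (card (q ` {x \<in> X. comp x = c})) \<le> 2 * \<Gamma> / \<alpha> + 1)"

text \<open>Half the routing cost; the factor 2 returns when passing from and to solutions.\<close>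

definition cost :: "('a \<Rightarrow> 'l) \<Rightarrow> real" where
  "cost q = (\<Sum>v\<in>N. wt v * real (card (q ` L v)))"

text \<open>The case split of the cost analysis. If \<open>below v\<close> is empty (a low edge),
  each tour has at most one piece under the edge; otherwise (a high edge) at least \<Gamma> tours
  use it.\<close>

definition below :: "'b \<Rightarrow> 'c set" where
  "below v = comp ` L v - {own v}"

definition piece :: "('a \<Rightarrow> 't) \<Rightarrow> 'a \<Rightarrow> 'a set" where
  "piece \<tau> x = {y \<in> X. \<tau> y = \<tau> x \<and> comp y = comp x}"

lemma piece_cong: "\<lbrakk>\<tau> y = \<tau> x; comp y = comp x\<rbrakk> \<Longrightarrow> piece \<tau> y = piece \<tau> x"
  by (simp add: piece_def)

lemma finite_below: "v \<in> N \<Longrightarrow> finite (below v)"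
  unfolding below_def using finite_L by blast

lemma comp_own: "\<lbrakk>below v = {}; x \<in> L v\<rbrakk> \<Longrightarrow> comp x = own v"
  by (auto simp: below_def)

lemma heavy_hits:
  assumes "\<And>t. card {x \<in> X. \<tau> x = t} \<le> k" "v \<in> N" "below v \<noteq> {}"
  shows "\<Gamma> \<le> real (card (\<tau> ` L v))"
    and "\<Gamma> * real (card (below v)) \<le> 3 * real (card (\<tau> ` L v))"
proof -
  have kp: "0 < real k" using k_pos by simp
  have l: "real (card (L v)) \<le> real k * real (card (\<tau> ` L v))"
    using load_le[OF assms(1,2)] by (simp only: of_nat_mult[symmetric] of_nat_le_iff)
  have "\<Gamma> * real k \<le> real (card (\<tau> ` L v)) * real k"
    using below_heavy[OF assms(2)] assms(3) l by (simp add: below_def mult.commute)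
  then show "\<Gamma> \<le> real (card (\<tau> ` L v))" using kp by simp
  have "(\<Gamma> * real (card (below v))) * real k \<le> (3 * real (card (\<tau> ` L v))) * real k"
    using below_few[OF assms(2)] l by (simp add: below_def mult.commute mult.left_commute)
  then show "\<Gamma> * real (card (below v)) \<le> 3 * real (card (\<tau> ` L v))" using kp by simp
qed

text \<open>Costs are charged to the original tours: \<open>vertex\<close> distributes the labels
  seen at an edge over the tours using it, and \<open>tour\<close> limits the extra charge of each
  tour to \<epsilon> times the weight of its edges.\<close>

theorem coarse_regrouping:
  fixes \<tau> :: "'a \<Rightarrow> 't" and \<epsilon> \<alpha> :: real
  assumes cap: "\<And>t. card {x \<in> X. \<tau> x = t} \<le> k"
    and eps: "1/3 \<le> \<epsilon>" "\<epsilon> \<le> 1" and Gam: "\<Gamma> = 12 / \<epsilon>" and alp: "0 < \<alpha>" "\<alpha> \<le> \<epsilon>"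
  shows "\<exists>q :: 'a \<Rightarrow> 't + 'c \<times> nat. admissible \<alpha> q \<and> cost q \<le> (1 + \<epsilon>) * cost \<tau>"
proof -
  have kp: "0 < real k" using k_pos by simp
  define big where "big x \<longleftrightarrow> \<epsilon> * real k < real (card (piece \<tau> x))" for x
  have big_cong: "big y = big x" if "\<tau> y = \<tau> x" "comp y = comp x" for x y
    using piece_cong[OF that] by (simp add: big_def)
  define K where "K t = {x \<in> X. \<tau> x = t \<and> big x}" for t
  define b where "b t = real (card (K t)) / real k" for t
  define p where "p t = (\<Sum>v | v \<in> N \<and> below v = {} \<and> K t \<inter> L v \<noteq> {}. wt v)" for t
  define u where "u t = (\<Sum>v | v \<in> N \<and> below v \<noteq> {} \<and> t \<in> \<tau> ` L v. wt v)" for t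
  \<comment> \<open>Breaking up the big pieces costs \<open>b t * p t\<close>. The allowance is
    \<open>\<epsilon> * p t\<close> plus \<open>2/3\<close> of \<open>\<epsilon> * u t\<close>, the
    last third being reserved for rounding at high edges. Pieces are kept when the allowance is
    exceeded.\<close>
  define keep where "keep t \<longleftrightarrow> \<epsilon> * p t + 2/3 * \<epsilon> * u t < b t * p t" for t
  define kept where "kept x \<longleftrightarrow> big x \<and> keep (\<tau> x)" for x
  have kept_cong: "kept y = kept x" if "\<tau> y = \<tau> x" "comp y = comp x" for x y
    using big_cong[OF that] that by (simp add: kept_def)
  define B where "B c = {x \<in> X. \<not> kept x \<and> comp x = c}" for c
  have BX: "B c \<subseteq> X" for c by (auto simp: B_def)
  have finB: "finite (B c)" for c using BX finite_sub by blast
  \<comment> \<open>The quotient rounded up. An offset may create one chunk more; folding indices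
    modulo \<open>n c\<close> avoids it, and the \<open>+ 1\<close> in the bound on tours per
    component pays for the rounding.\<close>
  define n where "n c = (card (B c) + (k - 1)) div k" for c
  have n1: "card (B c) \<le> n c * k" for c
  proof -
    have "card (B c) + (k - 1) < n c * k + k"
      unfolding n_def using dividend_less_div_times[of k "card (B c) + (k - 1)"] k_pos by simp
    then show ?thesis using k_pos by simp
  qed
  have n2: "real (n c) \<le> real (card (B c)) / real k + 1" for c
  proof -
    have "real (n c) \<le> real (card (B c) + (k - 1)) / real k" unfolding n_def by (rule of_nat_div_le_of_nat)
    also have "\<dots> \<le> (real (card (B c)) + real k) / real k" using kp by (intro divide_right_mono) auto
    also have "\<dots> = real (card (B c)) / real k + 1" using kp by (simp add: add_divide_distrib)
    finally show ?thesis .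
  qed
  obtain s where s:
    "(\<Sum>v\<in>N. wt v * real (card (chunk (B (own v)) k (s (own v)) ` (B (own v) \<inter> L v)))) \<le>
     (\<Sum>v\<in>N. wt v * (if B (own v) \<inter> L v = {} then 0
                   else 1 + real (card (B (own v) \<inter> L v)) / real k))"
    using good_shifts[of B N k] BX k_pos by auto
  define ch where "ch x = chunk (B (comp x)) k (s (comp x)) x" for x
  define q :: "'a \<Rightarrow> 't + 'c \<times> nat" where
    "q x = (if kept x then Inl (\<tau> x) else Inr (comp x, ch x mod n (comp x)))" for x
  have npos: "0 < n (comp x)" if "x \<in> X" "\<not> kept x" for x
  proof -
    have "x \<in> B (comp x)" using that by (simp add: B_def)
    then have "0 < card (B (comp x))" using finB by (auto simp: card_gt_0_iff)
    then show ?thesis using n1[of "comp x"] by (cases "n (comp x)") auto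
  qed

  \<comment> \<open>Capacity, density and number of tours after the coarse regrouping\<close>
  have adm: "admissible \<alpha> q"
    unfolding admissible_def
  proof (intro conjI allI)
    fix l
    show "card {x \<in> X. q x = l} \<le> k"
    proof (cases l)
      case (Inl t)
      have "card {x \<in> X. q x = l} \<le> card {x \<in> X. \<tau> x = t}"
        using finite_X by (intro card_mono) (auto simp: q_def Inl split: if_splits)
      then show ?thesis using cap le_trans by blast
    next
      case (Inr cj)
      obtain c j where cj: "cj = (c, j)" by fastforce
      have "card {x \<in> X. q x = l} \<le> card {x \<in> B c. chunk (B c) k (s c) x mod n c = j}"
      proof (rule card_mono)
        show "{x \<in> X. q x = l} \<subseteq> {x \<in> B c. chunk (B c) k (s c) x mod n c = j}"
        proof
          fix x assume "x \<in> {x \<in> X. q x = l}"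
          then have "x \<in> X" "\<not> kept x" "comp x = c" "ch x mod n (comp x) = j"
            by (auto simp: q_def Inr cj split: if_splits)
          then show "x \<in> {x \<in> B c. chunk (B c) k (s c) x mod n c = j}"
            by (simp add: B_def[of c] ch_def)
        qed
      qed (use finB in simp)
      also have "\<dots> \<le> k" using chunk_mod_card_le[OF BX _ n1] k_pos by simp
      finally show ?thesis .
    qed
    show "(\<exists>c. \<forall>x\<in>X. q x = l \<longrightarrow> comp x = c) \<or>
          (\<forall>x\<in>X. q x = l \<longrightarrow> \<alpha> * real k \<le> real (card {y \<in> X. q y = l \<and> comp y = comp x}))"
    proof (cases l)
      case (Inl t)
      have "\<alpha> * real k \<le> real (card {y \<in> X. q y = l \<and> comp y = comp x})" if "x \<in> X" "q x = l" for x
      proof -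
        have x: "kept x" "\<tau> x = t" using that by (auto simp: q_def Inl split: if_splits)
        have "piece \<tau> x \<subseteq> {y \<in> X. q y = l \<and> comp y = comp x}"
        proof
          fix y assume "y \<in> piece \<tau> x"
          then have y: "y \<in> X" "\<tau> y = \<tau> x" "comp y = comp x" by (simp_all add: piece_def)
          then show "y \<in> {y \<in> X. q y = l \<and> comp y = comp x}"
            using kept_cong[OF y(2,3)] x by (simp add: q_def Inl)
        qed
        then have "card (piece \<tau> x) \<le> card {y \<in> X. q y = l \<and> comp y = comp x}"
          using finite_X by (intro card_mono) auto
        moreover have "\<epsilon> * real k < real (card (piece \<tau> x))" using x by (simp add: kept_def big_def)
        moreover have "\<alpha> * real k \<le> \<epsilon> * real k" using alp kp by simp
        ultimately show ?thesis by linarith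
      qed
      then show ?thesis by blast
    next
      case (Inr cj)
      then show ?thesis by (auto simp: q_def split: if_splits)
    qed
  next
    fix c
    let ?Kc = "{x \<in> X. comp x = c \<and> kept x}"
    have sub: "q ` {x \<in> X. comp x = c} \<subseteq> Inl ` (\<tau> ` ?Kc) \<union> (\<lambda>j. Inr (c, j)) ` {..<n c}"
      using npos by (auto simp: q_def)
    have finK: "finite ?Kc" using finite_X by simp
    have "card (q ` {x \<in> X. comp x = c}) \<le> card (Inl ` (\<tau> ` ?Kc) \<union> (\<lambda>j. Inr (c, j)) ` {..<n c})"
      using sub finK by (intro card_mono) auto
    also have "\<dots> \<le> card (Inl ` (\<tau> ` ?Kc) :: ('t + 'c \<times> nat) set)
        + card ((\<lambda>j. Inr (c, j)) ` {..<n c} :: ('t + 'c \<times> nat) set)"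
      by (rule card_Un_le)
    also have "\<dots> = card (\<tau> ` ?Kc) + n c" by (simp add: card_image inj_on_def)
    finally have 1: "real (card (q ` {x \<in> X. comp x = c})) \<le> real (card (\<tau> ` ?Kc)) + real (n c)"
      by (simp only: of_nat_add[symmetric] of_nat_le_iff)
    have 2: "(\<alpha> * real k) * real (card (\<tau> ` ?Kc)) \<le> real (card ?Kc)"
    proof (rule card_image_mult_le[OF finK])
      fix x assume x: "x \<in> ?Kc"
      have "piece \<tau> x \<subseteq> {y \<in> ?Kc. \<tau> y = \<tau> x}"
      proof
        fix y assume "y \<in> piece \<tau> x"
        then have y: "y \<in> X" "\<tau> y = \<tau> x" "comp y = comp x" by (simp_all add: piece_def)
        then show "y \<in> {y \<in> ?Kc. \<tau> y = \<tau> x}" using kept_cong[OF y(2,3)] x by simp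
      qed
      then have "card (piece \<tau> x) \<le> card {y \<in> ?Kc. \<tau> y = \<tau> x}"
        using finite_X by (intro card_mono) auto
      moreover have "\<epsilon> * real k < real (card (piece \<tau> x))" using x by (simp add: kept_def big_def)
      moreover have "\<alpha> * real k \<le> \<epsilon> * real k" using alp kp by simp
      ultimately show "\<alpha> * real k \<le> real (card {y \<in> ?Kc. \<tau> y = \<tau> x})" by linarith
    qed
    have "card ?Kc + card (B c) = card (?Kc \<union> B c)"
      using finK finB by (intro card_Un_disjoint[symmetric]) (auto simp: B_def)
    also have "?Kc \<union> B c = {x \<in> X. comp x = c}" by (auto simp: B_def)
    finally have 3: "real (card ?Kc) + real (card (B c)) \<le> 2 * \<Gamma> * real k"
      using comp_size[of c] by linarith
    have ak: "0 < \<alpha> * real k" using alp kp by simp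
    have "\<alpha> * real k \<le> 1 * real k" using alp eps kp by (intro mult_right_mono) auto
    then have "real (card (B c)) / real k \<le> real (card (B c)) / (\<alpha> * real k)"
      using ak by (intro divide_left_mono) auto
    moreover have "real (card (\<tau> ` ?Kc)) \<le> real (card ?Kc) / (\<alpha> * real k)"
      using 2 ak by (simp add: pos_le_divide_eq mult.commute)
    moreover have "real (card ?Kc) / (\<alpha> * real k) + real (card (B c)) / (\<alpha> * real k)
        \<le> (2 * \<Gamma> * real k) / (\<alpha> * real k)"
      using divide_right_mono[OF 3 less_imp_le[OF ak]] by (simp only: add_divide_distrib)
    moreover have "(2 * \<Gamma> * real k) / (\<alpha> * real k) = 2 * \<Gamma> / \<alpha>" using kp by simp
    ultimately show "real (card (q ` {x \<in> X. comp x = c})) \<le> 2 * \<Gamma> / \<alpha> + 1"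
      using 1 n2[of c] by linarith
  qed

  \<comment> \<open>Charging the coarse regrouping to the original tours\<close>
  define e where "e v = real (card (chunk (B (own v)) k (s (own v)) ` (B (own v) \<inter> L v)))" for v
  define a where "a v = (if B (own v) \<inter> L v = {} then 0 else 1 + real (card (B (own v) \<inter> L v)) / real k)" for v
  define br where "br t v = real (card {x \<in> L v. \<not> kept x \<and> \<tau> x = t})" for t v
  \<comment> \<open>Charge to \<open>t\<close> at \<open>v\<close> beyond the unit it already pays.
    On a low edge it is the tour's share of full chunks. On a high edge a broken-up tour trades its
    unit for at most one unit of chunks, a kept tour sheds at most \<open>1 - b t\<close>, and
    \<open>\<epsilon> / 3\<close> covers rounding.\<close>
  define xt where "xt t v = (if below v = {} then br t v / real k
      else (if keep t then 1 - b t else 0) + \<epsilon> / 3)" for t v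
  have hits: "real (card (q ` L v)) \<le> real (card (\<tau> ` {x \<in> L v. kept x})) + e v + (\<Sum>c\<in>below v. real (n c))"
    if v: "v \<in> N" for v
  proof -
    let ?I = "Inl ` (\<tau> ` {x \<in> L v. kept x}) :: ('t + 'c \<times> nat) set"
    let ?E = "(\<lambda>j. Inr (own v, j mod n (own v))) ` (chunk (B (own v)) k (s (own v)) ` (B (own v) \<inter> L v))
      :: ('t + 'c \<times> nat) set"
    let ?F = "(\<Union>c\<in>below v. (\<lambda>j. Inr (c, j)) ` {..<n c}) :: ('t + 'c \<times> nat) set"
    have fin: "finite (L v)" "finite (below v)" using v finite_L finite_below by auto
    have "q ` L v \<subseteq> ?I \<union> ?E \<union> ?F"
    proof
      fix l assume "l \<in> q ` L v"
      then obtain x where x: "x \<in> L v" "l = q x" by blast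
      have xX: "x \<in> X" using x v L_subset by blast
      show "l \<in> ?I \<union> ?E \<union> ?F"
      proof (cases "kept x")
        case True
        then show ?thesis using x by (auto simp: q_def)
      next
        case False
        show ?thesis
        proof (cases "comp x = own v")
          case True
          have "x \<in> B (own v) \<inter> L v" using x xX False True by (auto simp: B_def)
          then have "l \<in> ?E" using False True x by (auto simp: q_def ch_def)
          then show ?thesis by blast
        next
          case False': False
          then have "comp x \<in> below v" using x by (auto simp: below_def)
          then have "l \<in> ?F" using False npos[OF xX] x by (auto simp: q_def intro!: bexI[of _ "comp x"])
          then show ?thesis by blast
        qed
      qed
    qed
    then have "card (q ` L v) \<le> card (?I \<union> ?E \<union> ?F)" using fin finB by (intro card_mono) auto
    also have "\<dots> \<le> card ?I + card ?E + card ?F" by (meson add_le_mono1 card_Un_le le_trans)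
    finally have "real (card (q ` L v)) \<le> real (card ?I) + real (card ?E) + real (card ?F)"
      by (simp only: of_nat_add[symmetric] of_nat_le_iff)
    moreover have "real (card ?I) = real (card (\<tau> ` {x \<in> L v. kept x}))" by (simp add: card_image)
    moreover have "real (card ?E) \<le> e v"
      unfolding e_def using finB by (intro of_nat_mono card_image_le) auto
    moreover have "real (card ?F) \<le> (\<Sum>c\<in>below v. real (n c))"
    proof -
      have "card ?F \<le> (\<Sum>c\<in>below v. card ((\<lambda>j. Inr (c, j)) ` {..<n c} :: ('t + 'c \<times> nat) set))"
        using fin by (intro card_UN_le)
      also have "\<dots> \<le> (\<Sum>c\<in>below v. n c)"
        by (intro sum_mono) (metis card_image_le card_lessThan finite_lessThan)
      finally show ?thesis by (simp only: of_nat_sum[symmetric] of_nat_le_iff)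
    qed
    ultimately show ?thesis by linarith
  qed
  have sum_e: "(\<Sum>v\<in>N. wt v * e v) \<le> (\<Sum>v\<in>N. wt v * a v)"
    using s by (simp only: e_def a_def)
  have card_br: "real (card {x \<in> L v. \<not> kept x}) = (\<Sum>t\<in>\<tau> ` L v. br t v)" if "v \<in> N" for v
    unfolding br_def using finite_L[OF that] by (intro card_eq_sum_fibres) auto
  have br_le: "br t v \<le> real (card {x \<in> X. \<tau> x = t \<and> \<not> kept x})" if "v \<in> N" for t v
    unfolding br_def using finite_X L_subset[OF that] by (intro of_nat_mono card_mono) auto
  have vertex: "real (card (\<tau> ` {x \<in> L v. kept x})) + a v + (\<Sum>c\<in>below v. real (n c)) \<le>
      (\<Sum>t\<in>\<tau> ` L v. 1 + xt t v)" if v: "v \<in> N" for v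
  proof (cases "below v = {}")
    case low: True
    have eqB: "B (own v) \<inter> L v = {x \<in> L v. \<not> kept x}"
      using comp_own[OF low] L_subset[OF v] by (auto simp: B_def)
    have "real (card (\<tau> ` {x \<in> L v. kept x})) + (if B (own v) \<inter> L v = {} then 0 else 1)
        \<le> real (card (\<tau> ` L v))"
    proof (cases "B (own v) \<inter> L v = {}")
      case True
      then show ?thesis using finite_L[OF v] by (auto intro!: card_mono)
    next
      \<comment> \<open>The extra chunk is free: a removed terminal lies in the only piece its tour
        has below \<open>v\<close>, so this tour is not among the kept ones there.\<close>
      case False
      then obtain y where y: "y \<in> L v" "\<not> kept y" using eqB by blast
      have "\<tau> y \<notin> \<tau> ` {x \<in> L v. kept x}"
      proof
        assume "\<tau> y \<in> \<tau> ` {x \<in> L v. kept x}"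
        then obtain x where "x \<in> L v" "kept x" "\<tau> y = \<tau> x" by blast
        then show False using kept_cong[of y x] y comp_own[OF low] by simp
      qed
      then have "\<tau> ` {x \<in> L v. kept x} \<subset> \<tau> ` L v" using y by blast
      then have "card (\<tau> ` {x \<in> L v. kept x}) < card (\<tau> ` L v)"
        using finite_L[OF v] by (intro psubset_card_mono) auto
      then show ?thesis using False by simp
    qed
    then have "real (card (\<tau> ` {x \<in> L v. kept x})) + a v
        \<le> real (card (\<tau> ` L v)) + real (card {x \<in> L v. \<not> kept x}) / real k"
      unfolding a_def eqB[symmetric] by (cases "B (own v) \<inter> L v = {}") simp_all
    also have "\<dots> = (\<Sum>t\<in>\<tau> ` L v. 1 + xt t v)"
      unfolding card_br[OF v] xt_def using low by (simp add: sum.distrib sum_divide_distrib)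
    finally show ?thesis using low by simp
  next
    case high: False
    define m where "m = real (card (\<tau> ` L v))"
    have m: "\<Gamma> \<le> m" "\<Gamma> * real (card (below v)) \<le> 3 * m"
      unfolding m_def using heavy_hits[OF cap v high] by auto
    have split: "real (card (B (own v) \<inter> L v)) + (\<Sum>c\<in>below v. real (card (B c)))
        \<le> real (card {x \<in> L v. \<not> kept x})"
    proof -
      have sub: "B c \<subseteq> L v" if "c \<in> below v" for c
        using that below_closed[OF v] by (auto simp: below_def B_def)
      have "(\<Sum>c\<in>below v. card (B c)) = card (\<Union>c\<in>below v. B c)"
        using finB finite_below[OF v] by (intro card_UN_disjoint[symmetric]) (auto simp: B_def)
      moreover have "card (B (own v) \<inter> L v) + card (\<Union>c\<in>below v. B c)
          = card ((B (own v) \<inter> L v) \<union> (\<Union>c\<in>below v. B c))"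
        using finB finite_below[OF v]
        by (intro card_Un_disjoint[symmetric]) (auto simp: B_def below_def)
      moreover have "card ((B (own v) \<inter> L v) \<union> (\<Union>c\<in>below v. B c)) \<le> card {x \<in> L v. \<not> kept x}"
        using sub finite_L[OF v] by (intro card_mono) (auto simp: B_def)
      ultimately have "card (B (own v) \<inter> L v) + (\<Sum>c\<in>below v. card (B c)) \<le> card {x \<in> L v. \<not> kept x}"
        by simp
      then show ?thesis by (simp only: of_nat_add[symmetric] of_nat_sum[symmetric] of_nat_le_iff)
    qed
    have "a v \<le> 1 + real (card (B (own v) \<inter> L v)) / real k" by (simp add: a_def)
    moreover have "(\<Sum>c\<in>below v. real (n c)) \<le> (\<Sum>c\<in>below v. real (card (B c)) / real k + 1)"
      using n2 by (intro sum_mono)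
    moreover have "(\<Sum>c\<in>below v. real (card (B c)) / real k + 1)
        = (\<Sum>c\<in>below v. real (card (B c))) / real k + real (card (below v))"
      by (simp add: sum.distrib sum_divide_distrib)
    moreover have "real (card (B (own v) \<inter> L v)) / real k + (\<Sum>c\<in>below v. real (card (B c))) / real k
        \<le> real (card {x \<in> L v. \<not> kept x}) / real k"
      using split kp by (simp add: add_divide_distrib[symmetric] divide_right_mono)
    \<comment> \<open>One unit for cutting the own component and one for rounding \<open>n c\<close>
      in each component below: at most \<open>4 * m / \<Gamma>\<close>, which is
      \<open>m * (\<epsilon> / 3)\<close>.\<close>
    moreover have "1 + real (card (below v)) \<le> m * (\<epsilon> / 3)"
    proof -
      have "\<Gamma> * (1 + real (card (below v))) \<le> 4 * m" using m by (simp add: algebra_simps)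
      then show ?thesis using eps unfolding Gam by (simp add: field_simps)
    qed
    ultimately have "real (card (\<tau> ` {x \<in> L v. kept x})) + a v + (\<Sum>c\<in>below v. real (n c))
        \<le> real (card (\<tau> ` {x \<in> L v. kept x})) + real (card {x \<in> L v. \<not> kept x}) / real k + m * (\<epsilon> / 3)"
      by linarith
    also have "\<dots> = (\<Sum>t\<in>\<tau> ` L v. (if t \<in> \<tau> ` {x \<in> L v. kept x} then 1 else 0) + br t v / real k + \<epsilon> / 3)"
    proof -
      have "real (card (\<tau> ` {x \<in> L v. kept x})) = (\<Sum>t\<in>\<tau> ` L v. if t \<in> \<tau> ` {x \<in> L v. kept x} then 1 else 0)"
        using finite_L[OF v] by (subst sum.inter_restrict[symmetric]) (auto intro!: arg_cong[of _ _ card])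
      then show ?thesis
        unfolding card_br[OF v] m_def by (simp add: sum.distrib sum_divide_distrib)
    qed
    also have "\<dots> \<le> (\<Sum>t\<in>\<tau> ` L v. 1 + xt t v)"
    proof (rule sum_mono)
      fix t assume t: "t \<in> \<tau> ` L v"
      have "(if t \<in> \<tau> ` {x \<in> L v. kept x} then 1 else 0) + br t v / real k \<le> 1 + (if keep t then 1 - b t else 0)"
      proof (cases "keep t")
        case True
        have "card {x \<in> X. \<tau> x = t \<and> \<not> kept x} + card (K t) = card ({x \<in> X. \<tau> x = t \<and> \<not> kept x} \<union> K t)"
          using finite_X True by (intro card_Un_disjoint[symmetric]) (auto simp: K_def kept_def)
        also have "{x \<in> X. \<tau> x = t \<and> \<not> kept x} \<union> K t = {x \<in> X. \<tau> x = t}"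
          using True by (auto simp: K_def kept_def)
        finally have "real (card {x \<in> X. \<tau> x = t \<and> \<not> kept x}) \<le> real k - real (card (K t))"
          using cap[of t] by linarith
        then have "br t v \<le> real k - real (card (K t))" using br_le[OF v, of t] by linarith
        then have "br t v / real k \<le> 1 - b t"
          using kp by (simp add: b_def field_simps)
        then show ?thesis using True by auto
      next
        case False
        then have "t \<notin> \<tau> ` {x \<in> L v. kept x}" by (auto simp: kept_def)
        moreover have "br t v \<le> real k"
        proof -
          have "card {x \<in> X. \<tau> x = t \<and> \<not> kept x} \<le> card {x \<in> X. \<tau> x = t}"
            using finite_X by (intro card_mono) auto
          then show ?thesis using br_le[OF v, of t] cap[of t] by linarith
        qed
        ultimately show ?thesis using False kp by simp
      qed
      then show "(if t \<in> \<tau> ` {x \<in> L v. kept x} then 1 else 0) + br t v / real k + \<epsilon> / 3 \<le> 1 + xt t v"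
        using high by (simp add: xt_def)
    qed
    finally show ?thesis .
  qed
  have tour: "(\<Sum>v | v \<in> N \<and> t \<in> \<tau> ` L v. wt v * xt t v) \<le> \<epsilon> * (\<Sum>v | v \<in> N \<and> t \<in> \<tau> ` L v. wt v)"
    (is "sum _ ?N \<le> _") for t
  proof -
    let ?P = "{v \<in> N. below v = {} \<and> K t \<inter> L v \<noteq> {}}"
    let ?U = "{v \<in> N. below v \<noteq> {} \<and> t \<in> \<tau> ` L v}"
    \<comment> \<open>\<open>cp\<close> and \<open>cu\<close> bound the excess of the charge over
      \<epsilon> on low edges above big pieces and on high edges. The remaining edges have no
      excess, as a piece that is not big has at most \<open>\<epsilon> * k\<close>
      terminals.\<close>
    define cp where "cp = (if keep t then - \<epsilon> else b t - \<epsilon>)"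
    define cu where "cu = (if keep t then 1 - b t else 0) - 2/3 * \<epsilon>"
    have finN: "finite ?N" using finite_N by simp
    have PN: "?P \<subseteq> ?N" by (auto simp: K_def)
    have UN: "?U \<subseteq> ?N" by auto
    have pt: "wt v * xt t v \<le> wt v * \<epsilon> + ((if v \<in> ?P then wt v * cp else 0) + (if v \<in> ?U then wt v * cu else 0))"
      if v: "v \<in> ?N" for v
    proof -
      have vN: "v \<in> N" and w: "0 \<le> wt v" using v wt_nonneg by auto
      consider (P) "v \<in> ?P" | (U) "v \<in> ?U" | (R) "v \<notin> ?P" "v \<notin> ?U" by blast
      then have "xt t v \<le> \<epsilon> + ((if v \<in> ?P then cp else 0) + (if v \<in> ?U then cu else 0))"
      proof cases
        case P
        then obtain y where y: "y \<in> L v" "\<tau> y = t" "big y" by (auto simp: K_def)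
        have "x \<in> K t" if "x \<in> L v" "\<tau> x = t" for x
          using that y big_cong[of x y] comp_own[of v] P L_subset[OF vN] by (auto simp: K_def)
        then have sub: "{x \<in> L v. \<not> kept x \<and> \<tau> x = t} \<subseteq> (if keep t then {} else K t)"
          by (auto simp: kept_def K_def)
        have "br t v \<le> real (card (if keep t then {} else K t))"
          unfolding br_def using finite_X by (intro of_nat_mono card_mono sub) (auto simp: K_def)
        then have "br t v / real k \<le> (if keep t then 0 else b t)"
          using kp by (auto simp: b_def divide_right_mono divide_nonpos_pos split: if_splits)
        then show ?thesis using P by (auto simp: xt_def cp_def)
      next
        case U
        then show ?thesis by (auto simp: xt_def cu_def)
      next
        case R
        have low: "below v = {}" using R v by auto
        obtain y where y: "y \<in> L v" "\<tau> y = t" using v by auto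
        have "\<not> big y" using R low y vN L_subset by (auto simp: K_def)
        then have "real (card (piece \<tau> y)) \<le> \<epsilon> * real k" by (simp add: big_def)
        moreover have "br t v \<le> real (card (piece \<tau> y))"
          unfolding br_def using finite_X L_subset[OF vN] y comp_own[OF low]
          by (intro of_nat_mono card_mono) (auto simp: piece_def)
        ultimately have "br t v / real k \<le> \<epsilon>" using kp by (simp add: pos_divide_le_eq)
        then show ?thesis using R low by (auto simp: xt_def)
      qed
      then have "wt v * xt t v \<le> wt v * (\<epsilon> + ((if v \<in> ?P then cp else 0) + (if v \<in> ?U then cu else 0)))"
        using w by (rule mult_left_mono)
      also have "\<dots> = wt v * \<epsilon> + ((if v \<in> ?P then wt v * cp else 0) + (if v \<in> ?U then wt v * cu else 0))"
        by (cases "v \<in> ?P"; cases "v \<in> ?U") (simp_all only: if_True if_False distrib_left mult_zero_right)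
      finally show ?thesis .
    qed
    have "(\<Sum>v\<in>?N. wt v * xt t v) \<le> (\<Sum>v\<in>?N. wt v * \<epsilon> +
        ((if v \<in> ?P then wt v * cp else 0) + (if v \<in> ?U then wt v * cu else 0)))"
      using pt by (rule sum_mono)
    also have "\<dots> = \<epsilon> * (\<Sum>v\<in>?N. wt v) + ((\<Sum>v\<in>?P. wt v * cp) + (\<Sum>v\<in>?U. wt v * cu))"
    proof -
      have "(\<Sum>v\<in>?N. if v \<in> ?P then wt v * cp else 0) = (\<Sum>v\<in>?P. wt v * cp)"
        using sum.inter_restrict[OF finN, of "\<lambda>v. wt v * cp" ?P] PN by (simp add: Int_absorb1)
      moreover have "(\<Sum>v\<in>?N. if v \<in> ?U then wt v * cu else 0) = (\<Sum>v\<in>?U. wt v * cu)"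
        using sum.inter_restrict[OF finN, of "\<lambda>v. wt v * cu" ?U] UN by (simp add: Int_absorb1)
      ultimately show ?thesis by (simp only: sum.distrib) (simp add: sum_distrib_left mult.commute)
    qed
    also have "(\<Sum>v\<in>?P. wt v * cp) = cp * p t" by (simp add: p_def sum_distrib_left mult.commute)
    also have "(\<Sum>v\<in>?U. wt v * cu) = cu * u t" by (simp add: u_def sum_distrib_left mult.commute)
    \<comment> \<open>For broken-up pieces this is the negation of \<open>keep\<close>; for kept
      ones it is \<open>break_or_keep\<close>.\<close>
    also have "cp * p t + cu * u t \<le> 0"
    proof (cases "keep t")
      case True
      have "0 \<le> p t" "0 \<le> u t" unfolding p_def u_def using wt_nonneg by (auto intro!: sum_nonneg)
      moreover have "b t \<le> 1"
      proof -
        have "card (K t) \<le> card {x \<in> X. \<tau> x = t}" using finite_X by (intro card_mono) (auto simp: K_def)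
        then have "card (K t) \<le> k" using cap le_trans by blast
        then show ?thesis using kp by (simp add: b_def)
      qed
      ultimately have "(1 - b t - 2/3 * \<epsilon>) * u t \<le> \<epsilon> * p t"
        using True eps unfolding keep_def by (intro break_or_keep) auto
      then show ?thesis using True by (simp add: cp_def cu_def)
    next
      case False
      then show ?thesis by (simp add: keep_def cp_def cu_def algebra_simps)
    qed
    finally show ?thesis by linarith
  qed
  have swap: "(\<Sum>v\<in>N. wt v * (\<Sum>t\<in>\<tau> ` L v. f t v)) = (\<Sum>t\<in>\<tau> ` X. \<Sum>v | v \<in> N \<and> t \<in> \<tau> ` L v. wt v * f t v)"
    for f :: "'t \<Rightarrow> 'b \<Rightarrow> real"
  proof -
    have "(\<Sum>v\<in>N. wt v * (\<Sum>t\<in>\<tau> ` L v. f t v)) = (\<Sum>v\<in>N. \<Sum>t | t \<in> \<tau> ` X \<and> t \<in> \<tau> ` L v. wt v * f t v)"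
    proof (rule sum.cong[OF refl])
      fix v assume "v \<in> N"
      then have "{t. t \<in> \<tau> ` X \<and> t \<in> \<tau> ` L v} = \<tau> ` L v" using L_subset by blast
      then show "wt v * (\<Sum>t\<in>\<tau> ` L v. f t v) = (\<Sum>t | t \<in> \<tau> ` X \<and> t \<in> \<tau> ` L v. wt v * f t v)"
        by (simp add: sum_distrib_left)
    qed
    also have "\<dots> = (\<Sum>t\<in>\<tau> ` X. \<Sum>v | v \<in> N \<and> t \<in> \<tau> ` L v. wt v * f t v)"
      using finite_N finite_X by (intro sum.swap_restrict) auto
    finally show ?thesis .
  qed
  have "cost q \<le> (\<Sum>v\<in>N. wt v * (real (card (\<tau> ` {x \<in> L v. kept x})) + e v + (\<Sum>c\<in>below v. real (n c))))"
    unfolding cost_def using hits wt_nonneg by (intro sum_mono mult_left_mono) auto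
  also have "\<dots> \<le> (\<Sum>v\<in>N. wt v * (real (card (\<tau> ` {x \<in> L v. kept x})) + a v + (\<Sum>c\<in>below v. real (n c))))"
    using sum_e by (simp add: distrib_left sum.distrib)
  also have "\<dots> \<le> (\<Sum>v\<in>N. wt v * (\<Sum>t\<in>\<tau> ` L v. 1 + xt t v))"
    using vertex wt_nonneg by (intro sum_mono mult_left_mono) auto
  also have "\<dots> = (\<Sum>t\<in>\<tau> ` X. \<Sum>v | v \<in> N \<and> t \<in> \<tau> ` L v. wt v * (1 + xt t v))" by (rule swap)
  also have "\<dots> \<le> (\<Sum>t\<in>\<tau> ` X. (1 + \<epsilon>) * (\<Sum>v | v \<in> N \<and> t \<in> \<tau> ` L v. wt v))"
    using tour by (intro sum_mono) (simp add: distrib_left sum.distrib algebra_simps)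
  also have "\<dots> = (1 + \<epsilon>) * (\<Sum>t\<in>\<tau> ` X. \<Sum>v | v \<in> N \<and> t \<in> \<tau> ` L v. wt v * 1)"
    by (simp add: sum_distrib_left)
  also have "\<dots> = (1 + \<epsilon>) * cost \<tau>"
    unfolding swap[of "\<lambda>_ _. 1", symmetric] cost_def by simp
  finally show ?thesis using adm by blast
qed

end

section \<open>Regrouping for \<open>\<epsilon> \<le> 1/3\<close>\<close>

text \<open>Renumbers \<open>I\<close> consecutively from 0, so that division by \<open>J\<close>
  groups the leftover chunks \<open>J\<close> at a time whatever gaps their indices have.\<close>

definition index_in :: "nat set \<Rightarrow> nat \<Rightarrow> nat" where
  "index_in I j = card {i \<in> I. i < j}"

lemma index_in_less:
  assumes "finite I" "i \<in> I" "i < j"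
  shows "index_in I i < index_in I j"
  unfolding index_in_def using assms by (intro psubset_card_mono) auto

lemma index_in_inj: "finite I \<Longrightarrow> inj_on (index_in I) I"
  by (rule linorder_inj_onI) (metis index_in_less less_irrefl, auto)

lemma index_in_image:
  assumes "finite I"
  shows "index_in I ` I = {..<card I}"
proof (rule card_subset_eq)
  show "index_in I ` I \<subseteq> {..<card I}"
  proof
    fix n assume "n \<in> index_in I ` I"
    then obtain j where j: "j \<in> I" "n = index_in I j" by blast
    have "{i \<in> I. i < j} \<subset> I" using j(1) by auto
    then show "n \<in> {..<card I}" unfolding j(2) index_in_def using assms by (simp add: psubset_card_mono)
  qed
qed (use card_image[OF index_in_inj[OF assms]] in auto)

text \<open>Contiguity makes the indices of the least and greatest element of \<open>S\<close>
  differ by \<open>card S - 1\<close>; rounding and the closing bin account for the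
  \<open>+ 2\<close>.\<close>

lemma bins_of_interval:
  assumes "finite I" "S \<subseteq> I" "0 < J"
    and conv: "\<And>i j l. \<lbrakk>i \<in> S; l \<in> S; j \<in> I; i \<le> j; j \<le> l\<rbrakk> \<Longrightarrow> j \<in> S"
  shows "real (card ((\<lambda>j. index_in I j div J) ` S)) \<le> real (card S) / real J + 2"
proof (cases "S = {}")
  case False
  have finS: "finite S" using assms(1,2) finite_subset by blast
  define a where "a = Min S"
  define b where "b = Max S"
  have ab: "a \<in> S" "b \<in> S" "a \<le> b" using finS False by (auto simp: a_def b_def)
  have ge: "a \<le> i" "i \<le> b" if "i \<in> S" for i using that finS by (auto simp: a_def b_def)
  have "{i \<in> I. i < b} = {i \<in> I. i < a} \<union> (S - {b})"
  proof (rule set_eqI)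
    fix i
    show "i \<in> {i \<in> I. i < b} \<longleftrightarrow> i \<in> {i \<in> I. i < a} \<union> (S - {b})"
      using conv[OF ab(1,2), of i] ge[of i] ab(3) assms(2) by (cases "i < a") force+
  qed
  moreover have "card ({i \<in> I. i < a} \<union> (S - {b})) = card {i \<in> I. i < a} + card (S - {b})"
    using assms(1) finS ge by (intro card_Un_disjoint) force+
  ultimately have idx: "index_in I b = index_in I a + (card S - 1)"
    using ab(2) finS by (simp add: index_in_def)
  have mono: "index_in I i \<le> index_in I j" if "i \<le> j" for i j
    unfolding index_in_def using that assms(1) by (intro card_mono) auto
  have "(\<lambda>j. index_in I j div J) ` S \<subseteq> {index_in I a div J..index_in I b div J}"
    using ge by (auto intro!: div_le_mono mono)
  then have "card ((\<lambda>j. index_in I j div J) ` S) \<le> card {index_in I a div J..index_in I b div J}"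
    by (intro card_mono) auto
  also have "\<dots> = index_in I b div J + 1 - index_in I a div J" by simp
  finally have "real (card ((\<lambda>j. index_in I j div J) ` S)) + real (index_in I a div J)
      \<le> real (index_in I b div J) + 1"
    using div_le_mono[OF mono[OF ab(3)], of J] by linarith
  moreover have "real (index_in I b div J) \<le> real (index_in I b) / real J"
    by (rule of_nat_div_le_of_nat)
  moreover have "real (index_in I b) / real J \<le> real (index_in I a) / real J + real (card S) / real J"
    unfolding idx add_divide_distrib[symmetric] by (intro divide_right_mono) auto
  moreover have "real (index_in I a) / real J \<le> real (index_in I a div J) + 1"
  proof -
    have "index_in I a < index_in I a div J * J + J" using dividend_less_div_times[OF assms(3), of "index_in I a"] by simp
    then have "real (index_in I a) \<le> (real (index_in I a div J) + 1) * real J"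
      by (simp add: algebra_simps flip: of_nat_mult of_nat_add)
    then show ?thesis using assms(3) by (simp add: pos_divide_le_eq)
  qed
  ultimately show ?thesis by linarith
qed simp

context laminar_routing
begin

text \<open>Three scales: a removed piece is below \<open>\<alpha> * k \<le> \<epsilon> * h\<close>,
  a chunk has size \<open>h\<close>, and \<open>J\<close> chunks fit into a new tour. High edges are
  compared with \<open>\<tau>\<close> one by one, low edges only in the weighted sum, where the
  offset was chosen well.\<close>

theorem fine_regrouping:
  fixes \<tau> :: "'a \<Rightarrow> 't" and \<epsilon> \<alpha> :: real
  assumes cap: "\<And>t. card {x \<in> X. \<tau> x = t} \<le> k"
    and eps: "0 < \<epsilon>" "\<epsilon> \<le> 1/3" and Gam: "\<Gamma> = 12 / \<epsilon>" and alp: "0 < \<alpha>" "\<alpha> \<le> \<epsilon> ^ 4"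
    and ak1: "1 < \<alpha> * real k"
  shows "\<exists>q :: 'a \<Rightarrow> 't + 'c \<times> nat. admissible \<alpha> q \<and> cost q \<le> (1 + \<epsilon>) * cost \<tau>"
proof -
  have kp: "0 < real k" using k_pos by simp
  \<comment> \<open>Large enough for \<open>1 / J \<le> \<epsilon> / 3\<close>, small enough that
    \<alpha> \<le> \<epsilon>^4 still gives \<open>\<alpha> * k \<le> \<epsilon> * h\<close>.
    Moreover \<open>9 \<le> J\<close>, so a full bin can tolerate two partial chunks.\<close>
  define J where "J = nat \<lceil>1 / \<epsilon>\<^sup>2\<rceil>"
  define h where "h = k div J"
  have e2: "0 < \<epsilon>\<^sup>2" "\<epsilon>\<^sup>2 \<le> 1/9"
    using eps power_mono[of \<epsilon> "1/3" 2] by (auto simp: power2_eq_square)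
  have J1: "1 / \<epsilon>\<^sup>2 \<le> real J" unfolding J_def by linarith
  have J2: "real J \<le> 1 / \<epsilon>\<^sup>2 + 1"
  proof -
    have "0 < 1 / \<epsilon>\<^sup>2" using e2 by simp
    then show ?thesis unfolding J_def by linarith
  qed
  have J9: "9 \<le> J"
  proof -
    have "9 \<le> 1 / \<epsilon>\<^sup>2" using e2 by (simp add: pos_le_divide_eq)
    then show ?thesis using J1 by linarith
  qed
  have Jinv: "1 / real J \<le> \<epsilon> / 3"
  proof -
    have "1 \<le> \<epsilon>\<^sup>2 * real J" using J1 e2(1) by (simp add: pos_divide_le_eq mult.commute)
    also have "\<dots> \<le> \<epsilon> / 3 * real J"
      using eps by (intro mult_right_mono) (auto simp: power2_eq_square intro: mult_left_mono[of \<epsilon> "1/3" \<epsilon>, simplified])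
    finally show ?thesis using J9 by (simp add: pos_divide_le_eq)
  qed
  have Jh: "J * h \<le> k" unfolding h_def by simp
  \<comment> \<open>\<open>1 < \<alpha> * k\<close> forces
    \<open>9 < \<epsilon>\<^sup>2 * k\<close>, so rounding down \<open>k div J\<close> still leaves
    at least a third of \<open>\<epsilon>\<^sup>2 * k\<close>.\<close>
  have ake: "\<alpha> * real k \<le> \<epsilon> * real h"
  proof -
    have "k < h * J + J" unfolding h_def using J9 dividend_less_div_times[of J k] by simp
    then have "real k \<le> (real h + 1) * real J"
      by (simp add: algebra_simps flip: of_nat_mult of_nat_add)
    also have "\<dots> \<le> (real h + 1) * (1 / \<epsilon>\<^sup>2 + 1)" using J2 by (intro mult_left_mono) auto
    finally have "real k * \<epsilon>\<^sup>2 \<le> (real h + 1) * (1 / \<epsilon>\<^sup>2 + 1) * \<epsilon>\<^sup>2"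
      using e2(1) by (intro mult_right_mono) auto
    also have "\<dots> = (real h + 1) * (1 + \<epsilon>\<^sup>2)" using e2(1) eps by (simp add: field_simps)
    also have "\<dots> \<le> (real h + 1) * (10/9)" using e2 by (intro mult_left_mono) auto
    finally have k1: "9 * (real k * \<epsilon>\<^sup>2) \<le> 10 * (real h + 1)" by simp
    have a1: "\<alpha> * real k \<le> \<epsilon>\<^sup>2 * (\<epsilon>\<^sup>2 * real k)"
    proof -
      have "\<alpha> * real k \<le> \<epsilon> ^ 4 * real k" using alp kp by (intro mult_right_mono) auto
      then show ?thesis by (simp add: power2_eq_square power4_eq_xxxx mult.assoc)
    qed
    let ?y = "\<epsilon>\<^sup>2 * real k"
    have y0: "0 \<le> ?y" by simp
    have "1 < \<epsilon>\<^sup>2 * ?y" using ak1 a1 by linarith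
    also have "\<dots> \<le> 1/9 * ?y" using e2 y0 by (intro mult_right_mono) auto
    finally have y9: "9 < ?y" by simp
    have "?y / 3 \<le> real h" using k1 y9 by (simp add: mult.commute)
    have "\<alpha> * real k \<le> \<epsilon>\<^sup>2 * ?y" by (rule a1)
    also have "\<dots> \<le> (\<epsilon> / 3) * ?y"
      using eps y0 by (intro mult_right_mono) (auto simp: power2_eq_square intro: mult_left_mono[of \<epsilon> "1/3" \<epsilon>, simplified])
    also have "\<dots> = \<epsilon> * (?y / 3)" by simp
    also have "\<dots> \<le> \<epsilon> * real h" using \<open>?y / 3 \<le> real h\<close> eps by (intro mult_left_mono) auto
    finally show ?thesis .
  qed
  have akh: "\<alpha> * real k \<le> real h"
  proof -
    have "\<epsilon> * real h \<le> 1 * real h" using eps by (intro mult_right_mono) auto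
    then show ?thesis using ake by linarith
  qed
  have hpos: "0 < h" using akh ak1 by (cases h) auto
  define small where "small x \<longleftrightarrow> real (card (piece \<tau> x)) < \<alpha> * real k" for x
  define B where "B c = {x \<in> X. small x \<and> comp x = c}" for c
  have BX: "B c \<subseteq> X" for c by (auto simp: B_def)
  have finB: "finite (B c)" for c using BX finite_sub by blast
  \<comment> \<open>The offset is optimised for low edges only; at a high edge at most two chunks
    are cut, which \<Gamma> absorbs.\<close>
  define M where "M = {v \<in> N. below v = {}}"
  have MN: "M \<subseteq> N" and finM: "finite M" using finite_N by (auto simp: M_def)
  obtain s where s:
    "(\<Sum>v\<in>M. wt v * real (card (chunk (B (own v)) h (s (own v)) ` (B (own v) \<inter> L v)))) \<le>
     (\<Sum>v\<in>M. wt v * (if B (own v) \<inter> L v = {} then 0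
                   else 1 + real (card (B (own v) \<inter> L v)) / real h))"
    by (rule good_shifts[of B M h, OF BX MN hpos])
  define ch where "ch c = chunk (B c) h (s c)" for c
  define key where "key x = (comp x, ch (comp x) x)" for x
  define G where "G g = {x \<in> X. small x \<and> key x = g}" for g
  have G_eq: "G (c, j) = {x \<in> B c. ch c x = j}" for c j by (auto simp: G_def key_def B_def)
  have finG: "finite (G g)" for g using finite_X by (simp add: G_def)
  have cardG: "card (G g) \<le> h" for g
  proof (cases g)
    case (Pair c j)
    then show ?thesis unfolding Pair G_eq ch_def by (simp add: chunk_card_le[OF BX hpos])
  qed
  define Full where "Full = {g \<in> key ` {x \<in> X. small x}. card (G g) = h}"
  have finFull: "finite Full" using finite_X by (simp add: Full_def)
  define load where "load t = card {x \<in> X. small x \<and> \<tau> x = t}" for t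
  \<comment> \<open>A contributing tour offers \<open>load t div h\<close> slots that its freed
    capacity can hold, and one surplus slot, of index \<open>load t div h\<close>, which secures
    Hall's condition despite rounding.\<close>
  define slots where "slots g = Sigma (\<tau> ` G g) (\<lambda>t. {..load t div h})" for g
  have "\<exists>f. (\<forall>g\<in>Full. f g \<in> slots g) \<and> inj_on f Full"
  proof (rule hall_marriage[OF finFull])
    show "finite (slots g)" for g unfolding slots_def using finG by auto
    fix F assume F: "F \<subseteq> Full"
    have finF: "finite F" using F finFull finite_subset by blast
    define T where "T = \<tau> ` (\<Union>g\<in>F. G g)"
    have finT: "finite T" unfolding T_def using finF finG by blast
    have U: "\<Union>(slots ` F) = Sigma T (\<lambda>t. {..load t div h})" by (auto simp: slots_def T_def)
    \<comment> \<open>Hall's condition by counting terminals: those in the chunks of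
      \<open>F\<close> all come from tours in \<open>T\<close>, and \<open>h\<close> times the
      number of slots of a tour is at least its load.\<close>
    have "h * card F = (\<Sum>g\<in>F. card (G g))" using F by (auto simp: Full_def subset_eq)
    also have "\<dots> = card (\<Union>g\<in>F. G g)"
      using finF finG by (intro card_UN_disjoint[symmetric]) (auto simp: G_def)
    also have "\<dots> \<le> card (\<Union>t\<in>T. {x \<in> X. small x \<and> \<tau> x = t})"
    proof (rule card_mono)
      show "finite (\<Union>t\<in>T. {x \<in> X. small x \<and> \<tau> x = t})" using finT finite_X by simp
    qed (auto simp: T_def G_def)
    also have "\<dots> \<le> (\<Sum>t\<in>T. load t)" unfolding load_def using finT by (rule card_UN_le)
    also have "\<dots> \<le> (\<Sum>t\<in>T. h * (load t div h + 1))"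
    proof (rule sum_mono)
      fix t
      show "load t \<le> h * (load t div h + 1)"
        using dividend_less_div_times[OF hpos, of "load t"] by (simp add: algebra_simps)
    qed
    also have "\<dots> = h * card (\<Union>(slots ` F))" unfolding U using finT by (simp add: sum_distrib_left)
    finally show "card F \<le> card (\<Union>(slots ` F))" using hpos by simp
  qed
  then obtain f where f: "\<And>g. g \<in> Full \<Longrightarrow> f g \<in> slots g" "inj_on f Full" by blast
  \<comment> \<open>Chunks matched to a surplus slot are not given back; they join the partial
    chunks in \<open>I c\<close>.\<close>
  define asg where "asg g \<longleftrightarrow> g \<in> Full \<and> snd (f g) < load (fst (f g)) div h" for g
  define I where "I c = {j \<in> ch c ` B c. \<not> asg (c, j)}" for c
  have finI: "finite (I c)" for c using finB by (simp add: I_def)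
  define q :: "'a \<Rightarrow> 't + 'c \<times> nat" where
    "q x = (if \<not> small x then Inl (\<tau> x) else if asg (key x) then Inl (fst (f (key x)))
            else Inr (comp x, index_in (I (comp x)) (ch (comp x) x) div J))" for x
  have chI: "ch (comp x) x \<in> I (comp x)" if "x \<in> X" "small x" "\<not> asg (key x)" for x
    using that by (auto simp: I_def B_def key_def)
  have GFull: "\<exists>x. x \<in> G g" if "g \<in> Full" for g
  proof -
    have "card (G g) \<noteq> 0" using that hpos by (simp add: Full_def)
    then show ?thesis by (metis all_not_in_conv card.empty)
  qed
  \<comment> \<open>Only the last bin of a component can be short. It stays inside that component,
    so \<open>admissible\<close> does not require it to be dense.\<close>
  define lastbin :: "'c \<Rightarrow> 't + 'c \<times> nat" where "lastbin c = Inr (c, (card (I c) - 1) div J)" for c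
  have dense: "\<alpha> * real k \<le> real (card {y \<in> X. q y = q x \<and> comp y = comp x})"
    if x: "x \<in> X" "q x \<noteq> lastbin (comp x)" for x
  proof (cases "small x")
    case False
    have "piece \<tau> x \<subseteq> {y \<in> X. q y = q x \<and> comp y = comp x}"
    proof
      fix y assume "y \<in> piece \<tau> x"
      then have y: "y \<in> X" "\<tau> y = \<tau> x" "comp y = comp x" by (simp_all add: piece_def)
      then have "\<not> small y" using False piece_cong[OF y(2,3)] by (simp add: small_def)
      then show "y \<in> {y \<in> X. q y = q x \<and> comp y = comp x}" using y False by (simp add: q_def)
    qed
    then have "card (piece \<tau> x) \<le> card {y \<in> X. q y = q x \<and> comp y = comp x}"
      using finite_X by (intro card_mono) auto
    then show ?thesis using False by (simp add: small_def)
  next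
    case sm: True
    show ?thesis
    proof (cases "asg (key x)")
      case True
      have "G (key x) \<subseteq> {y \<in> X. q y = q x \<and> comp y = comp x}"
        using True sm by (auto simp: G_def q_def) (simp add: key_def)
      then have "card (G (key x)) \<le> card {y \<in> X. q y = q x \<and> comp y = comp x}"
        using finite_X by (intro card_mono) auto
      then show ?thesis using True akh by (simp add: asg_def Full_def)
    next
      case False
      let ?c = "comp x"
      define b where "b = index_in (I ?c) (ch ?c x) div J"
      have qx: "q x = Inr (?c, b)" using sm False by (simp add: q_def b_def)
      have "index_in (I ?c) (ch ?c x) \<in> {..<card (I ?c)}"
        using chI[OF x(1) sm False] index_in_image[OF finI] by blast
      then have "b \<le> (card (I ?c) - 1) div J" unfolding b_def by (intro div_le_mono) auto
      moreover have "b \<noteq> (card (I ?c) - 1) div J" using x(2) qx by (auto simp: lastbin_def)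
      ultimately have "b + 1 \<le> (card (I ?c) - 1) div J" by simp
      then have "(b + 1) * J \<le> card (I ?c) - 1" using J9 by (simp add: less_eq_div_iff_mult_less_eq)
      moreover have "0 < (b + 1) * J" using J9 by simp
      ultimately have bc: "b * J + J \<le> card (I ?c)" by simp
      define S where "S = {j \<in> I ?c. index_in (I ?c) j div J = b}"
      have "{b * J..<b * J + J} \<subseteq> index_in (I ?c) ` S"
      proof
        fix i assume i: "i \<in> {b * J..<b * J + J}"
        then have "i \<in> index_in (I ?c) ` I ?c" using bc index_in_image[OF finI] by simp
        moreover have "i div J = b" using i by (intro div_nat_eqI) (auto simp: mult.commute)
        ultimately show "i \<in> index_in (I ?c) ` S" by (auto simp: S_def)
      qed
      then have "card {b * J..<b * J + J} \<le> card S"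
        using finI by (intro surj_card_le[of S _ "index_in (I ?c)"]) (auto simp: S_def)
      then have S9: "9 \<le> card S" using J9 by simp
      obtain j1 j2 where j12: "\<And>j. \<lbrakk>j \<in> ch ?c ` B ?c; j \<noteq> j1; j \<noteq> j2\<rbrakk> \<Longrightarrow> card {x \<in> B ?c. ch ?c x = j} = h"
        using partial_chunks[OF BX hpos, of ?c "s ?c"] unfolding ch_def by blast
      have "\<not> S \<subseteq> {j1, j2}"
      proof
        assume "S \<subseteq> {j1, j2}"
        then have "card S \<le> card {j1, j2}" by (intro card_mono) auto
        also have "\<dots> \<le> 2" by (simp add: card_insert_if)
        finally show False using S9 by simp
      qed
      \<comment> \<open>Of at least nine chunks in this bin at most two are partial, and a single
        full one already has \<open>h \<ge> \<alpha> * k\<close> terminals.\<close>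
      then obtain j where j: "j \<in> S" "j \<noteq> j1" "j \<noteq> j2" by blast
      have "j \<in> ch ?c ` B ?c" "\<not> asg (?c, j)" using j(1) by (auto simp: S_def I_def)
      then have "card (G (?c, j)) = h" using j12 j unfolding G_eq by blast
      moreover have "G (?c, j) \<subseteq> {y \<in> X. q y = q x \<and> comp y = comp x}"
        unfolding qx using \<open>\<not> asg (?c, j)\<close> j(1) by (auto simp: G_def q_def key_def S_def)
      then have "card (G (?c, j)) \<le> card {y \<in> X. q y = q x \<and> comp y = comp x}"
        using finite_X by (intro card_mono) auto
      ultimately show ?thesis using akh by simp
    qed
  qed

  \<comment> \<open>Capacity, density and number of tours after the fine regrouping\<close>
  have adm: "admissible \<alpha> q"
    unfolding admissible_def
  proof (intro conjI allI)
    fix l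
    show "card {x \<in> X. q x = l} \<le> k"
    proof (cases l)
      case (Inl t)
      \<comment> \<open>The chunks given to \<open>t\<close> occupy distinct slots below
        \<open>load t div h\<close>, so \<open>t\<close> receives no more terminals than the
        \<open>load t\<close> it gave up.\<close>
      define Q where "Q = {g \<in> Full. asg g \<and> fst (f g) = t}"
      have finQ: "finite Q" using finFull by (simp add: Q_def)
      have "card Q \<le> card {..<load t div h}"
      proof (rule card_inj_on_le)
        show "inj_on (\<lambda>g. snd (f g)) Q"
          using f(2) by (auto simp: Q_def inj_on_def prod_eq_iff)
        show "(\<lambda>g. snd (f g)) ` Q \<subseteq> {..<load t div h}" by (auto simp: Q_def asg_def)
      qed simp
      then have cQ: "card Q * h \<le> load t"
        by (metis card_lessThan div_times_less_eq_dividend le_trans mult_le_mono1)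
      have "{x \<in> X. q x = l} \<subseteq> {x \<in> X. \<not> small x \<and> \<tau> x = t} \<union> (\<Union>g\<in>Q. G g)"
        by (auto simp: q_def Inl Q_def G_def asg_def split: if_splits)
      then have "card {x \<in> X. q x = l} \<le> card ({x \<in> X. \<not> small x \<and> \<tau> x = t} \<union> (\<Union>g\<in>Q. G g))"
        using finite_X finQ finG by (intro card_mono) auto
      also have "\<dots> \<le> card {x \<in> X. \<not> small x \<and> \<tau> x = t} + card (\<Union>g\<in>Q. G g)" by (rule card_Un_le)
      also have "card (\<Union>g\<in>Q. G g) \<le> (\<Sum>g\<in>Q. card (G g))" by (rule card_UN_le[OF finQ])
      also have "\<dots> \<le> (\<Sum>g\<in>Q. h)" by (intro sum_mono cardG)
      also have "\<dots> \<le> load t" using cQ by simp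
      also have "card {x \<in> X. \<not> small x \<and> \<tau> x = t} + load t
          = card ({x \<in> X. \<not> small x \<and> \<tau> x = t} \<union> {x \<in> X. small x \<and> \<tau> x = t})"
        unfolding load_def using finite_X by (intro card_Un_disjoint[symmetric]) auto
      also have "\<dots> = card {x \<in> X. \<tau> x = t}" by (rule arg_cong[of _ _ card]) auto
      also have "\<dots> \<le> k" by (rule cap)
      finally show ?thesis by simp
    next
      case (Inr cj)
      obtain c b where cj: "cj = (c, b)" by fastforce
      define S where "S = {j \<in> I c. index_in (I c) j div J = b}"
      have finS: "finite S" using finI by (simp add: S_def)
      have "card S \<le> card {b * J..<b * J + J}"
      proof (rule card_inj_on_le)
        show "inj_on (index_in (I c)) S"
          using index_in_inj[OF finI] by (auto simp: S_def inj_on_def)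
        have "b * J \<le> i \<and> i < b * J + J" if "i div J = b" for i
          using that dividend_less_div_times[of J i] J9 by auto
        then show "index_in (I c) ` S \<subseteq> {b * J..<b * J + J}" by (auto simp: S_def)
      qed simp
      then have cS: "card S \<le> J" by simp
      have "{x \<in> X. q x = l} \<subseteq> (\<Union>j\<in>S. G (c, j))"
      proof
        fix x assume "x \<in> {x \<in> X. q x = l}"
        then have x: "x \<in> X" "small x" "\<not> asg (key x)" "comp x = c" "index_in (I c) (ch c x) div J = b"
          by (auto simp: q_def Inr cj split: if_splits)
        have "ch c x \<in> S" using chI[OF x(1,2,3)] x(4,5) by (simp add: S_def)
        moreover have "x \<in> G (c, ch c x)" using x by (simp add: G_def key_def)
        ultimately show "x \<in> (\<Union>j\<in>S. G (c, j))" by blast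
      qed
      then have "card {x \<in> X. q x = l} \<le> card (\<Union>j\<in>S. G (c, j))"
        using finS finG by (intro card_mono) auto
      also have "\<dots> \<le> (\<Sum>j\<in>S. card (G (c, j)))" by (rule card_UN_le[OF finS])
      also have "\<dots> \<le> (\<Sum>j\<in>S. h)" by (intro sum_mono cardG)
      also have "\<dots> \<le> J * h" using cS by simp
      also have "\<dots> \<le> k" by (rule Jh)
      finally show ?thesis .
    qed
    show "(\<exists>c. \<forall>x\<in>X. q x = l \<longrightarrow> comp x = c) \<or>
          (\<forall>x\<in>X. q x = l \<longrightarrow> \<alpha> * real k \<le> real (card {y \<in> X. q y = l \<and> comp y = comp x}))"
    proof (cases l)
      case (Inl t)
      have "\<alpha> * real k \<le> real (card {y \<in> X. q y = l \<and> comp y = comp x})" if "x \<in> X" "q x = l" for x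
        using dense[OF that(1)] that(2) Inl by (simp add: lastbin_def)
      then show ?thesis by blast
    next
      case (Inr cj)
      then show ?thesis by (auto simp: q_def split: if_splits)
    qed
  next
    fix c
    \<comment> \<open>All labels except \<open>lastbin c\<close> hold at least
      \<open>\<alpha> * k\<close> terminals of \<open>c\<close>; the last bin is the
      \<open>+ 1\<close> of the bound.\<close>
    define Y where "Y = {x \<in> X. comp x = c \<and> q x \<noteq> lastbin c}"
    have finY: "finite Y" using finite_X by (simp add: Y_def)
    have "(\<alpha> * real k) * real (card (q ` Y)) \<le> real (card Y)"
    proof (rule card_image_mult_le[OF finY])
      fix x assume x: "x \<in> Y"
      then have "{y \<in> X. q y = q x \<and> comp y = comp x} = {y \<in> Y. q y = q x}" by (auto simp: Y_def)
      then show "\<alpha> * real k \<le> real (card {y \<in> Y. q y = q x})"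
        using dense[of x] x by (simp add: Y_def)
    qed
    also have "real (card Y) \<le> real (card {x \<in> X. comp x = c})"
      using finite_X by (intro of_nat_mono card_mono) (auto simp: Y_def)
    also have "\<dots> \<le> 2 * \<Gamma> * real k" by (rule comp_size)
    finally have "(\<alpha> * real (card (q ` Y))) * real k \<le> (2 * \<Gamma>) * real k" by (simp add: mult_ac)
    then have "\<alpha> * real (card (q ` Y)) \<le> 2 * \<Gamma>" using kp by simp
    then have qY: "real (card (q ` Y)) \<le> 2 * \<Gamma> / \<alpha>" using alp(1) by (simp add: pos_le_divide_eq mult.commute)
    have "q ` {x \<in> X. comp x = c} \<subseteq> insert (lastbin c) (q ` Y)" by (auto simp: Y_def)
    then have "card (q ` {x \<in> X. comp x = c}) \<le> card (insert (lastbin c) (q ` Y))"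
      using finY by (intro card_mono) auto
    also have "\<dots> \<le> card (q ` Y) + 1" by (simp add: card_insert_le_m1 card_insert_if finY)
    finally show "real (card (q ` {x \<in> X. comp x = c})) \<le> 2 * \<Gamma> / \<alpha> + 1" using qY by linarith
  qed

  \<comment> \<open>Cost of the fine regrouping on low and high edges\<close>
  define e where "e v = real (card (ch (own v) ` (B (own v) \<inter> L v)))" for v
  define a where "a v = (if B (own v) \<inter> L v = {} then 0 else 1 + real (card (B (own v) \<inter> L v)) / real h)" for v
  have low1: "real (card (q ` L v)) \<le> real (card (\<tau> ` {x \<in> L v. \<not> small x})) + e v"
    if v: "v \<in> N" "below v = {}" for v
  proof -
    let ?c = "own v"
    define F :: "nat \<Rightarrow> 't + 'c \<times> nat" where
      "F j = (if asg (?c, j) then Inl (fst (f (?c, j))) else Inr (?c, index_in (I ?c) j div J))" for j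
    have "q ` L v \<subseteq> Inl ` \<tau> ` {x \<in> L v. \<not> small x} \<union> F ` (ch ?c ` (B ?c \<inter> L v))"
    proof
      fix l assume "l \<in> q ` L v"
      then obtain x where x: "x \<in> L v" "l = q x" by blast
      show "l \<in> Inl ` \<tau> ` {x \<in> L v. \<not> small x} \<union> F ` (ch ?c ` (B ?c \<inter> L v))"
      proof (cases "small x")
        case True
        have cx: "comp x = ?c" using comp_own[OF v(2) x(1)] .
        then have "x \<in> B ?c \<inter> L v" using x True L_subset[OF v(1)] by (auto simp: B_def)
        moreover have "l = F (ch ?c x)" using x True cx by (simp add: q_def F_def key_def)
        ultimately show ?thesis by blast
      qed (use x in \<open>auto simp: q_def\<close>)
    qed
    then have "card (q ` L v) \<le> card (Inl ` \<tau> ` {x \<in> L v. \<not> small x} \<union> F ` (ch ?c ` (B ?c \<inter> L v)))"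
      using finite_L[OF v(1)] finB by (intro card_mono) auto
    also have "\<dots> \<le> card (Inl ` \<tau> ` {x \<in> L v. \<not> small x} :: ('t + 'c \<times> nat) set)
        + card (F ` (ch ?c ` (B ?c \<inter> L v)))" by (rule card_Un_le)
    also have "\<dots> \<le> card (\<tau> ` {x \<in> L v. \<not> small x}) + card (ch ?c ` (B ?c \<inter> L v))"
      using card_image_le[of "ch ?c ` (B ?c \<inter> L v)" F] finB by (simp add: card_image)
    finally show ?thesis unfolding e_def by (simp only: of_nat_add[symmetric] of_nat_le_iff)
  qed
  have low2: "real (card (\<tau> ` {x \<in> L v. \<not> small x})) + a v \<le> (1 + \<epsilon>) * real (card (\<tau> ` L v))"
    if v: "v \<in> N" "below v = {}" for v
  proof -
    define Tn where "Tn = \<tau> ` {x \<in> L v. \<not> small x}"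
    define Ts where "Ts = \<tau> ` {x \<in> L v. small x}"
    have fin: "finite Tn" "finite Ts" using finite_L[OF v(1)] by (auto simp: Tn_def Ts_def)
    have eqB: "B (own v) \<inter> L v = {x \<in> L v. small x}"
      using comp_own[OF v(2)] L_subset[OF v(1)] by (auto simp: B_def)
    have same: "small x = small y" if "x \<in> L v" "y \<in> L v" "\<tau> x = \<tau> y" for x y
      using piece_cong[OF that(3)] comp_own[OF v(2)] that by (simp add: small_def)
    have "Tn \<inter> Ts = {}" using same by (auto simp: Tn_def Ts_def)
    moreover have "\<tau> ` L v = Tn \<union> Ts" by (auto simp: Tn_def Ts_def)
    ultimately have m: "real (card (\<tau> ` L v)) = real (card Tn) + real (card Ts)"
      using fin by (simp add: card_Un_disjoint)
    \<comment> \<open>\<open>Ts\<close> is nonempty, so one removed tour pays for the leading 1 of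
      \<open>a v\<close>; the rest is small because each removed piece has at most
      \<open>\<epsilon> * h\<close> terminals.\<close>
    have "a v \<le> (1 + \<epsilon>) * real (card Ts)"
    proof (cases "B (own v) \<inter> L v = {}")
      case True
      then show ?thesis using eps by (simp add: a_def)
    next
      case False
      then have "Ts \<noteq> {}" using eqB by (auto simp: Ts_def)
      then have T1: "1 \<le> real (card Ts)" using fin by (simp add: Suc_le_eq card_gt_0_iff)
      have "real (card {x \<in> L v. small x}) = (\<Sum>t\<in>Ts. real (card {x \<in> L v. small x \<and> \<tau> x = t}))"
        using finite_L[OF v(1)] fin by (intro card_eq_sum_fibres) (auto simp: Ts_def)
      also have "\<dots> \<le> (\<Sum>t\<in>Ts. \<alpha> * real k)"
      proof (rule sum_mono)
        fix t assume "t \<in> Ts"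
        then obtain y where y: "y \<in> L v" "small y" "\<tau> y = t" by (auto simp: Ts_def)
        have "card {x \<in> L v. small x \<and> \<tau> x = t} \<le> card (piece \<tau> y)"
          using finite_X L_subset[OF v(1)] y comp_own[OF v(2)]
          by (intro card_mono) (auto simp: piece_def)
        then show "real (card {x \<in> L v. small x \<and> \<tau> x = t}) \<le> \<alpha> * real k"
          using y(2) unfolding small_def by linarith
      qed
      also have "\<dots> \<le> real (card Ts) * (\<epsilon> * real h)" using ake by (simp add: mult_left_mono)
      finally have "real (card {x \<in> L v. small x}) / real h \<le> \<epsilon> * real (card Ts)"
        using hpos by (simp add: pos_divide_le_eq mult_ac)
      moreover have "a v = 1 + real (card {x \<in> L v. small x}) / real h" 
        unfolding a_def eqB[symmetric] using False by simp
      ultimately show ?thesis using T1 by (simp add: algebra_simps)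
    qed
    moreover have "0 \<le> \<epsilon> * real (card Tn)" using eps by simp
    ultimately show ?thesis unfolding m Tn_def[symmetric] by (simp add: algebra_simps)
  qed
  define Rem where "Rem = {g \<in> Full. \<not> asg g}"
  have finRem: "finite Rem" using finFull by (simp add: Rem_def)
  \<comment> \<open>A tour has a single surplus slot, so the full chunks left over belong to
    distinct contributing tours.\<close>
  have inj_Rem: "inj_on (\<lambda>g. fst (f g)) Rem"
  proof (rule inj_onI)
    fix g g' assume g: "g \<in> Rem" "g' \<in> Rem" "fst (f g) = fst (f g')"
    have last: "snd (f g) = load (fst (f g)) div h" if "g \<in> Rem" for g
      using that f(1)[of g] by (auto simp: Rem_def asg_def slots_def)
    have "f g = f g'" using g last by (simp add: prod_eq_iff)
    then show "g = g'" using f(2) g by (auto simp: Rem_def dest: inj_onD)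
  qed
  have high: "real (card (q ` L v)) \<le> (1 + \<epsilon>) * real (card (\<tau> ` L v))"
    if v: "v \<in> N" "below v \<noteq> {}" for v
  proof -
    let ?c = "own v"
    define m where "m = real (card (\<tau> ` L v))"
    have m: "\<Gamma> \<le> m" "\<Gamma> * real (card (below v)) \<le> 3 * m"
      unfolding m_def using heavy_hits[OF cap v] by auto
    define W where "W = ch ?c ` (B ?c \<inter> L v)"
    have finW: "finite W" using finB by (simp add: W_def)
    obtain j1 j2 where j12: "\<And>j. \<lbrakk>j \<in> W; j \<noteq> j1; j \<noteq> j2\<rbrakk> \<Longrightarrow> G (?c, j) \<subseteq> L v \<and> card (G (?c, j)) = h"
      using chunk_ends[OF BX v(1) hpos, of ?c "s ?c"] unfolding W_def G_eq ch_def by blast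
    define nb where "nb c = (card (I c) + (J - 1)) div J" for c
    have fL: "finite (L v)" and fb: "finite (below v)" using finite_L[OF v(1)] finite_below[OF v(1)] .
    let ?P1 = "Inl ` (\<tau> ` L v) :: ('t + 'c \<times> nat) set"
    \<comment> \<open>A receiver contributed to its chunk, hence uses \<open>v\<close> already if
      the chunk lies below \<open>v\<close>. Receivers foreign to \<open>v\<close> can only come
      from the two chunks that \<open>v\<close> may cut.\<close>
    let ?P2 = "{Inl (fst (f (?c, j1))), Inl (fst (f (?c, j2)))} :: ('t + 'c \<times> nat) set"
    let ?P3 = "(\<Union>c\<in>below v. (\<lambda>b. Inr (c, b)) ` {..<nb c}) :: ('t + 'c \<times> nat) set"
    let ?P4 = "(\<lambda>b. Inr (?c, b)) ` ((\<lambda>j. index_in (I ?c) j div J) ` (I ?c \<inter> W)) :: ('t + 'c \<times> nat) set"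
    have belowL: "G g \<subseteq> L v" if "fst g \<in> below v" for g
      using that below_closed[OF v(1)] by (auto simp: below_def G_def key_def)
    have asg_in: "fst (f g) \<in> \<tau> ` L v" if "g \<in> Full" "G g \<subseteq> L v" for g
      using f(1)[OF that(1)] that(2) by (auto simp: slots_def)
    have "q ` L v \<subseteq> ?P1 \<union> ?P2 \<union> (?P3 \<union> ?P4)"
    proof
      fix l assume "l \<in> q ` L v"
      then obtain x where x: "x \<in> L v" "l = q x" by blast
      have xX: "x \<in> X" using x(1) L_subset[OF v(1)] by blast
      consider "\<not> small x" | "small x" "asg (key x)" | "small x" "\<not> asg (key x)" by blast
      then show "l \<in> ?P1 \<union> ?P2 \<union> (?P3 \<union> ?P4)"
      proof cases
        case 1
        then have "l \<in> ?P1" using x by (simp add: q_def)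
        then show ?thesis by blast
      next
        case 2
        have l: "l = Inl (fst (f (key x)))" using 2 x by (simp add: q_def)
        show ?thesis
        proof (cases "G (key x) \<subseteq> L v")
          case True
          then have "fst (f (key x)) \<in> \<tau> ` L v" using 2 asg_in by (simp add: asg_def)
          then have "l \<in> ?P1" using l by blast
          then show ?thesis by blast
        next
          case False
          then have "comp x \<notin> below v" using belowL[of "key x"] by (auto simp: key_def)
          then have cx: "comp x = ?c" using x by (auto simp: below_def)
          have "x \<in> B ?c \<inter> L v" using xX x 2 cx by (simp add: B_def)
          then have "ch ?c x \<in> W" by (simp add: W_def)
          then have "ch ?c x = j1 \<or> ch ?c x = j2" using j12[of "ch ?c x"] False cx by (auto simp: key_def)
          then have "l \<in> ?P2" using l cx by (auto simp: key_def)
          then show ?thesis by blast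
        qed
      next
        case 3
        have l: "l = Inr (comp x, index_in (I (comp x)) (ch (comp x) x) div J)" using 3 x by (simp add: q_def)
        have jI: "ch (comp x) x \<in> I (comp x)" using chI[OF xX 3] .
        show ?thesis
        proof (cases "comp x = ?c")
          case True
          have "x \<in> B ?c \<inter> L v" using xX x 3 True by (simp add: B_def)
          then have "ch ?c x \<in> I ?c \<inter> W" using jI True by (simp add: W_def)
          then have "l \<in> ?P4" unfolding l True by blast
          then show ?thesis by blast
        next
          case False
          then have cb: "comp x \<in> below v" using x by (auto simp: below_def)
          have "index_in (I (comp x)) (ch (comp x) x) < card (I (comp x))"
            using jI index_in_image[OF finI] by blast
          then have "index_in (I (comp x)) (ch (comp x) x) div J < nb (comp x)"
          proof -
            assume less: "index_in (I (comp x)) (ch (comp x) x) < card (I (comp x))"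
            then have "index_in (I (comp x)) (ch (comp x) x) + J \<le> card (I (comp x)) + (J - 1)" using J9 by simp
            then have "(index_in (I (comp x)) (ch (comp x) x) + J) div J \<le> nb (comp x)"
              unfolding nb_def by (rule div_le_mono)
            then show ?thesis using J9 by simp
          qed
          then have "l \<in> ?P3" using cb unfolding l by blast
          then show ?thesis by blast
        qed
      qed
    qed
    then have "card (q ` L v) \<le> card (?P1 \<union> ?P2 \<union> (?P3 \<union> ?P4))"
      using fL fb finI by (intro card_mono) auto
    also have "\<dots> \<le> card ?P1 + card ?P2 + (card ?P3 + card ?P4)"
      by (intro order.trans[OF card_Un_le] add_mono card_Un_le)
    finally have c1: "real (card (q ` L v)) \<le> real (card ?P1) + real (card ?P2) + (real (card ?P3) + real (card ?P4))"
      by (simp only: of_nat_add[symmetric] of_nat_le_iff)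
    have p1: "real (card ?P1) = m" by (simp add: m_def card_image)
    have p2: "real (card ?P2) \<le> 2" by (simp add: card_insert_if)
    define R where "R c = {g \<in> Rem. fst g = c}" for c
    define Ro where "Ro = {g \<in> Rem. fst g = ?c \<and> G g \<subseteq> L v}"
    have items: "card (I c) \<le> card (R c) + 2" for c
    proof -
      obtain i1 i2 where i12: "\<And>j. \<lbrakk>j \<in> ch c ` B c; j \<noteq> i1; j \<noteq> i2\<rbrakk> \<Longrightarrow> card {x \<in> B c. ch c x = j} = h"
        using partial_chunks[OF BX hpos, of c "s c"] unfolding ch_def by blast
      have "I c - {i1, i2} \<subseteq> snd ` R c"
      proof
        fix j assume j: "j \<in> I c - {i1, i2}"
        then have jB: "j \<in> ch c ` B c" and na: "\<not> asg (c, j)" by (auto simp: I_def)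
        have "(c, j) \<in> key ` {x \<in> X. small x}" using jB by (auto simp: key_def B_def)
        moreover have "card (G (c, j)) = h" using i12[OF jB] j unfolding G_eq by blast
        ultimately have "(c, j) \<in> R c" using na by (simp add: R_def Rem_def Full_def)
        then show "j \<in> snd ` R c" by force
      qed
      then have "card (I c - {i1, i2}) \<le> card (R c)"
        using finRem by (intro surj_card_le) (auto simp: R_def)
      moreover have "card (I c) - card {i1, i2} \<le> card (I c - {i1, i2})" by (rule diff_card_le_card_Diff) simp
      moreover have "card {i1, i2} \<le> 2" by (simp add: card_insert_if)
      ultimately show ?thesis by linarith
    qed
    have own_items: "card (I ?c \<inter> W) \<le> card Ro + 2"
    proof -
      have "(I ?c \<inter> W) - {j1, j2} \<subseteq> snd ` Ro"
      proof
        fix j assume j: "j \<in> (I ?c \<inter> W) - {j1, j2}"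
        then have jB: "j \<in> ch ?c ` B ?c" and na: "\<not> asg (?c, j)" by (auto simp: I_def)
        obtain x where x: "x \<in> X" "small x" "comp x = ?c" "j = ch ?c x" using jB by (auto simp: B_def)
        then have "(?c, j) = key x" by (simp add: key_def)
        then have "(?c, j) \<in> key ` {x \<in> X. small x}" using x(1,2) by blast
        moreover have "G (?c, j) \<subseteq> L v \<and> card (G (?c, j)) = h" using j12 j by blast
        ultimately have "(?c, j) \<in> Ro" using na by (simp add: Ro_def Rem_def Full_def)
        then show "j \<in> snd ` Ro" by force
      qed
      then have "card ((I ?c \<inter> W) - {j1, j2}) \<le> card Ro"
        using finRem by (intro surj_card_le) (auto simp: Ro_def)
      moreover have "card (I ?c \<inter> W) - card {j1, j2} \<le> card ((I ?c \<inter> W) - {j1, j2})"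
        by (rule diff_card_le_card_Diff) simp
      moreover have "card {j1, j2} \<le> 2" by (simp add: card_insert_if)
      ultimately show ?thesis by linarith
    qed
    \<comment> \<open>Surplus chunks below \<open>v\<close> are matched to distinct tours that use
      \<open>v\<close>, so there are at most \<open>m\<close> of them; packing \<open>J\<close> per
      tour reduces this to \<open>m / J\<close>.\<close>
    have rem: "(\<Sum>c\<in>below v. real (card (R c))) + real (card Ro) \<le> m"
    proof -
      have "(\<Sum>c\<in>below v. card (R c)) = card (\<Union>c\<in>below v. R c)"
        using fb finRem by (intro card_UN_disjoint[symmetric]) (auto simp: R_def)
      moreover have "card (\<Union>c\<in>below v. R c) + card Ro = card ((\<Union>c\<in>below v. R c) \<union> Ro)"
        using fb finRem by (intro card_Un_disjoint[symmetric]) (auto simp: R_def Ro_def below_def)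
      moreover have "card ((\<Union>c\<in>below v. R c) \<union> Ro) \<le> card (\<tau> ` L v)"
      proof (rule card_inj_on_le)
        show "inj_on (\<lambda>g. fst (f g)) ((\<Union>c\<in>below v. R c) \<union> Ro)"
          by (rule inj_on_subset[OF inj_Rem]) (auto simp: R_def Ro_def)
        show "(\<lambda>g. fst (f g)) ` ((\<Union>c\<in>below v. R c) \<union> Ro) \<subseteq> \<tau> ` L v"
        proof
          fix t assume "t \<in> (\<lambda>g. fst (f g)) ` ((\<Union>c\<in>below v. R c) \<union> Ro)"
          then obtain g where g: "g \<in> (\<Union>c\<in>below v. R c) \<union> Ro" "t = fst (f g)" by blast
          then have "g \<in> Full" "G g \<subseteq> L v" using belowL[of g] by (auto simp: R_def Ro_def Rem_def)
          then show "t \<in> \<tau> ` L v" unfolding g(2) by (rule asg_in)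
        qed
      qed (use fL in simp)
      ultimately have "(\<Sum>c\<in>below v. card (R c)) + card Ro \<le> card (\<tau> ` L v)" by simp
      then show ?thesis unfolding m_def by (simp only: of_nat_add[symmetric] of_nat_sum[symmetric] of_nat_le_iff)
    qed
    have J0: "0 < real J" using J9 by simp
    have p3: "real (card ?P3) \<le> (\<Sum>c\<in>below v. real (card (R c)) / real J + (1 + 2 / real J))"
    proof -
      have "card ?P3 \<le> (\<Sum>c\<in>below v. card ((\<lambda>b. Inr (c, b)) ` {..<nb c} :: ('t + 'c \<times> nat) set))"
        using fb by (intro card_UN_le)
      also have "\<dots> = (\<Sum>c\<in>below v. nb c)" by (simp add: card_image inj_on_def)
      finally have "real (card ?P3) \<le> (\<Sum>c\<in>below v. real (nb c))"
        by (simp only: of_nat_sum[symmetric] of_nat_le_iff)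
      also have "\<dots> \<le> (\<Sum>c\<in>below v. real (card (R c)) / real J + (1 + 2 / real J))"
      proof (rule sum_mono)
        fix c
        have "real (nb c) \<le> real (card (I c) + (J - 1)) / real J" unfolding nb_def by (rule of_nat_div_le_of_nat)
        also have "\<dots> \<le> (real (card (R c)) + 2 + real J) / real J"
          using items[of c] J0 by (intro divide_right_mono) linarith+
        also have "\<dots> = real (card (R c)) / real J + (1 + 2 / real J)"
          using J0 by (simp add: add_divide_distrib)
        finally show "real (nb c) \<le> real (card (R c)) / real J + (1 + 2 / real J)" .
      qed
      finally show ?thesis .
    qed
    have p4: "real (card ?P4) \<le> real (card Ro) / real J + 2 / real J + 2"
    proof -
      have "card ?P4 = card ((\<lambda>j. index_in (I ?c) j div J) ` (I ?c \<inter> W))"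
        by (intro card_image) (auto simp: inj_on_def)
      also have "real (card ((\<lambda>j. index_in (I ?c) j div J) ` (I ?c \<inter> W))) \<le> real (card (I ?c \<inter> W)) / real J + 2"
      proof (rule bins_of_interval[OF finI])
        fix i j l assume "i \<in> I ?c \<inter> W" "l \<in> I ?c \<inter> W" "j \<in> I ?c" "i \<le> j" "j \<le> l"
        then show "j \<in> I ?c \<inter> W"
          using chunk_convex[OF BX v(1), of i ?c h "s ?c" l j] unfolding W_def ch_def I_def by auto
      qed (use J9 in auto)
      also have "real (card (I ?c \<inter> W)) / real J \<le> (real (card Ro) + 2) / real J"
        using own_items J0 by (intro divide_right_mono) linarith+
      finally show ?thesis by (simp add: add_divide_distrib)
    qed
    have J2': "2 / real J \<le> 2/9" using J9 by (simp add: divide_le_eq)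
    have "(\<Sum>c\<in>below v. real (card (R c)) / real J + (1 + 2 / real J)) + real (card Ro) / real J
        = ((\<Sum>c\<in>below v. real (card (R c))) + real (card Ro)) / real J + real (card (below v)) * (1 + 2 / real J)"
      by (simp add: sum.distrib sum_divide_distrib add_divide_distrib)
    also have "\<dots> \<le> m / real J + real (card (below v)) * (11/9)"
      using rem J0 J2' by (intro add_mono divide_right_mono mult_left_mono) auto
    \<comment> \<open>\<open>38/9\<close> bounds \<open>2 + 2 + 2 / J\<close>: receivers of cut
      chunks, bins met only in part, and cut chunks of the own component. Each component below adds
      at most \<open>1 + 2 / J \<le> 11/9\<close>.\<close>
    finally have "real (card (q ` L v)) \<le> m + m * (1 / real J) + (38/9 + real (card (below v)) * (11/9))"
      using c1 p1 p2 p3 p4 J2' by simp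
    also have "m * (1 / real J) \<le> m * (\<epsilon> / 3)"
      using Jinv m(1) \<Gamma>_pos by (intro mult_left_mono) auto
    also have "38/9 + real (card (below v)) * (11/9) \<le> m * (\<epsilon> * (2/3))"
    proof -
      \<comment> \<open>\<open>38/9 + 3 * 11/9 = 71/9\<close> is just below 8, and
        \<open>8 / \<Gamma> = 2/3 * \<epsilon>\<close>; the remaining third of \<epsilon> went to
        \<open>1 / J\<close>.\<close>
      have "\<Gamma> * (38/9 + real (card (below v)) * (11/9)) \<le> 8 * m"
      proof -
        have "\<Gamma> * (38/9 + real (card (below v)) * (11/9)) = 38/9 * \<Gamma> + 11/9 * (\<Gamma> * real (card (below v)))"
          by (simp add: algebra_simps)
        then show ?thesis using m \<Gamma>_pos by linarith
      qed
      then show ?thesis using eps unfolding Gam by (simp add: field_simps)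
    qed
    finally show ?thesis by (simp add: m_def algebra_simps)
  qed
  have "cost q = (\<Sum>v\<in>M. wt v * real (card (q ` L v))) + (\<Sum>v\<in>N - M. wt v * real (card (q ` L v)))"
    unfolding cost_def using MN finite_N by (simp add: sum.subset_diff)
  also have "(\<Sum>v\<in>M. wt v * real (card (q ` L v))) \<le>
      (\<Sum>v\<in>M. wt v * (real (card (\<tau> ` {x \<in> L v. \<not> small x})) + e v))"
    using low1 wt_nonneg by (intro sum_mono mult_left_mono) (auto simp: M_def)
  also have "\<dots> \<le> (\<Sum>v\<in>M. wt v * (real (card (\<tau> ` {x \<in> L v. \<not> small x})) + a v))"
    using s by (simp add: distrib_left sum.distrib e_def a_def ch_def)
  also have "\<dots> \<le> (\<Sum>v\<in>M. wt v * ((1 + \<epsilon>) * real (card (\<tau> ` L v))))"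
    using low2 wt_nonneg by (intro sum_mono mult_left_mono) (auto simp: M_def)
  also have "(\<Sum>v\<in>N - M. wt v * real (card (q ` L v))) \<le>
      (\<Sum>v\<in>N - M. wt v * ((1 + \<epsilon>) * real (card (\<tau> ` L v))))"
    using high wt_nonneg by (intro sum_mono mult_left_mono) (auto simp: M_def)
  also have "(\<Sum>v\<in>M. wt v * ((1 + \<epsilon>) * real (card (\<tau> ` L v)))) +
      (\<Sum>v\<in>N - M. wt v * ((1 + \<epsilon>) * real (card (\<tau> ` L v)))) = (1 + \<epsilon>) * cost \<tau>"
  proof -
    have "(1 + \<epsilon>) * cost \<tau> = (\<Sum>v\<in>N. wt v * ((1 + \<epsilon>) * real (card (\<tau> ` L v))))"
      unfolding cost_def by (simp add: sum_distrib_left mult.left_commute)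
    then show ?thesis using MN finite_N by (simp add: sum.subset_diff)
  qed
  finally show ?thesis using adm by auto
qed

end

section \<open>Rooted trees\<close>

lemma gwalk_rev: "gwalk V E u p v \<Longrightarrow> gwalk V E v (rev p) u"
  by (auto simp: gwalk_def hd_rev last_rev insert_commute)

lemma gwalk_split:
  assumes "gwalk V E u (p @ z # q) v"
  shows "gwalk V E u (p @ [z]) z" and "gwalk V E z (z # q) v"
  using assms by (auto simp: gwalk_def successively_append_iff hd_append split: if_splits)

lemma gpath_split:
  assumes "gpath V E u (p @ z # q) v"
  shows "gpath V E u (p @ [z]) z" and "gpath V E z (z # q) v"
  using assms gwalk_split[of V E u p z q v] by (auto simp: gpath_def)

lemma gwalk_append:
  assumes "gwalk V E u p v" "gwalk V E v (v # s) z" "s \<noteq> []"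
  shows "gwalk V E u (p @ s) z"
  using assms by (simp add: gwalk_def successively_append_iff successively_Cons)

lemma gwalk_imp_gpath:
  assumes "gwalk V E u p v"
  shows "\<exists>q. gpath V E u q v"
  using assms
proof (induction "length p" arbitrary: p rule: less_induct)
  case less
  show ?case
  proof (cases "distinct p")
    case False
    then obtain a b c x where p: "p = a @ [x] @ b @ [x] @ c" using not_distinct_decomp by blast
    have "gwalk V E u (a @ [x]) x" using gwalk_split(1)[of V E u a x "b @ x # c" v] less.prems p by simp
    moreover have "gwalk V E x (x # c) v"
      using gwalk_split(2)[of V E u "a @ x # b" x c v] less.prems p by simp
    ultimately have "gwalk V E u (a @ x # c) v"
      by (auto simp: gwalk_def successively_append_iff hd_append split: if_splits)
    then show ?thesis using less.hyps[of "a @ x # c"] p by simp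
  qed (use less.prems in \<open>auto simp: gpath_def\<close>)
qed

text \<open>If the paths share an inner vertex, both are split there and induction applies to the
  parts. Otherwise \<open>p\<close> followed by the reverse of \<open>q\<close> is a cycle, unless
  both are the same single edge.\<close>

lemma gpath_unique:
  assumes acyclic: "\<nexists>c. gcycle V E c"
  shows "\<lbrakk>gpath V E u p v; gpath V E u q v\<rbrakk> \<Longrightarrow> p = q"
proof (induction "length p + length q" arbitrary: u v p q rule: less_induct)
  case less
  obtain p' q' where p: "p = u # p'" and q: "q = u # q'"
    using less.prems by (cases p; cases q) (auto simp: gpath_def gwalk_def)
  have lp: "last p = v" "last q = v" "distinct p" "distinct q"
    using less.prems by (auto simp: gpath_def gwalk_def)
  show ?case
  proof (cases "p' = [] \<or> q' = []")
    case True
    then have "u = v" using lp p q by auto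
    then have "p' = []" "q' = []" using lp p q by (auto split: if_splits)
    then show ?thesis using p q by simp
  next
    case ne: False
    show ?thesis
    proof (cases "\<exists>z. z \<in> set p' \<and> z \<in> set q' \<and> z \<noteq> v")
      case True
      then obtain z where z: "z \<in> set p'" "z \<in> set q'" "z \<noteq> v" by blast
      obtain a b where ab: "p' = a @ z # b" using z(1) by (meson split_list)
      obtain c d where cd: "q' = c @ z # d" using z(2) by (meson split_list)
      have bd: "b \<noteq> []" "d \<noteq> []" using z(3) lp(1,2) p q ab cd by auto
      have P: "gpath V E u ((u # a) @ z # b) v" and Q: "gpath V E u ((u # c) @ z # d) v"
        using less.prems p q ab cd by auto
      have "(u # a) @ [z] = (u # c) @ [z]"
        using gpath_split(1)[OF P] gpath_split(1)[OF Q] bd p q ab cd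
        by (intro less.hyps) (auto simp: neq_Nil_conv)
      moreover have "z # b = z # d"
        using gpath_split(2)[OF P] gpath_split(2)[OF Q] p q ab cd by (intro less.hyps) auto
      ultimately show ?thesis using p q ab cd by simp
    next
      case False
      show ?thesis
      proof (rule ccontr)
        assume "p \<noteq> q"
        obtain s where s: "rev q = v # s"
          using lp(2) q by (metis hd_Cons_tl hd_rev list.distinct(1) rev_is_Nil_conv)
        have q_eq: "q = rev s @ [v]" using s by (metis rev.simps(2) rev_swap)
        have sne: "s \<noteq> []" using q_eq q ne by auto
        have "rev q = rev q' @ [u]" by (simp add: q)
        then have ls: "last s = u" using s sne by (metis last.simps last_snoc)
        have wq: "gwalk V E v (v # s) u" using gwalk_rev[of V E u q v] less.prems(2) s by (auto simp: gpath_def)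
        have wp: "gwalk V E u p v" using less.prems(1) by (simp add: gpath_def)
        have "gwalk V E u (p @ s) u"
          using gwalk_append[OF wp wq sne] .
        moreover have "distinct (p' @ s)"
        proof -
          have "set s \<inter> set p' = {}"
          proof (rule ccontr)
            assume "set s \<inter> set p' \<noteq> {}"
            then obtain z where z: "z \<in> set s" "z \<in> set p'" by blast
            have "z \<noteq> v" using z(1) lp(4) q_eq by auto
            moreover have "z \<noteq> u" using z(2) lp(3) p by auto
            moreover have "z \<in> set q" using z(1) q_eq by simp
            ultimately show False using False z(2) q by auto
          qed
          then show ?thesis using lp(3,4) p q_eq by auto
        qed
        moreover have "length (p @ s) \<ge> 4"
        proof (rule ccontr)
          assume "\<not> 4 \<le> length (p @ s)"
          moreover have "length p \<ge> 2" "length s \<ge> 1" using ne p sne by (auto simp: Suc_le_eq)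
          ultimately have "length p = 2" "length s = 1" by auto
          then have "p = [u, v]" "q = [u, v]"
            using p q_eq lp ls by (auto simp: length_Suc_conv numeral_2_eq_2)
          then show False using \<open>p \<noteq> q\<close> by simp
        qed
        ultimately have "gcycle V E (p @ s)" using p by (auto simp: gcycle_def)
        then show False using acyclic by blast
      qed
    qed
  qed
qed

text \<open>A discrete intermediate value principle, locating where a walk enters or leaves a
  subtree.\<close>

lemma step_out:
  fixes P :: "nat \<Rightarrow> bool"
  assumes "P a" "\<not> P b" "a \<le> b"
  obtains i where "a \<le> i" "i < b" "P i" "\<not> P (Suc i)"
proof -
  have "\<exists>i. a \<le> i \<and> i < b \<and> P i \<and> \<not> P (Suc i)"
    using assms(3,2)
  proof (induction rule: dec_induct)
    case (step n)
    then show ?case by (cases "P n") (auto intro: less_SucI)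
  qed (use assms(1) in simp)
  then show ?thesis using that by blast
qed

lemma gwalk_edge_nth: "\<lbrakk>gwalk V E u p v; Suc i < length p\<rbrakk> \<Longrightarrow> {p ! i, p ! Suc i} \<in> E"
  by (auto simp: gwalk_def successively_conv_nth)

lemma gwalk_exits:
  assumes "gwalk V E u p v" "u \<in> A" "v \<notin> A"
  obtains x y where "x \<in> A" "y \<notin> A" "{x, y} \<in> E" "x \<in> V" "y \<in> V"
proof -
  have ne: "p \<noteq> []" and ends: "p ! 0 = u" "p ! (length p - 1) = v" "set p \<subseteq> V"
    using assms(1) by (auto simp: gwalk_def hd_conv_nth last_conv_nth)
  obtain i where i: "i < length p - 1" "p ! i \<in> A" "p ! Suc i \<notin> A"
    using step_out[of "\<lambda>i. p ! i \<in> A" 0 "length p - 1"] assms ends by auto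
  then have "p ! i \<in> V" "p ! Suc i \<in> V" using ends(3) nth_mem[of i p] nth_mem[of "Suc i" p] by auto
  then show ?thesis
    using that[of "p ! i" "p ! Suc i"] i gwalk_edge_nth[OF assms(1), of i] by auto
qed

lemma walk_cost_Cons: "walk_cost w (x # y # p) = w {x, y} + walk_cost w (y # p)"
  unfolding walk_cost_def by (simp add: sum.lessThan_Suc_shift del: sum.lessThan_Suc)

lemma walk_cost_append: "walk_cost w (a @ u # b) = walk_cost w (a @ [u]) + walk_cost w (u # b)"
proof (induction a)
  case Nil
  then show ?case by (simp add: walk_cost_def)
next
  case (Cons x a)
  have "walk_cost w [x] = 0" for x by (simp add: walk_cost_def)
  with Cons show ?case by (cases a) (simp_all add: walk_cost_Cons)
qed

section \<open>Parents, subtrees and closed walks in a rooted tree\<close>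

locale rooted_tree =
  fixes V :: "'v set" and E :: "'v set set" and r :: 'v
  assumes tree: "tree_graph V E" and root: "r \<in> V"
begin

lemma finite_V: "finite V"
  and edge_subset: "e \<in> E \<Longrightarrow> e \<subseteq> V"
  and edge_card: "e \<in> E \<Longrightarrow> card e = 2"
  and connected: "\<lbrakk>u \<in> V; v \<in> V\<rbrakk> \<Longrightarrow> \<exists>p. gwalk V E u p v"
  and acyclic: "\<nexists>c. gcycle V E c"
  using tree by (auto simp: tree_graph_def simple_graph_def gconnected_def)

definition path_to :: "'v \<Rightarrow> 'v list" where
  "path_to x = (THE p. gpath V E r p x)"

text \<open>Serves to name each edge by its lower end. At the root it is the unspecified
  \<open>last []\<close>, so edge sums range over \<open>V - {r}\<close>.\<close>

definition parent :: "'v \<Rightarrow> 'v" where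
  "parent x = last (butlast (path_to x))"

abbreviation desc :: "'v \<Rightarrow> 'v set" where
  "desc \<equiv> descendants V E r"

abbreviation pedge :: "'v \<Rightarrow> 'v set" where
  "pedge v \<equiv> {parent v, v}"

lemma path_to_eqI: "gpath V E r p x \<Longrightarrow> path_to x = p"
  unfolding path_to_def using gpath_unique[OF acyclic] by (blast intro: the_equality)

lemma gpath_path_to: "x \<in> V \<Longrightarrow> gpath V E r (path_to x) x"
  using connected[OF root] gwalk_imp_gpath path_to_eqI by metis

lemma desc_iff: "v \<in> desc u \<longleftrightarrow> v \<in> V \<and> u \<in> set (path_to v)"
  unfolding descendants_def using gpath_path_to path_to_eqI by blast

lemma path_to_root: "path_to r = [r]"
  using root by (intro path_to_eqI) (simp add: gpath_def gwalk_def)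

lemma path_to_ends:
  assumes "x \<in> V"
  shows "path_to x \<noteq> []" "hd (path_to x) = r" "last (path_to x) = x" "set (path_to x) \<subseteq> V"
    "distinct (path_to x)"
  using gpath_path_to[OF assms] by (auto simp: gpath_def gwalk_def)

lemma path_to_prefix:
  assumes "x \<in> V" "path_to x = a @ z # b"
  shows "path_to z = a @ [z]"
  using gpath_path_to[OF assms(1)] gpath_split(1)[of V E r a z b x] assms(2) by (auto intro: path_to_eqI)

lemma path_to_parent:
  assumes "x \<in> V" "x \<noteq> r"
  shows "path_to x = path_to (parent x) @ [x]" "parent x \<in> V" "pedge x \<in> E"
proof -
  define ys where "ys = butlast (path_to x)"
  have ys: "path_to x = ys @ [x]"
    unfolding ys_def using path_to_ends[OF assms(1)] by (metis append_butlast_last_id)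
  have "ys \<noteq> []" using ys path_to_ends(2)[OF assms(1)] assms(2) by auto
  then obtain a where a: "ys = a @ [parent x]"
    unfolding parent_def ys_def[symmetric] by (metis append_butlast_last_id)
  show "parent x \<in> V" using path_to_ends(4)[OF assms(1)] ys a by auto
  show "path_to x = path_to (parent x) @ [x]"
    using path_to_prefix[OF assms(1), of a "parent x" "[x]"] ys a by simp
  have "gwalk V E r (a @ [parent x, x]) x"
    using gpath_path_to[OF assms(1)] ys a by (simp add: gpath_def)
  then show "pedge x \<in> E" by (simp add: gwalk_def successively_append_iff)
qed

text \<open>Unless \<open>y\<close> lies on the path to \<open>x\<close>, appending \<open>y\<close>
  gives the path to \<open>y\<close>. If it does, the path to \<open>y\<close> extended by
  \<open>x\<close> is a path to \<open>x\<close>; uniqueness concludes.\<close>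

lemma edge_path_to:
  assumes "{x, y} \<in> E"
  shows "path_to y = path_to x @ [y] \<or> path_to x = path_to y @ [x]"
proof -
  have xy: "x \<in> V" "y \<in> V" "x \<noteq> y" using edge_subset[OF assms] edge_card[OF assms] by auto
  show ?thesis
  proof (cases "y \<in> set (path_to x)")
    case False
    have "gpath V E r (path_to x @ [y]) y"
      using gpath_path_to[OF xy(1)] False xy assms
      by (auto simp: gpath_def gwalk_def successively_append_iff)
    then show ?thesis using path_to_eqI by blast
  next
    case True
    then obtain a b where ab: "path_to x = a @ y # b" by (meson split_list)
    have py: "path_to y = a @ [y]" using path_to_prefix[OF xy(1) ab] .
    have "x \<notin> set (a @ [y])"
    proof
      assume "x \<in> set (a @ [y])"
      moreover have "x \<in> set b" using path_to_ends(3)[OF xy(1)] ab xy(3) by (auto split: if_splits)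
      ultimately show False using path_to_ends(5)[OF xy(1)] ab xy(3) by auto
    qed
    then have "gpath V E r (path_to y @ [x]) x"
      using gpath_path_to[OF xy(2)] py xy assms
      by (auto simp: gpath_def gwalk_def successively_append_iff insert_commute hd_append)
    then show ?thesis using path_to_eqI by blast
  qed
qed

lemma parent_eqI: "\<lbrakk>x \<in> V; path_to y = path_to x @ [y]\<rbrakk> \<Longrightarrow> parent y = x \<and> y \<noteq> r"
  using path_to_ends[of x] by (auto simp: parent_def path_to_root)

lemma edge_is_pedge:
  assumes "{x, y} \<in> E"
  shows "(y \<noteq> r \<and> parent y = x) \<or> (x \<noteq> r \<and> parent x = y)"
  using edge_path_to[OF assms] edge_subset[OF assms] parent_eqI by auto

lemma pedge_cases:
  assumes "e \<in> E"
  obtains v where "v \<in> V - {r}" "e = pedge v"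
proof -
  obtain x y where e: "e = {x, y}" using edge_card[OF assms] by (meson card_2_iff)
  then show ?thesis
    using edge_is_pedge[of x y] assms edge_subset[OF assms] that by (auto simp: insert_commute)
qed

lemma length_path_to: "\<lbrakk>v \<in> V; v \<noteq> r\<rbrakk> \<Longrightarrow> length (path_to v) = Suc (length (path_to (parent v)))"
  using path_to_parent(1) by (metis length_append_singleton)

lemma pedge_inj:
  assumes "u \<in> V - {r}" "v \<in> V - {r}" "pedge u = pedge v"
  shows "u = v"
  using assms length_path_to[of u] length_path_to[of v] by (auto simp: doubleton_eq_iff)

lemma self_desc: "v \<in> V \<Longrightarrow> v \<in> desc v"
  using path_to_ends[of v] by (metis desc_iff last_in_set)

lemma root_not_desc: "v \<noteq> r \<Longrightarrow> r \<notin> desc v"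
  by (simp add: desc_iff path_to_root)

lemma desc_parent:
  assumes "x \<in> V" "x \<noteq> r"
  shows "x \<in> desc v \<longleftrightarrow> x = v \<or> parent x \<in> desc v"
  using path_to_parent[OF assms] assms by (auto simp: desc_iff)

lemma desc_trans: "\<lbrakk>u \<in> desc v; x \<in> desc u\<rbrakk> \<Longrightarrow> x \<in> desc v"
proof -
  assume u: "u \<in> desc v" and x: "x \<in> desc u"
  then obtain a b where ab: "path_to x = a @ u # b" by (meson desc_iff split_list)
  have "path_to u = a @ [u]" using path_to_prefix[of x a u b] ab x by (simp add: desc_iff)
  then show "x \<in> desc v" using u x ab by (auto simp: desc_iff)
qed

lemma crossing_edge:
  assumes "{x, y} \<in> E" "x \<in> desc v" "y \<notin> desc v"
  shows "x = v \<and> y = parent v"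
proof -
  have xy: "x \<in> V" "y \<in> V" using edge_subset[OF assms(1)] by auto
  consider "y \<noteq> r" "parent y = x" | "x \<noteq> r" "parent x = y" using edge_is_pedge[OF assms(1)] by blast
  then show ?thesis
  proof cases
    case 1
    then show ?thesis using desc_parent[of y v] assms xy by auto
  next
    case 2
    then show ?thesis using desc_parent[of x v] assms xy by auto
  qed
qed

text \<open>A walk inside \<open>c\<close> has to leave the subtree of \<open>v\<close>, and the
  edge above \<open>v\<close> is the only exit.\<close>

lemma connected_cut:
  assumes "c \<subseteq> E" "gconnected (\<Union>c) c" "v \<in> V" "v \<noteq> r"
    "x \<in> \<Union>c" "x \<in> desc v" "y \<in> \<Union>c" "y \<notin> desc v"
  shows "pedge v \<in> c"
proof -
  have "\<exists>p. gwalk (\<Union>c) c x p y" using assms(2,5,7) unfolding gconnected_def by blast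
  then obtain p where "gwalk (\<Union>c) c x p y" ..
  then obtain a b where ab: "a \<in> desc v" "b \<notin> desc v" "{a, b} \<in> c"
    using assms(6,8) by (rule gwalk_exits)
  then have "a = v \<and> b = parent v" using crossing_edge assms(1) by blast
  then show ?thesis using ab(3) by (simp add: insert_commute)
qed

text \<open>Any other edge at \<open>l\<close> would lead to a child. This is what puts every
  terminal into exactly one component.\<close>

lemma leaf_edge:
  assumes "l \<in> leaves V E r" "l \<noteq> r" "e \<in> E" "l \<in> e"
  shows "e = pedge l"
proof -
  obtain v where v: "v \<in> V - {r}" "e = pedge v" using pedge_cases[OF assms(3)] .
  show ?thesis
  proof (cases "l = v")
    case False
    then have l: "l = parent v" using v assms(4) by auto
    have "v \<in> desc l" using desc_parent[of v l] v l self_desc[of l] path_to_parent(2)[of v] by auto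
    then have "v \<in> children V E r l" using v l assms(3) by (simp add: children_def)
    then show ?thesis using assms(1) by (auto simp: leaves_def)
  qed (use v in simp)
qed

lemma root_leaf_imp_trivial:
  assumes "r \<in> leaves V E r"
  shows "V = {r}"
proof (rule ccontr)
  assume "V \<noteq> {r}"
  then obtain v where v: "v \<in> V" "v \<noteq> r" using root by blast
  obtain q where q: "path_to v = r # q"
    using path_to_ends[OF v(1)] by (metis list.collapse)
  have "q \<noteq> []" using q path_to_ends(3)[OF v(1)] v(2) by auto
  then obtain s q' where s: "path_to v = [r] @ s # q'" using q by (cases q) auto
  have sV: "s \<in> V" using path_to_ends(4)[OF v(1)] s by auto
  have ps: "path_to s = [r, s]" using path_to_prefix[OF v(1) s] by simp
  have "{r, s} \<in> E" using gpath_path_to[OF sV] ps by (simp add: gpath_def gwalk_def)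
  then have "s \<in> children V E r r" using sV ps by (simp add: children_def desc_iff)
  then show False using assms by (auto simp: leaves_def)
qed

text \<open>The walk starts and ends outside \<open>desc v\<close>, so it crosses the edge above
  \<open>v\<close> both before and after a visit inside. Distinct edges are crossed at disjoint sets
  of steps.\<close>

lemma walk_cost_ge:
  assumes nonneg: "\<forall>e\<in>E. 0 \<le> w e" and p: "gwalk V E r p r" and A: "A \<subseteq> set p"
  shows "2 * (\<Sum>v | v \<in> V - {r} \<and> A \<inter> desc v \<noteq> {}. w (pedge v)) \<le> walk_cost w p"
proof -
  let ?n = "length p - 1"
  define cross where "cross v = {i. i < ?n \<and> {p ! i, p ! Suc i} = pedge v}" for v
  have ne: "p \<noteq> []" and ends: "p ! 0 = r" "p ! ?n = r"
    using p by (auto simp: gwalk_def hd_conv_nth last_conv_nth)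
  have edge: "{p ! i, p ! Suc i} \<in> E" if "i < ?n" for i using gwalk_edge_nth[OF p, of i] that by simp
  have two: "2 \<le> card (cross v)" if v: "v \<in> V - {r}" "A \<inter> desc v \<noteq> {}" for v
  proof -
    have vr: "v \<noteq> r" using v(1) by blast
    obtain x where "x \<in> set p" "x \<in> desc v" using v A by blast
    then obtain j where j: "j < length p" "p ! j \<in> desc v" by (auto simp: in_set_conv_nth)
    have r0: "p ! 0 \<notin> desc v" "p ! ?n \<notin> desc v" using ends root_not_desc[OF vr] by auto
    obtain i1 where i1: "i1 < j" "p ! i1 \<notin> desc v" "p ! Suc i1 \<in> desc v"
      using step_out[of "\<lambda>i. p ! i \<notin> desc v" 0 j] r0 j by auto
    obtain i2 where i2: "j \<le> i2" "i2 < ?n" "p ! i2 \<in> desc v" "p ! Suc i2 \<notin> desc v"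
      
    proof (rule step_out[of "\<lambda>i. p ! i \<in> desc v" j ?n])
      show "j \<le> ?n" using j(1) by simp
    qed (use r0 j in auto)
    have "{p ! Suc i1, p ! i1} \<in> E" using edge[of i1] i1 j by (simp add: insert_commute)
    then have "i1 \<in> cross v" using crossing_edge[OF _ i1(3,2)] i1(1) j by (auto simp: cross_def)
    moreover have "i2 \<in> cross v"
      using crossing_edge[OF edge[OF i2(2)] i2(3,4)] i2(2) by (auto simp: cross_def insert_commute)
    ultimately have "{i1, i2} \<subseteq> cross v" by simp
    then have "card {i1, i2} \<le> card (cross v)" by (intro card_mono) (auto simp: cross_def)
    then show ?thesis using i1 i2 by simp
  qed
  have fin: "finite (V - {r})" using finite_V by simp
  have disj: "cross u \<inter> cross v = {}" if "u \<in> V - {r}" "v \<in> V - {r}" "u \<noteq> v" for u v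
    using pedge_inj[OF that(1,2)] that(3) by (auto simp: cross_def)
  have cover: "(\<Union>v\<in>V - {r}. cross v) = {..<?n}"
  proof
    show "{..<?n} \<subseteq> (\<Union>v\<in>V - {r}. cross v)"
    proof
      fix i assume i: "i \<in> {..<?n}"
      obtain v where "v \<in> V - {r}" "{p ! i, p ! Suc i} = pedge v" using pedge_cases[OF edge] i by blast
      then show "i \<in> (\<Union>v\<in>V - {r}. cross v)" using i by (auto simp: cross_def)
    qed
  qed (auto simp: cross_def)
  have "2 * (\<Sum>v | v \<in> V - {r} \<and> A \<inter> desc v \<noteq> {}. w (pedge v))
      = (\<Sum>v | v \<in> V - {r} \<and> A \<inter> desc v \<noteq> {}. 2 * w (pedge v))" by (simp add: sum_distrib_left)
  also have "\<dots> \<le> (\<Sum>v | v \<in> V - {r} \<and> A \<inter> desc v \<noteq> {}. real (card (cross v)) * w (pedge v))"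
  proof (rule sum_mono)
    fix v assume v: "v \<in> {v \<in> V - {r}. A \<inter> desc v \<noteq> {}}"
    have "0 \<le> w (pedge v)" using v path_to_parent(3)[of v] nonneg by auto
    then show "2 * w (pedge v) \<le> real (card (cross v)) * w (pedge v)"
      using two v by (intro mult_right_mono) auto
  qed
  also have "\<dots> \<le> (\<Sum>v\<in>V - {r}. real (card (cross v)) * w (pedge v))"
    using fin nonneg path_to_parent(3) by (intro sum_mono2) auto
  also have "\<dots> = (\<Sum>v\<in>V - {r}. \<Sum>i\<in>cross v. w {p ! i, p ! Suc i})"
    by (intro sum.cong) (auto simp: cross_def)
  also have "\<dots> = (\<Sum>i\<in>(\<Union>v\<in>V - {r}. cross v). w {p ! i, p ! Suc i})"
    using fin disj by (intro sum.UNION_disjoint[symmetric]) (auto simp: cross_def)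
  also have "\<dots> = walk_cost w p" unfolding cover walk_cost_def ..
  finally show ?thesis .
qed

text \<open>The vertex sets of subtrees containing \<open>r\<close>; tours and the depth-first order
  are built over them one vertex at a time.\<close>

definition parent_closed :: "'v set \<Rightarrow> bool" where
  "parent_closed S \<longleftrightarrow> S \<subseteq> V \<and> r \<in> S \<and> (\<forall>v\<in>S. v \<noteq> r \<longrightarrow> parent v \<in> S)"

lemma parent_closed_desc:
  assumes "parent_closed S" "x \<in> S" "x \<in> desc v"
  shows "v \<in> S"
  using assms(2,3)
proof (induction "length (path_to x)" arbitrary: x rule: less_induct)
  case less
  have xV: "x \<in> V" using less.prems(2) by (simp add: desc_iff)
  show ?case
  proof (cases "x = v")
    case False
    then have "x \<noteq> r" using less.prems(2) by (auto simp: desc_iff path_to_root)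
    then show ?thesis
      using less.hyps[of "parent x"] desc_parent[OF xV, of v] length_path_to[OF xV] less.prems False assms(1)
      by (auto simp: parent_closed_def)
  qed (use less.prems in simp)
qed

text \<open>A vertex of greatest depth is nobody's parent within \<open>S\<close>, so removing it
  leaves a parent-closed set.\<close>

lemma parent_closed_induct [consumes 1, case_names root insert]:
  assumes "parent_closed S"
    and base: "P {r}"
    and step: "\<And>S v. \<lbrakk>parent_closed S; v \<in> V; v \<noteq> r; v \<notin> S; parent v \<in> S; P S\<rbrakk> \<Longrightarrow> P (insert v S)"
  shows "P S"
  using assms(1)
proof (induction "card S" arbitrary: S rule: less_induct)
  case less
  have fin: "finite S" using less.prems finite_V finite_subset by (auto simp: parent_closed_def)
  show ?case
  proof (cases "S = {r}")
    case False
    then have ne: "S - {r} \<noteq> {}" using less.prems by (auto simp: parent_closed_def)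
    define m where "m = Max ((\<lambda>v. length (path_to v)) ` (S - {r}))"
    have "m \<in> (\<lambda>v. length (path_to v)) ` (S - {r})"
      unfolding m_def using fin ne by (intro Max_in) auto
    then obtain v where v: "v \<in> S - {r}" "m = length (path_to v)" by blast
    have mx: "length (path_to x) \<le> length (path_to v)" if "x \<in> S - {r}" for x
      unfolding v(2)[symmetric] m_def using fin that by (intro Max_ge) auto
    have vV: "v \<in> V" "v \<noteq> r" using v less.prems by (auto simp: parent_closed_def)
    have "parent v \<noteq> v" using length_path_to[OF vV] by (metis n_not_Suc_n)
    then have pv: "parent v \<in> S - {v}" using v(1) vV(2) less.prems by (simp add: parent_closed_def)
    have "parent_closed (S - {v})"
    proof -
      have "parent x \<in> S - {v}" if x: "x \<in> S - {v}" "x \<noteq> r" for x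
      proof -
        have "x \<in> V" using x less.prems by (auto simp: parent_closed_def)
        then have "length (path_to x) = Suc (length (path_to (parent x)))" using length_path_to x(2) by blast
        then have "parent x \<noteq> v" using mx[of x] x by auto
        then show ?thesis using x less.prems by (simp add: parent_closed_def)
      qed
      then show ?thesis using less.prems vV unfolding parent_closed_def by blast
    qed
    moreover have "card (S - {v}) < card S" using v fin by (intro psubset_card_mono) auto
    ultimately have "P (insert v (S - {v}))" using step less.hyps vV pv by blast
    then show ?thesis using v by (simp add: insert_absorb)
  qed (use base in simp)
qed

text \<open>Each new vertex is reached by a detour from its parent and back, which adds its edge
  twice.\<close>

lemma parent_closed_walk:
  assumes "parent_closed S"
  shows "\<exists>p. gwalk V E r p r \<and> S \<subseteq> set p \<and> walk_cost w p = 2 * (\<Sum>v\<in>S - {r}. w (pedge v))"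
  using assms
proof (induction rule: parent_closed_induct)
  case root
  have "gwalk V E r [r] r" using rooted_tree.root[OF rooted_tree_axioms] by (simp add: gwalk_def)
  then show ?case by (intro exI[of _ "[r]"]) (simp add: walk_cost_def)
next
  case (insert S v)
  let ?u = "parent v"
  obtain p where p: "gwalk V E r p r" "S \<subseteq> set p" "walk_cost w p = 2 * (\<Sum>v\<in>S - {r}. w (pedge v))"
    using insert.IH by blast
  obtain a b where ab: "p = a @ ?u # b" using p(2) insert.hyps(5) by (meson split_list subsetD)
  let ?p = "a @ ?u # v # ?u # b"
  have e: "{?u, v} \<in> E" "{v, ?u} \<in> E"
    using path_to_parent(3)[OF insert.hyps(2,3)] by (auto simp: insert_commute)
  have "gwalk V E r ?p r"
    using p(1) ab e insert.hyps(2)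
    by (auto simp: gwalk_def successively_append_iff hd_append split: if_splits)
  moreover have "insert v S \<subseteq> set ?p" using p(2) ab by auto
  moreover have "walk_cost w ?p = 2 * (\<Sum>v\<in>insert v S - {r}. w (pedge v))"
  proof -
    have "walk_cost w ?p = walk_cost w (a @ [?u]) + (w {?u, v} + (w {v, ?u} + walk_cost w (?u # b)))"
      by (simp only: walk_cost_append[of w a ?u "v # ?u # b"] walk_cost_Cons)
    also have "\<dots> = walk_cost w p + 2 * w (pedge v)"
      unfolding ab walk_cost_append[of w a ?u b] by (simp add: insert_commute)
    also have "\<dots> = 2 * (\<Sum>v\<in>insert v S - {r}. w (pedge v))"
    proof -
      have "finite S" using insert.hyps(1) finite_V finite_subset by (auto simp: parent_closed_def)
      moreover have "insert v S - {r} = insert v (S - {r})" using insert.hyps(3) by blast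
      ultimately show ?thesis using p(3) insert.hyps(4) by simp
    qed
    finally show ?thesis .
  qed
  ultimately show ?case by blast
qed

lemma parent_closed_V: "parent_closed V"
  using root path_to_parent(2) by (auto simp: parent_closed_def)

text \<open>Attains the bound of \<open>walk_cost_ge\<close> by walking round the subtree formed by
  the ancestors of \<open>A\<close>.\<close>

lemma visiting_walk:
  assumes "A \<subseteq> V"
  shows "\<exists>p. gwalk V E r p r \<and> A \<subseteq> set p \<and>
    walk_cost w p = 2 * (\<Sum>v | v \<in> V - {r} \<and> A \<inter> desc v \<noteq> {}. w (pedge v))"
proof -
  let ?S = "insert r {v \<in> V. A \<inter> desc v \<noteq> {}}"
  have "parent_closed ?S"
  proof -
    have "A \<inter> desc (parent v) \<noteq> {}" if v: "v \<in> V" "v \<noteq> r" "A \<inter> desc v \<noteq> {}" for v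
    proof -
      have "v \<in> desc (parent v)" using desc_parent[OF v(1,2)] path_to_parent(2)[OF v(1,2)] self_desc by auto
      then show ?thesis using v(3) desc_trans by blast
    qed
    then show ?thesis using root path_to_parent(2) by (auto simp: parent_closed_def)
  qed
  from parent_closed_walk[OF this, of w] obtain p where p: "gwalk V E r p r" "?S \<subseteq> set p"
    "walk_cost w p = 2 * (\<Sum>v\<in>?S - {r}. w (pedge v))" by blast
  have "?S - {r} = {v \<in> V - {r}. A \<inter> desc v \<noteq> {}}" by auto
  moreover have "A \<subseteq> ?S" using assms self_desc by blast
  ultimately show ?thesis using p by (intro exI[of _ p]) auto
qed

text \<open>A depth-first order: each new vertex is placed immediately after its parent.\<close>
lemma parent_closed_rank:
  assumes "parent_closed S"
  shows "\<exists>f :: 'v \<Rightarrow> real. inj_on f S \<and>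
    (\<forall>a x y z. x \<in> S \<longrightarrow> z \<in> S \<longrightarrow> y \<in> S \<longrightarrow> x \<in> desc a \<longrightarrow> z \<in> desc a \<longrightarrow>
      f x \<le> f y \<longrightarrow> f y \<le> f z \<longrightarrow> y \<in> desc a)"
  using assms
proof (induction rule: parent_closed_induct)
  case (insert S v)
  let ?u = "parent v"
  obtain f :: "'v \<Rightarrow> real" where f: "inj_on f S"
    "\<And>a x y z. \<lbrakk>x \<in> S; z \<in> S; y \<in> S; x \<in> desc a; z \<in> desc a; f x \<le> f y; f y \<le> f z\<rbrakk> \<Longrightarrow> y \<in> desc a"
    using insert.IH by blast
  have fin: "finite S" using insert.hyps(1) finite_V finite_subset by (auto simp: parent_closed_def)
  \<comment> \<open>Room strictly between the rank of the parent and the next larger rank: density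
    is why ranks are real.\<close>
  obtain t where t: "f ?u < t" "\<And>x. x \<in> S \<Longrightarrow> f x \<le> f ?u \<or> t < f x"
  proof -
    define U where "U = f ` {x \<in> S. f ?u < f x}"
    have "finite U" using fin by (simp add: U_def)
    moreover have "\<forall>y\<in>U. f ?u < y" by (auto simp: U_def)
    ultimately have "\<exists>t > f ?u. \<forall>y\<in>U. t < y"
    proof (induction U rule: finite_induct)
      case empty
      then show ?case using lt_ex gt_ex by auto
    next
      case (insert y U)
      then obtain t where "f ?u < t" "\<forall>y\<in>U. t < y" by auto
      moreover obtain t' where "f ?u < t'" "t' < min t y" using dense[of "f ?u" "min t y"] calculation insert.prems by auto
      ultimately show ?case by (intro exI[of _ t']) auto
    qed
    then show ?thesis using that by (force simp: U_def not_less)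
  qed
  define g where "g = f(v := t)"
  have gS: "g x = f x" if "x \<in> S" for x using that insert.hyps(4) by (auto simp: g_def)
  have gv: "g v = t" by (simp add: g_def)
  have "inj_on g (insert v S)"
  proof -
    have "inj_on g S" using f(1) gS by (simp add: inj_on_def)
    moreover have "g v \<notin> g ` (S - {v})"
      using t gS gv by (force simp: image_iff)
    ultimately show ?thesis by (simp add: inj_on_insert)
  qed
  moreover have "y \<in> desc a"
    if h: "x \<in> insert v S" "z \<in> insert v S" "y \<in> insert v S" "x \<in> desc a" "z \<in> desc a" "g x \<le> g y" "g y \<le> g z"
    for a x y z
  proof (cases "a = v")
    case True
    \<comment> \<open>\<open>S\<close> is closed under ancestors and lacks \<open>v\<close>, so it
      contains nothing of the subtree of \<open>v\<close>.\<close>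
    have "x = v" "z = v" using h parent_closed_desc[OF insert.hyps(1)] insert.hyps(4) True by blast+
    then have "g y = g v" using h by simp
    then have "y = v" using inj_onD[OF \<open>inj_on g (insert v S)\<close>, of y v] h(3) by simp
    then show ?thesis using h \<open>x = v\<close> by simp
  next
    case False
    have va: "v \<in> desc a \<longleftrightarrow> ?u \<in> desc a" using desc_parent[OF insert.hyps(2,3)] False by auto
    have uS: "?u \<in> S" by (rule insert.hyps(5))
    show ?thesis
    proof (cases "?u \<in> desc a")
      case True
      show ?thesis
      proof (cases "y = v")
        case yv: False
        then have yS: "y \<in> S" using h(3) by simp
        \<comment> \<open>No vertex of \<open>S\<close> ranks between \<open>?u\<close> and
          \<open>v\<close>, so \<open>v\<close> may be replaced by its parent when compared with
          \<open>y\<close>.\<close>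
        define x' where "x' = (if x = v then ?u else x)"
        define z' where "z' = (if z = v then ?u else z)"
        have x': "x' \<in> S" "x' \<in> desc a" "f x' \<le> f y"
          using h True uS gS gv t(1) yS by (auto simp: x'_def split: if_splits)
        have z': "z' \<in> S" "z' \<in> desc a" using h True uS by (auto simp: z'_def)
        have "f y \<le> f z'"
          using h gS gv yS t(2)[OF yS] by (auto simp: z'_def split: if_splits)
        then show ?thesis using f(2) x' z' yS by blast
      qed (use va True in simp)
    next
      case False
      then have xz: "x \<in> S" "z \<in> S" using h va by auto
      show ?thesis
      proof (cases "y = v")
        case True
        \<comment> \<open>If \<open>v\<close> fell between \<open>x\<close> and \<open>z\<close>, so
          would its parent, which lies outside \<open>desc a\<close>.\<close>
        have "f x \<le> f ?u" using h(6) gS[OF xz(1)] gv True t(2)[OF xz(1)] by auto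
        moreover have "f ?u \<le> f z" using h(7) gS[OF xz(2)] gv True t(1) by auto
        ultimately have "?u \<in> desc a" using f(2) xz uS h(4,5) by blast
        then show ?thesis using False by simp
      next
        case yv: False
        then have yS: "y \<in> S" using h(3) by simp
        have "f x \<le> f y" "f y \<le> f z" using h(6,7) gS[OF xz(1)] gS[OF xz(2)] gS[OF yS] by simp_all
        then show ?thesis using f(2)[OF xz yS h(4,5)] by blast
      qed
    qed
  qed
  ultimately show ?case by (intro exI[of _ g]) blast
qed auto

end

section \<open>From labellings to solutions\<close>

context laminar_routing
begin

text \<open>When \<open>\<alpha> * k \<le> 1\<close> every nonempty piece is dense, and a component
  has at most \<open>2 * \<Gamma> * k \<le> 2 * \<Gamma> / \<alpha>\<close> terminals, let alone
  tours.\<close>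

lemma trivial_regrouping:
  fixes \<tau> :: "'a \<Rightarrow> 't"
  assumes cap: "\<And>t. card {x \<in> X. \<tau> x = t} \<le> k" and alp: "0 < \<alpha>" "\<alpha> * real k \<le> 1"
  shows "admissible \<alpha> (Inl \<circ> \<tau> :: 'a \<Rightarrow> 't + 'c \<times> nat)" and "cost (Inl \<circ> \<tau> :: 'a \<Rightarrow> 't + 'c \<times> nat) = cost \<tau>"
proof -
  let ?q = "Inl \<circ> \<tau> :: 'a \<Rightarrow> 't + 'c \<times> nat"
  show "cost ?q = cost \<tau>" by (simp add: cost_def card_image flip: image_image)
  show "admissible \<alpha> ?q"
    unfolding admissible_def
  proof (intro conjI allI)
    fix l :: "'t + 'c \<times> nat"
    show "card {x \<in> X. ?q x = l} \<le> k" using cap by (cases l) auto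
    have "\<alpha> * real k \<le> real (card {y \<in> X. ?q y = l \<and> comp y = comp x})" if "x \<in> X" "?q x = l" for x
    proof -
      have "card {x} \<le> card {y \<in> X. ?q y = l \<and> comp y = comp x}"
        using finite_X that by (intro card_mono) auto
      then show ?thesis using alp(2) by simp
    qed
    then show "(\<exists>c. \<forall>x\<in>X. ?q x = l \<longrightarrow> comp x = c) \<or>
        (\<forall>x\<in>X. ?q x = l \<longrightarrow> \<alpha> * real k \<le> real (card {y \<in> X. ?q y = l \<and> comp y = comp x}))" by blast
  next
    fix c
    have "real (card (?q ` {x \<in> X. comp x = c})) \<le> real (card {x \<in> X. comp x = c})"
      using finite_X by (intro of_nat_mono card_image_le) simp
    also have "\<dots> \<le> 2 * \<Gamma> * real k" by (rule comp_size)
    also have "\<dots> \<le> 2 * \<Gamma> / \<alpha>"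
    proof -
      have "(2 * \<Gamma>) * (\<alpha> * real k) \<le> (2 * \<Gamma>) * 1" using alp(2) \<Gamma>_pos by (intro mult_left_mono) auto
      then show ?thesis using alp(1) by (simp add: pos_le_divide_eq mult_ac)
    qed
    finally show "real (card (?q ` {x \<in> X. comp x = c})) \<le> 2 * \<Gamma> / \<alpha> + 1" by linarith
  qed
qed

lemma cost_nonneg: "0 \<le> cost q"
  unfolding cost_def using wt_nonneg by (intro sum_nonneg) auto

theorem regrouping:
  fixes \<tau> :: "'a \<Rightarrow> 't"
  assumes cap: "\<And>t. card {x \<in> X. \<tau> x = t} \<le> k"
    and eps: "0 < \<epsilon>" "\<epsilon> < 1" and Gam: "\<Gamma> = 12 / \<epsilon>" and alp: "\<alpha> = \<epsilon> powr (1 / \<epsilon> + 1)"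
  shows "\<exists>q :: 'a \<Rightarrow> 't + 'c \<times> nat. admissible \<alpha> q \<and> cost q \<le> (1 + \<epsilon>) * cost \<tau>"
proof -
  have a0: "0 < \<alpha>" using eps alp by simp
  show ?thesis
  proof (cases "1/3 \<le> \<epsilon>")
    case True
    have "\<alpha> \<le> \<epsilon> powr 1" unfolding alp using eps by (intro powr_mono') auto
    then show ?thesis using coarse_regrouping[OF cap True _ Gam a0] eps by simp
  next
    case False
    show ?thesis
    proof (cases "1 < \<alpha> * real k")
      case True
      have "3 \<le> 1 / \<epsilon>" using False eps by (simp add: pos_le_divide_eq)
      then have "\<alpha> \<le> \<epsilon> powr (real 4)" unfolding alp using eps by (intro powr_mono') auto
      then have "\<alpha> \<le> \<epsilon> ^ 4" by (simp only: powr_realpow[OF eps(1)])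
      then show ?thesis using fine_regrouping[OF cap eps(1) _ Gam a0 _ True] False by simp
    next
      case small: False
      have "cost \<tau> \<le> (1 + \<epsilon>) * cost \<tau>" using cost_nonneg[of \<tau>] eps by (simp add: algebra_simps)
      moreover have "\<alpha> * real k \<le> 1" using small by simp
      ultimately show ?thesis
        using trivial_regrouping[OF cap a0] by (intro exI[of _ "Inl \<circ> \<tau>"]) simp
    qed
  qed
qed

text \<open>The label type may be infinite, but the cost depends only on how many labels each edge
  sees, and these numbers are at most \<open>card X\<close>. Hence a cheapest labelling
  exists.\<close>

lemma finite_costs: "finite (range (cost :: ('a \<Rightarrow> 't) \<Rightarrow> real))"
proof -
  have "range (cost :: ('a \<Rightarrow> 't) \<Rightarrow> real) \<subseteq>
      (\<lambda>n. \<Sum>v\<in>N. wt v * real (n v)) ` (N \<rightarrow>\<^sub>E {..card X})"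
  proof
    fix y assume "y \<in> range (cost :: ('a \<Rightarrow> 't) \<Rightarrow> real)"
    then obtain \<tau> :: "'a \<Rightarrow> 't" where y: "y = cost \<tau>" by blast
    have "card (\<tau> ` L v) \<le> card X" if "v \<in> N" for v
      using card_image_le[OF finite_L[OF that], of \<tau>] card_mono[OF finite_X L_subset[OF that]] by linarith
    then have "restrict (\<lambda>v. card (\<tau> ` L v)) N \<in> N \<rightarrow>\<^sub>E {..card X}" by auto
    moreover have "y = (\<Sum>v\<in>N. wt v * real (restrict (\<lambda>v. card (\<tau> ` L v)) N v))"
      unfolding y cost_def by (intro sum.cong) auto
    ultimately show "y \<in> (\<lambda>n. \<Sum>v\<in>N. wt v * real (n v)) ` (N \<rightarrow>\<^sub>E {..card X})" by blast
  qed
  moreover have "finite (N \<rightarrow>\<^sub>E {..card X})" using finite_N by (intro finite_PiE) auto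
  ultimately show ?thesis using finite_surj by blast
qed

lemma cheapest_labelling:
  fixes \<tau>0 :: "'a \<Rightarrow> 't"
  assumes "\<And>t. card {x \<in> X. \<tau>0 x = t} \<le> k"
  obtains \<tau> :: "'a \<Rightarrow> 't" where "\<And>t. card {x \<in> X. \<tau> x = t} \<le> k"
    "\<And>\<tau>' :: 'a \<Rightarrow> 't. (\<And>t. card {x \<in> X. \<tau>' x = t} \<le> k) \<Longrightarrow> cost \<tau> \<le> cost \<tau>'"
proof -
  define F :: "('a \<Rightarrow> 't) set" where "F = {\<tau>. \<forall>t. card {x \<in> X. \<tau> x = t} \<le> k}"
  have fin: "finite (cost ` F)" using finite_costs by (rule finite_subset[rotated]) blast
  have "cost ` F \<noteq> {}" using assms by (auto simp: F_def)
  from Min_in[OF fin this] obtain \<tau> where \<tau>: "\<tau> \<in> F" "Min (cost ` F) = cost \<tau>" by blast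
  have "cost \<tau> \<le> cost \<tau>'" if "\<tau>' \<in> F" for \<tau>'
    unfolding \<tau>(2)[symmetric] using fin that by (intro Min_le) auto
  then show ?thesis using that \<tau>(1) by (auto simp: F_def)
qed

end

lemma sum_restrict_swap:
  fixes g :: "'b \<Rightarrow> real"
  assumes "finite N" "finite T"
  shows "(\<Sum>t\<in>T. \<Sum>v | v \<in> N \<and> R t v. g v) = (\<Sum>v\<in>N. g v * real (card {t \<in> T. R t v}))"
proof -
  have "(\<Sum>t\<in>T. \<Sum>v | v \<in> N \<and> R t v. g v) = (\<Sum>v\<in>N. \<Sum>t | t \<in> T \<and> R t v. g v)"
    using assms(2,1) by (rule sum.swap_restrict)
  then show ?thesis by (simp add: mult.commute)
qed

context rooted_tree
begin

text \<open>A tour is padded up to \<open>\<alpha> * k\<close> only if it stays inside one component, so that the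
  padding cannot exceed the capacity; the dummies sit at terminals the tour already visits.\<close>
lemma solution_of_labelling:
  fixes q :: "'v \<Rightarrow> 'l" and comp :: "'v \<Rightarrow> 'v set set" and \<alpha> m :: real
  assumes XV: "X \<subseteq> V" and comp: "\<And>x c. \<lbrakk>x \<in> X; c \<in> C\<rbrakk> \<Longrightarrow> x \<in> \<Union>c \<longleftrightarrow> comp x = c"
    and cap: "\<And>l. card {x \<in> X. q x = l} \<le> k"
    and dense: "\<And>l. (\<exists>c. \<forall>x\<in>X. q x = l \<longrightarrow> comp x = c) \<or>
      (\<forall>x\<in>X. q x = l \<longrightarrow> \<alpha> * real k \<le> real (card {y \<in> X. q y = l \<and> comp y = comp x}))"
    and few: "\<And>c. real (card (q ` {x \<in> X. comp x = c})) \<le> m"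
    and alp: "\<alpha> \<le> 1"
  shows "\<exists>(D :: nat set) pos (S :: ('v, 'v + nat) tour set).
    finite D \<and> pos ` D \<subseteq> V \<and> cvrp_solution V E r k (X <+> D) (case_sum id pos) S \<and>
    (\<forall>c\<in>C. real (card {t \<in> S. visited_in (case_sum id pos) c t \<noteq> {}}) \<le> m) \<and>
    (\<forall>c\<in>C. \<forall>t\<in>S. visited_in (case_sum id pos) c t \<noteq> {} \<longrightarrow>
       \<alpha> * real k \<le> real (card (visited_in (case_sum id pos) c t))) \<and>
    cvrp_cost w S = 2 * (\<Sum>v\<in>V - {r}. w (pedge v) * real (card (q ` (desc v \<inter> X))))"
proof -
  have finX: "finite X" using XV finite_V finite_subset by blast
  define fib where "fib l = {x \<in> X. q x = l}" for l
  define single where "single l \<longleftrightarrow> (\<exists>c. \<forall>x\<in>X. q x = l \<longrightarrow> comp x = c)" for l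
  \<comment> \<open>Truncated subtraction: no padding if the tour already has enough
    terminals.\<close>
  define d where "d l = (if single l then nat \<lceil>\<alpha> * real k\<rceil> - card (fib l) else 0)" for l
  define Z where "Z = (SIGMA l : q ` X. {..<d l})"
  have finfib: "finite (fib l)" for l using finX by (simp add: fib_def)
  have ceil: "nat \<lceil>\<alpha> * real k\<rceil> \<le> k"
  proof -
    have "\<alpha> * real k \<le> 1 * real k" using alp by (intro mult_right_mono) auto
    then show ?thesis by linarith
  qed
  have size: "card (fib l) + d l \<le> k" for l
  proof -
    have "card (fib l) \<le> k" using cap[of l] by (simp add: fib_def)
    moreover have "a + (b - a) \<le> k" if "a \<le> k" "b \<le> k" for a b :: nat using that by simp
    ultimately show ?thesis using ceil by (simp only: d_def split: if_split) simp
  qed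
  have "finite Z" using finX by (auto simp: Z_def)
  \<comment> \<open>Numbering the padding requests makes the dummies natural numbers;
    \<open>lab\<close> recovers the tour a dummy pads.\<close>
  then obtain \<beta> where \<beta>: "bij_betw \<beta> {0..<card Z} Z" using ex_bij_betw_nat_finite by blast
  define D where "D = {0..<card Z}"
  define lab where "lab n = fst (\<beta> n)" for n
  have lab: "lab n \<in> q ` X" if "n \<in> D" for n
  proof -
    have "\<beta> n \<in> Z" using that \<beta> by (auto simp: D_def bij_betw_def)
    then show ?thesis by (auto simp: lab_def Z_def)
  qed
  have card_lab: "card {n \<in> D. lab n = l} = d l" if l: "l \<in> q ` X" for l
  proof -
    have "\<beta> ` {n \<in> D. lab n = l} = {z \<in> Z. fst z = l}"
    proof -
      have "Z = \<beta> ` D" using \<beta> by (simp add: D_def bij_betw_def)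
      then show ?thesis by (auto simp: lab_def)
    qed
    also have "\<dots> = Pair l ` {..<d l}" using l by (auto simp: Z_def)
    finally have "card (\<beta> ` {n \<in> D. lab n = l}) = d l" by (simp add: card_image inj_on_def)
    moreover have "inj_on \<beta> {n \<in> D. lab n = l}"
      using \<beta> by (auto simp: D_def bij_betw_def inj_on_def)
    ultimately show ?thesis by (simp add: card_image)
  qed
  define pos where "pos n = (SOME x. x \<in> fib (lab n))" for n
  have pos: "pos n \<in> fib (lab n)" if "n \<in> D" for n
  proof -
    have "\<exists>x. x \<in> fib (lab n)" using lab[OF that] by (auto simp: fib_def)
    then show ?thesis unfolding pos_def by (rule someI_ex)
  qed
  let ?loc = "case_sum id pos"
  have "\<forall>l. \<exists>p. gwalk V E r p r \<and> fib l \<subseteq> set p \<and>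
      walk_cost w p = 2 * (\<Sum>v | v \<in> V - {r} \<and> fib l \<inter> desc v \<noteq> {}. w (pedge v))"
  proof
    fix l
    have "fib l \<subseteq> V" using XV by (auto simp: fib_def)
    from visiting_walk[OF this, of w] show "\<exists>p. gwalk V E r p r \<and> fib l \<subseteq> set p \<and>
      walk_cost w p = 2 * (\<Sum>v | v \<in> V - {r} \<and> fib l \<inter> desc v \<noteq> {}. w (pedge v))" .
  qed
  then obtain W where W: "\<And>l. gwalk V E r (W l) r" "\<And>l. fib l \<subseteq> set (W l)"
      "\<And>l. walk_cost w (W l) = 2 * (\<Sum>v | v \<in> V - {r} \<and> fib l \<inter> desc v \<noteq> {}. w (pedge v))"
    using choice[of "\<lambda>l p. gwalk V E r p r \<and> fib l \<subseteq> set p \<and>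
      walk_cost w p = 2 * (\<Sum>v | v \<in> V - {r} \<and> fib l \<inter> desc v \<noteq> {}. w (pedge v))"] by blast
  define load where "load l = Inl ` fib l \<union> Inr ` {n \<in> D. lab n = l}" for l
  define T where "T l = (W l, load l)" for l
  have finD: "finite D" by (simp add: D_def)
  have lab_load: "Inl x \<in> load l \<longleftrightarrow> x \<in> X \<and> q x = l" "Inr n \<in> load l \<longleftrightarrow> n \<in> D \<and> lab n = l" for x n l
    by (auto simp: load_def fib_def)
  have card_load: "card (load l) = card (fib l) + d l" if "l \<in> q ` X" for l
  proof -
    have "card (load l) = card (Inl ` fib l :: ('v + nat) set) + card (Inr ` {n \<in> D. lab n = l} :: ('v + nat) set)"
      unfolding load_def using finfib finD by (intro card_Un_disjoint) auto
    then show ?thesis using card_lab[OF that] by (simp add: card_image)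
  qed
  have loc_load: "?loc y \<in> fib l" if "y \<in> load l" for y l
    using that pos by (cases y) (auto simp: lab_load fib_def)
  \<comment> \<open>A label is recognised by any real terminal in its load, so tours with equal
    walks are not merged in the set.\<close>
  have injT: "inj_on T (q ` X)"
  proof (rule inj_onI)
    fix l l' assume l: "l \<in> q ` X" "T l = T l'"
    then obtain x where "x \<in> X" "q x = l" by blast
    then have "Inl x \<in> load l'" using l(2) lab_load(1)[of x l] by (simp add: T_def)
    then show "l = l'" using lab_load(1) \<open>q x = l\<close> by simp
  qed
  have sol: "cvrp_solution V E r k (X <+> D) ?loc (T ` q ` X)"
    unfolding cvrp_solution_def
  proof (intro conjI ballI)
    show "finite (T ` q ` X)" using finX by simp
  next
    fix t assume "t \<in> T ` q ` X"
    then obtain l where l: "l \<in> q ` X" "t = T l" by blast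
    have "load l \<subseteq> X <+> D" using lab_load by (auto simp: load_def fib_def)
    moreover have "?loc ` load l \<subseteq> set (W l)" using loc_load W(2) by blast
    moreover have "card (load l) \<le> k" using card_load[OF l(1)] size by simp
    ultimately show "case t of (p, A) \<Rightarrow> gwalk V E r p r \<and> A \<subseteq> X <+> D \<and> ?loc ` A \<subseteq> set p \<and> card A \<le> k"
      using W(1) l(2) by (simp add: T_def)
  next
    fix y assume y: "y \<in> X <+> D"
    obtain l0 where l0: "l0 \<in> q ` X" "\<And>l. y \<in> load l \<longleftrightarrow> l = l0"
    proof (cases y)
      case (Inl x)
      then show ?thesis using y that[of "q x"] lab_load(1) by auto
    next
      case (Inr n)
      then show ?thesis using y that[of "lab n"] lab lab_load(2) by auto
    qed
    show "\<exists>!t. t \<in> T ` q ` X \<and> y \<in> snd t"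
      using l0 by (intro ex1I[of _ "T l0"]) (auto simp: T_def)
  qed
  have visited: "visited_in ?loc c (T l) = {y \<in> load l. comp (?loc y) = c}" if "c \<in> C" for c l
  proof -
    have "?loc y \<in> \<Union>c \<longleftrightarrow> comp (?loc y) = c" if "y \<in> load l" for y
    proof (rule comp[OF _ \<open>c \<in> C\<close>])
      show "?loc y \<in> X" using loc_load[OF that] by (simp add: fib_def)
    qed
    then show ?thesis unfolding visited_in_def T_def snd_conv by blast
  qed
  have c1: "real (card {t \<in> T ` q ` X. visited_in ?loc c t \<noteq> {}}) \<le> m" if c: "c \<in> C" for c
  proof -
    have "{t \<in> T ` q ` X. visited_in ?loc c t \<noteq> {}} \<subseteq> T ` (q ` {x \<in> X. comp x = c})"
    proof
      fix t assume "t \<in> {t \<in> T ` q ` X. visited_in ?loc c t \<noteq> {}}"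
      then obtain l where l: "t = T l" "visited_in ?loc c (T l) \<noteq> {}" by blast
      then obtain y where t: "t = T l" "y \<in> load l" "comp (?loc y) = c" unfolding visited[OF c] by blast
      have "l \<in> q ` {x \<in> X. comp x = c}" using loc_load[OF t(2)] t(3) by (auto simp: fib_def)
      then show "t \<in> T ` (q ` {x \<in> X. comp x = c})" using t(1) by blast
    qed
    then have "card {t \<in> T ` q ` X. visited_in ?loc c t \<noteq> {}} \<le> card (T ` (q ` {x \<in> X. comp x = c}))"
      using finX by (intro card_mono) auto
    also have "\<dots> \<le> card (q ` {x \<in> X. comp x = c})" using finX by (intro card_image_le) simp
    finally show ?thesis using few[of c] by linarith
  qed
  have c2: "\<alpha> * real k \<le> real (card (visited_in ?loc c t))"
    if c: "c \<in> C" and t: "t \<in> T ` q ` X" and ne: "visited_in ?loc c t \<noteq> {}" for c t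
  proof -
    obtain l where l: "l \<in> q ` X" "t = T l" using t by blast
    obtain y where y: "y \<in> load l" "comp (?loc y) = c" using ne unfolding l(2) visited[OF c] by blast
    define x where "x = ?loc y"
    have x: "x \<in> X" "q x = l" "comp x = c" using loc_load[OF y(1)] y(2) by (auto simp: x_def fib_def)
    have finl: "finite (load l)" using finfib finD by (simp add: load_def)
    show ?thesis
    proof (cases "single l")
      case True
      then have "comp z = c" if "z \<in> fib l" for z using that x by (auto simp: single_def fib_def)
      then have "visited_in ?loc c t = load l" using visited[OF c] l(2) loc_load by blast
      then have "card (visited_in ?loc c t) = card (fib l) + (nat \<lceil>\<alpha> * real k\<rceil> - card (fib l))"
        using card_load[OF l(1)] True by (simp only: d_def if_True)
      moreover have "b \<le> a + (b - a)" for a b :: nat by simp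
      ultimately have "nat \<lceil>\<alpha> * real k\<rceil> \<le> card (visited_in ?loc c t)" by metis
      then show ?thesis by linarith
    next
      case False
      then have "\<alpha> * real k \<le> real (card {z \<in> X. q z = l \<and> comp z = comp x})"
        using dense[of l] x(1,2) unfolding single_def by blast
      also have "card {z \<in> X. q z = l \<and> comp z = comp x} \<le> card (visited_in ?loc c t)"
      proof (rule card_inj_on_le[where f = Inl])
        show "Inl ` {z \<in> X. q z = l \<and> comp z = comp x} \<subseteq> visited_in ?loc c t"
        proof
          fix y' :: "'v + nat" assume "y' \<in> Inl ` {z \<in> X. q z = l \<and> comp z = comp x}"
          then obtain z where z: "y' = Inl z" "z \<in> X" "q z = l" "comp z = comp x" by blast
          have "y' \<in> load l" unfolding z(1) lab_load(1) using z(2,3) by (rule conjI)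
          moreover have "comp (?loc y') = c" unfolding z(1) using z(4) x(3) by simp
          ultimately show "y' \<in> visited_in ?loc c t" unfolding l(2) visited[OF c] by blast
        qed
        show "finite (visited_in ?loc c t)" unfolding l(2) visited[OF c] using finl by simp
      qed simp
      finally show ?thesis by simp
    qed
  qed
  have "cvrp_cost w (T ` q ` X) = (\<Sum>l\<in>q ` X. walk_cost w (W l))"
    unfolding cvrp_cost_def by (subst sum.reindex[OF injT]) (simp add: T_def)
  also have "\<dots> = 2 * (\<Sum>l\<in>q ` X. \<Sum>v | v \<in> V - {r} \<and> fib l \<inter> desc v \<noteq> {}. w (pedge v))"
    unfolding W(3) by (simp add: sum_distrib_left)
  also have "\<dots> = 2 * (\<Sum>v\<in>V - {r}. w (pedge v) * real (card {l \<in> q ` X. fib l \<inter> desc v \<noteq> {}}))"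
    using finX finite_V by (subst sum_restrict_swap) auto
  also have "\<dots> = 2 * (\<Sum>v\<in>V - {r}. w (pedge v) * real (card (q ` (desc v \<inter> X))))"
  proof -
    have "{l \<in> q ` X. fib l \<inter> desc v \<noteq> {}} = q ` (desc v \<inter> X)" for v
    proof (intro equalityI subsetI)
      fix l assume "l \<in> {l \<in> q ` X. fib l \<inter> desc v \<noteq> {}}"
      then obtain x where "x \<in> desc v" "x \<in> X" "q x = l" by (auto simp: fib_def)
      then show "l \<in> q ` (desc v \<inter> X)" by blast
    next
      fix l assume "l \<in> q ` (desc v \<inter> X)"
      then obtain x where "x \<in> desc v" "x \<in> X" "q x = l" by blast
      then show "l \<in> {l \<in> q ` X. fib l \<inter> desc v \<noteq> {}}" by (auto simp: fib_def)
    qed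
    then show ?thesis by simp
  qed
  finally have "cvrp_cost w (T ` q ` X) = 2 * (\<Sum>v\<in>V - {r}. w (pedge v) * real (card (q ` (desc v \<inter> X))))" .
  moreover have "pos ` D \<subseteq> V"
  proof
    fix y assume "y \<in> pos ` D"
    then obtain n where "n \<in> D" "y = pos n" by blast
    then show "y \<in> V" using pos[of n] XV by (auto simp: fib_def)
  qed
  ultimately show ?thesis using finD sol c1 c2
    by (intro exI[of _ D] exI[of _ pos] exI[of _ "T ` q ` X"] conjI ballI impI)
qed

lemma labelling_of_solution:
  fixes S :: "('v, 'v) tour set"
  assumes nonneg: "\<forall>e\<in>E. 0 \<le> w e" and XV: "X \<subseteq> V" and sol: "cvrp_solution V E r k X id S"
  obtains \<tau> :: "'v \<Rightarrow> ('v, 'v) tour" where "\<And>t. card {x \<in> X. \<tau> x = t} \<le> k"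
    "2 * (\<Sum>v\<in>V - {r}. w (pedge v) * real (card (\<tau> ` (desc v \<inter> X)))) \<le> cvrp_cost w S"
proof -
  define \<tau> where "\<tau> x = (THE t. t \<in> S \<and> x \<in> snd t)" for x
  have finX: "finite X" using XV finite_V finite_subset by blast
  have finS: "finite S" using sol by (simp add: cvrp_solution_def)
  have tour: "gwalk V E r (fst t) r" "snd t \<subseteq> X" "snd t \<subseteq> set (fst t)" "card (snd t) \<le> k" if "t \<in> S" for t
    using sol that by (auto simp: cvrp_solution_def split_beta)
  have ex1: "\<exists>!t. t \<in> S \<and> x \<in> snd t" if "x \<in> X" for x
    using sol that by (auto simp: cvrp_solution_def)
  have \<tau>: "\<tau> x \<in> S" "x \<in> snd (\<tau> x)" if "x \<in> X" for x
    using theI'[OF ex1[OF that]] by (auto simp: \<tau>_def)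
  have \<tau>_eq: "\<tau> x = t" if "t \<in> S" "x \<in> snd t" for x t
    using ex1[of x] \<tau>[of x] tour(2)[OF that(1)] that by blast
  have "card {x \<in> X. \<tau> x = t} \<le> k" for t
  proof (cases "t \<in> S")
    case True
    have "card {x \<in> X. \<tau> x = t} \<le> card (snd t)"
      using \<tau>(2) tour(2)[OF True] finX by (intro card_mono) (auto intro: finite_subset)
    then show ?thesis using tour(4)[OF True] by simp
  next
    case False
    then have "{x \<in> X. \<tau> x = t} = {}" using \<tau>(1) by blast
    then show ?thesis by (metis card.empty zero_le)
  qed
  moreover have "2 * (\<Sum>v\<in>V - {r}. w (pedge v) * real (card (\<tau> ` (desc v \<inter> X)))) \<le> cvrp_cost w S"
  proof -
    have "{t \<in> S. snd t \<inter> desc v \<noteq> {}} = \<tau> ` (desc v \<inter> X)" for v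
    proof (intro equalityI subsetI)
      fix t assume "t \<in> {t \<in> S. snd t \<inter> desc v \<noteq> {}}"
      then obtain x where "t \<in> S" "x \<in> snd t" "x \<in> desc v" by blast
      then show "t \<in> \<tau> ` (desc v \<inter> X)" using \<tau>_eq tour(2) by blast
    qed (use \<tau> in blast)
    then have "2 * (\<Sum>v\<in>V - {r}. w (pedge v) * real (card (\<tau> ` (desc v \<inter> X))))
        = 2 * (\<Sum>t\<in>S. \<Sum>v | v \<in> V - {r} \<and> snd t \<inter> desc v \<noteq> {}. w (pedge v))"
      using finS finite_V by (subst sum_restrict_swap) auto
    also have "\<dots> \<le> (\<Sum>t\<in>S. walk_cost w (fst t))"
      unfolding sum_distrib_left using walk_cost_ge[OF nonneg tour(1,3)]
      by (intro sum_mono) (simp add: sum_distrib_left)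
    finally show ?thesis by (simp add: cvrp_cost_def)
  qed
  ultimately show ?thesis using that by blast
qed

text \<open>One tour per terminal. Nonemptiness is needed for the infimum that defines the optimum
  to be bounded below by a common lower bound of all costs.\<close>

lemma solution_exists:
  assumes XV: "X \<subseteq> V" and k: "1 \<le> k"
  shows "\<exists>S :: ('v, 'v) tour set. cvrp_solution V E r k X id S"
proof -
  have finX: "finite X" using XV finite_V finite_subset by blast
  have "\<exists>p. gwalk V E r p r \<and> x \<in> set p" if "x \<in> X" for x
    using visiting_walk[of "{x}"] XV that by blast
  then obtain W where W: "\<And>x. x \<in> X \<Longrightarrow> gwalk V E r (W x) r \<and> x \<in> set (W x)" by metis
  have "cvrp_solution V E r k X id ((\<lambda>x. (W x, {x})) ` X)"
    unfolding cvrp_solution_def using finX W k by auto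
  then show ?thesis by blast
qed

end

theorem theorem13:
  fixes V V' :: "'v set" and E :: "'v set set" and r :: 'v
    and w :: "'v set \<Rightarrow> real" and k :: nat
    and C :: "'v set set set" and \<epsilon> \<Gamma> \<alpha> :: real
  assumes "0 < \<epsilon>" and "\<epsilon> < 1"
    and "\<Gamma> = 12 / \<epsilon>"
    and "\<alpha> = \<epsilon> powr (1 / \<epsilon> + 1)"
    and "rooted_binary_tree V E r"
    and "\<forall>e\<in>E. 0 \<le> w e"
    and "V' = leaves V E r"
    and "1 \<le> k" and "k \<le> card V"
    and "Max (gdist V E w r ` V') < (1 / \<epsilon>) powr (1 / \<epsilon> - 1) * Min (gdist V E w r ` V')"
    and "component_decomposition V E r V' k \<Gamma> C"
  shows "\<exists>(D :: nat set) (pos :: nat \<Rightarrow> 'v) (OPT1 :: ('v, 'v + nat) tour set).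
    finite D \<and> pos ` D \<subseteq> V \<and>
    cvrp_solution V E r k (V' <+> D) (case_sum id pos) OPT1 \<and>
    (\<forall>c\<in>C. real (card {t \<in> OPT1. visited_in (case_sum id pos) c t \<noteq> {}}) \<le> 2 * \<Gamma> / \<alpha> + 1) \<and>
    (\<forall>c\<in>C. \<forall>t\<in>OPT1. visited_in (case_sum id pos) c t \<noteq> {} \<longrightarrow>
       \<alpha> * real k \<le> real (card (visited_in (case_sum id pos) c t))) \<and>
    cvrp_cost w OPT1 \<le> (1 + \<epsilon>) * cvrp_opt V E w r k V'"
proof -
  interpret T: rooted_tree V E r
    using assms(5) by unfold_locales (auto simp: rooted_binary_tree_def)
  have kp: "0 < real k" using assms(8) by simp
  have Gp: "0 < \<Gamma>" using assms(1,3) by simp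
  \<comment> \<open>A depot that is a leaf is the whole tree; both extremal distances are then 0,
    against the strict distance bound. So every terminal has an edge above it.\<close>
  have r_notin: "r \<notin> V'"
  proof
    assume "r \<in> V'"
    then have Vr: "V = {r}" using T.root_leaf_imp_trivial assms(7) by blast
    have "E = {}"
    proof (rule ccontr)
      assume "E \<noteq> {}"
      then obtain e where e: "e \<in> E" by blast
      then have "card e \<le> card {r}" using T.edge_subset[OF e] Vr by (intro card_mono) auto
      then show False using T.edge_card[OF e] by simp
    qed
    then have "p = [r]" if "gwalk V E r p r" for p
      using that by (cases p rule: remdups_adj.cases) (auto simp: gwalk_def)
    moreover have "gwalk V E r [r] r" using T.root by (simp add: gwalk_def)
    ultimately have "{p. gwalk V E r p r} = {[r]}" by blast
    then have "gdist V E w r r = 0" by (simp add: gdist_def walk_cost_def)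
    moreover have "V' = {r}" using \<open>r \<in> V'\<close> assms(7) Vr by (auto simp: leaves_def)
    ultimately show False using assms(10) by simp
  qed
  have V'V: "V' \<subseteq> V - {r}" using r_notin assms(7) by (auto simp: leaves_def)
  have finV': "finite V'" using V'V T.finite_V finite_subset by blast
  have part: "partition_on E C" and conn: "\<And>c. c \<in> C \<Longrightarrow> gconnected (\<Union>c) c"
    and csize: "\<And>c. c \<in> C \<Longrightarrow> real (card (V' \<inter> \<Union>c)) \<le> 2 * \<Gamma> * real k"
    using assms(11) by (auto simp: component_decomposition_def)
  have CE: "c \<subseteq> E" if "c \<in> C" for c using part that by (auto simp: partition_on_def)
  have uniq: "c = c'" if "c \<in> C" "c' \<in> C" "e \<in> c" "e \<in> c'" for c c' e
    using part that by (auto simp: partition_on_def disjoint_def)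
  \<comment> \<open>The component of the edge above \<open>v\<close>. For a terminal this is the
    only component containing it, so \<open>cp\<close> will serve both as \<open>comp\<close> and as
    \<open>own\<close>.\<close>
  define cp where "cp v = (THE c. c \<in> C \<and> {T.parent v, v} \<in> c)" for v
  have cp_eq: "cp v = c" if "c \<in> C" "{T.parent v, v} \<in> c" for v c
    unfolding cp_def using that uniq by (intro the_equality) auto
  have cp: "cp v \<in> C" "{T.parent v, v} \<in> cp v" if v: "v \<in> V - {r}" for v
  proof -
    have "{T.parent v, v} \<in> E" using T.path_to_parent(3) v by blast
    then obtain c where "c \<in> C" "{T.parent v, v} \<in> c" using part by (auto simp: partition_on_def)
    then show "cp v \<in> C" "{T.parent v, v} \<in> cp v" using cp_eq by auto
  qed
  have comp: "x \<in> \<Union>c \<longleftrightarrow> cp x = c" if x: "x \<in> V'" and c: "c \<in> C" for x c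
  proof
    assume "x \<in> \<Union>c"
    then obtain e where e: "e \<in> c" "x \<in> e" by blast
    have "e = {T.parent x, x}" using T.leaf_edge[of x e] x e CE[OF c] V'V assms(7) by blast
    then show "cp x = c" using cp_eq[OF c] e(1) by simp
  next
    assume "cp x = c"
    then show "x \<in> \<Union>c" using cp(2)[of x] x V'V by blast
  qed
  \<comment> \<open>A component that reaches below \<open>v\<close> without containing the edge
    above \<open>v\<close> cannot leave the subtree.\<close>
  have inside: "\<Union>c \<subseteq> T.desc v" if v: "v \<in> V - {r}" and c: "c \<in> C" "c \<noteq> cp v" and x: "x \<in> \<Union>c" "x \<in> T.desc v"
    for v c x
  proof
    fix y assume y: "y \<in> \<Union>c"
    show "y \<in> T.desc v"
    proof (rule ccontr)
      assume "y \<notin> T.desc v"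
      then have "{T.parent v, v} \<in> c" using T.connected_cut[OF CE[OF c(1)] conn[OF c(1)], of v x y] v x y by blast
      then show False using cp_eq[OF c(1)] c(2) by blast
    qed
  qed
  have below_inside: "\<Union>c \<subseteq> T.desc v \<and> c \<in> C"
    if v: "v \<in> V - {r}" and c: "c \<in> cp ` (T.desc v \<inter> V') - {cp v}" for v c
  proof -
    obtain x where x: "x \<in> T.desc v" "x \<in> V'" "c = cp x" "c \<noteq> cp v" using c by blast
    have "c \<in> C" using cp(1)[of x] x V'V by blast
    moreover have "x \<in> \<Union>c" using comp[OF x(2) \<open>c \<in> C\<close>] x(3) by simp
    ultimately show ?thesis using inside[OF v _ x(4) _ x(1)] by blast
  qed
  have finC: "finite C"
  proof -
    have "finite E" using T.finite_V T.edge_subset by (meson PowI finite_Pow_iff finite_subset subsetI)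
    then show ?thesis using CE by (meson PowI finite_Pow_iff finite_subset subsetI)
  qed
  have root_in: "comp_root V E r c \<in> \<Union>c" if c: "c \<in> C" for c
  proof -
    have "\<Union>c \<subseteq> V" using CE[OF c] T.edge_subset by blast
    then have "finite (\<Union>c)" using T.finite_V finite_subset by blast
    moreover have "\<Union>c \<noteq> {}" using conn[OF c] by (simp add: gconnected_def)
    ultimately show ?thesis unfolding comp_root_def by (rule arg_min_if_finite(1))
  qed
  have big: "\<exists>\<phi>. (\<forall>c\<in>C. \<phi> c \<in> C \<and> big_component V' k \<Gamma> (\<phi> c) \<and>
        \<Union>(\<phi> c) \<subseteq> T.desc (comp_root V E r c)) \<and>
        (\<forall>b\<in>C. big_component V' k \<Gamma> b \<longrightarrow> card {c \<in> C. \<phi> c = b} \<le> 3)"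
    if "c \<in> C" "c' \<in> C" "c \<noteq> c'" for c c'
  proof -
    have "card {c, c'} \<le> card C" using that finC by (intro card_mono) auto
    then have "1 < card C" using that(3) by simp
    then show ?thesis using assms(11) unfolding component_decomposition_def by blast
  qed
  \<comment> \<open>Components counted here are rooted in the subtree of \<open>v\<close>, so
    \<open>\<phi>\<close> sends them to big components below \<open>v\<close>. Each of these is hit
    at most three times and no two share a terminal, whence the factor 3.\<close>
  have heavy: "(cp ` (T.desc v \<inter> V') - {cp v} \<noteq> {} \<longrightarrow> \<Gamma> * real k \<le> real (card (T.desc v \<inter> V'))) \<and>
      \<Gamma> * real k * real (card (cp ` (T.desc v \<inter> V') - {cp v})) \<le> 3 * real (card (T.desc v \<inter> V'))"
    if v: "v \<in> V - {r}" for v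
  proof (cases "cp ` (T.desc v \<inter> V') - {cp v} = {}")
    case False
    let ?Q = "cp ` (T.desc v \<inter> V') - {cp v}"
    obtain c0 where c0: "c0 \<in> ?Q" using False by blast
    obtain \<phi> where \<phi>: "\<And>c. c \<in> C \<Longrightarrow> \<phi> c \<in> C \<and> big_component V' k \<Gamma> (\<phi> c) \<and>
        \<Union>(\<phi> c) \<subseteq> T.desc (comp_root V E r c)"
      "\<And>b. \<lbrakk>b \<in> C; big_component V' k \<Gamma> b\<rbrakk> \<Longrightarrow> card {c \<in> C. \<phi> c = b} \<le> 3"
      using big[of c0 "cp v"] below_inside[OF v c0] c0 cp(1)[OF v] by blast
    have QC: "?Q \<subseteq> C" using below_inside[OF v] by blast
    have sub: "V' \<inter> \<Union>(\<phi> c) \<subseteq> T.desc v \<inter> V'" if c: "c \<in> ?Q" for c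
    proof -
      have "comp_root V E r c \<in> T.desc v" using root_in below_inside[OF v c] by blast
      then show ?thesis using \<phi>(1) below_inside[OF v c] T.desc_trans by blast
    qed
    have finL: "finite (T.desc v \<inter> V')" using finV' by simp
    have finQ: "finite ?Q" using finL by simp
    have bigc: "\<Gamma> * real k \<le> real (card (V' \<inter> \<Union>(\<phi> c)))" if "c \<in> ?Q" for c
      using \<phi>(1) QC that by (auto simp: big_component_def)
    have "\<Gamma> * real k \<le> real (card (T.desc v \<inter> V'))"
    proof -
      have "card (V' \<inter> \<Union>(\<phi> c0)) \<le> card (T.desc v \<inter> V')" by (rule card_mono[OF finL sub[OF c0]])
      then show ?thesis using bigc[OF c0] by linarith
    qed
    moreover have "\<Gamma> * real k * real (card ?Q) \<le> 3 * real (card (T.desc v \<inter> V'))"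
    proof -
      have "card ?Q = card (\<Union>b\<in>\<phi> ` ?Q. {c \<in> ?Q. \<phi> c = b})" by (rule arg_cong[of _ _ card]) blast
      also have "\<dots> \<le> (\<Sum>b\<in>\<phi> ` ?Q. card {c \<in> ?Q. \<phi> c = b})" using finQ by (intro card_UN_le) simp
      also have "\<dots> \<le> (\<Sum>b\<in>\<phi> ` ?Q. 3)"
      proof (rule sum_mono)
        fix b assume "b \<in> \<phi> ` ?Q"
        then have "b \<in> C" "big_component V' k \<Gamma> b" using \<phi>(1) QC by auto
        then have "card {c \<in> C. \<phi> c = b} \<le> 3" by (rule \<phi>(2))
        moreover have "card {c \<in> ?Q. \<phi> c = b} \<le> card {c \<in> C. \<phi> c = b}"
          using QC finC by (intro card_mono) auto
        ultimately show "card {c \<in> ?Q. \<phi> c = b} \<le> 3" by linarith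
      qed
      finally have card_Q: "real (card ?Q) \<le> 3 * real (card (\<phi> ` ?Q))" by simp
      have "\<Gamma> * real k * real (card (\<phi> ` ?Q)) = (\<Sum>b\<in>\<phi> ` ?Q. \<Gamma> * real k)" by simp
      also have "\<dots> \<le> (\<Sum>b\<in>\<phi> ` ?Q. real (card (V' \<inter> \<Union>b)))" using bigc by (intro sum_mono) auto
      also have "\<dots> = real (card (\<Union>b\<in>\<phi> ` ?Q. V' \<inter> \<Union>b))"
      proof -
        have "V' \<inter> \<Union>b \<inter> (V' \<inter> \<Union>b') = {}" if "b \<in> \<phi> ` ?Q" "b' \<in> \<phi> ` ?Q" "b \<noteq> b'" for b b'
        proof -
          have "b \<in> C" "b' \<in> C" using that \<phi>(1) QC by auto
          then show ?thesis using comp that(3) by blast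
        qed
        then have "card (\<Union>b\<in>\<phi> ` ?Q. V' \<inter> \<Union>b) = (\<Sum>b\<in>\<phi> ` ?Q. card (V' \<inter> \<Union>b))"
          using finQ finV' by (intro card_UN_disjoint) auto
        then show ?thesis by simp
      qed
      also have "\<dots> \<le> real (card (T.desc v \<inter> V'))"
        using finL sub by (intro of_nat_mono card_mono) auto
      finally have "\<Gamma> * real k * real (card (\<phi> ` ?Q)) \<le> real (card (T.desc v \<inter> V'))" .
      moreover have "\<Gamma> * real k * real (card ?Q) \<le> \<Gamma> * real k * (3 * real (card (\<phi> ` ?Q)))"
        using card_Q Gp kp by (intro mult_left_mono) auto
      ultimately show ?thesis by linarith
    qed
    ultimately show ?thesis by blast
  next
    case True
    show ?thesis unfolding True by simp
  qed
  obtain rank :: "'v \<Rightarrow> real" where rank: "inj_on rank V"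
    "\<And>a x y z. \<lbrakk>x \<in> V; z \<in> V; y \<in> V; x \<in> T.desc a; z \<in> T.desc a; rank x \<le> rank y; rank y \<le> rank z\<rbrakk>
      \<Longrightarrow> y \<in> T.desc a"
    using T.parent_closed_rank[OF T.parent_closed_V] by blast
  interpret R: laminar_routing V' "V - {r}" "\<lambda>v. T.desc v \<inter> V'" "\<lambda>v. w {T.parent v, v}" cp cp rank k \<Gamma>
  proof
    show "finite V'" "finite (V - {r})" using finV' T.finite_V by auto
    show "0 \<le> w {T.parent v, v}" if "v \<in> V - {r}" for v using assms(6) T.path_to_parent(3) that by blast
    show "inj_on rank V'" using rank(1) V'V by (auto intro: inj_on_subset)
    show "y \<in> T.desc v \<inter> V'"
      if "v \<in> V - {r}" "x \<in> T.desc v \<inter> V'" "z \<in> T.desc v \<inter> V'" "y \<in> V'" "rank x \<le> rank y" "rank y \<le> rank z"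
      for v x z y using rank(2)[of x z y v] that V'V by blast
    show "y \<in> T.desc v \<inter> V'"
      if "v \<in> V - {r}" "x \<in> T.desc v \<inter> V'" "cp x \<noteq> cp v" "y \<in> V'" "cp y = cp x" for v x y
      using below_inside[of v "cp x"] comp[of y "cp x"] that by blast
    show "\<Gamma> * real k \<le> real (card (T.desc v \<inter> V'))"
      if "v \<in> V - {r}" "cp ` (T.desc v \<inter> V') - {cp v} \<noteq> {}" for v using heavy that by blast
    show "\<Gamma> * real k * real (card (cp ` (T.desc v \<inter> V') - {cp v})) \<le> 3 * real (card (T.desc v \<inter> V'))"
      if "v \<in> V - {r}" for v using heavy that by blast
    show "real (card {x \<in> V'. cp x = c}) \<le> 2 * \<Gamma> * real k" for c
    proof (cases "c \<in> C")
      case True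
      then have "{x \<in> V'. cp x = c} = V' \<inter> \<Union>c" using comp by blast
      then show ?thesis using csize[OF True] by simp
    next
      case False
      then have none: "{x \<in> V'. cp x = c} = {}" using cp(1) V'V by blast
      show ?thesis unfolding none using Gp kp by simp
    qed
  qed (use assms(8) Gp in auto)
  have V'V2: "V' \<subseteq> V" using V'V by blast
  let ?sols = "{S :: ('v, 'v) tour set. cvrp_solution V E r k V' id S}"
  have sols: "?sols \<noteq> {}" using T.solution_exists[OF V'V2 assms(8)] by blast
  have lower: "\<exists>\<tau> :: 'v \<Rightarrow> ('v, 'v) tour. (\<forall>t. card {x \<in> V'. \<tau> x = t} \<le> k) \<and> 2 * R.cost \<tau> \<le> cvrp_cost w S"
    if "S \<in> ?sols" for S
    using T.labelling_of_solution[OF assms(6) V'V2, of k S] that unfolding R.cost_def by blast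
  obtain \<tau>0 :: "'v \<Rightarrow> ('v, 'v) tour" where \<tau>0: "\<And>t. card {x \<in> V'. \<tau>0 x = t} \<le> k" using sols lower by blast
  obtain \<tau> :: "'v \<Rightarrow> ('v, 'v) tour" where \<tau>: "\<And>t. card {x \<in> V'. \<tau> x = t} \<le> k"
    "\<And>\<tau>' :: 'v \<Rightarrow> ('v, 'v) tour. (\<And>t. card {x \<in> V'. \<tau>' x = t} \<le> k) \<Longrightarrow> R.cost \<tau> \<le> R.cost \<tau>'"
    using R.cheapest_labelling[OF \<tau>0] by blast
  have opt: "2 * R.cost \<tau> \<le> cvrp_opt V E w r k V'"
    unfolding cvrp_opt_def
  proof (rule cINF_greatest[OF sols])
    fix S assume "S \<in> ?sols"
    then obtain \<tau>' :: "'v \<Rightarrow> ('v, 'v) tour" where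
      \<tau>': "\<And>t. card {x \<in> V'. \<tau>' x = t} \<le> k" "2 * R.cost \<tau>' \<le> cvrp_cost w S" using lower by blast
    show "2 * R.cost \<tau> \<le> cvrp_cost w S" using \<tau>(2)[OF \<tau>'(1)] \<tau>'(2) by linarith
  qed
  obtain q :: "'v \<Rightarrow> ('v, 'v) tour + 'v set set \<times> nat" where
    q: "R.admissible \<alpha> q" "R.cost q \<le> (1 + \<epsilon>) * R.cost \<tau>"
    using R.regrouping[OF \<tau>(1) assms(1-4)] by blast
  have "\<alpha> \<le> 1" using assms(1,2,4) by (simp add: powr_le1)
  have "\<exists>(D :: nat set) pos (S :: ('v, 'v + nat) tour set).
    finite D \<and> pos ` D \<subseteq> V \<and> cvrp_solution V E r k (V' <+> D) (case_sum id pos) S \<and>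
    (\<forall>c\<in>C. real (card {t \<in> S. visited_in (case_sum id pos) c t \<noteq> {}}) \<le> 2 * \<Gamma> / \<alpha> + 1) \<and>
    (\<forall>c\<in>C. \<forall>t\<in>S. visited_in (case_sum id pos) c t \<noteq> {} \<longrightarrow>
       \<alpha> * real k \<le> real (card (visited_in (case_sum id pos) c t))) \<and>
    cvrp_cost w S = 2 * R.cost q"
    unfolding R.cost_def
    by (rule T.solution_of_labelling[OF V'V2 comp])
      (use q(1) \<open>\<alpha> \<le> 1\<close> in \<open>simp_all only: R.admissible_def\<close>)
  then obtain D pos and S :: "('v, 'v + nat) tour set" where S: "finite D" "pos ` D \<subseteq> V"
    "cvrp_solution V E r k (V' <+> D) (case_sum id pos) S"
    "\<forall>c\<in>C. real (card {t \<in> S. visited_in (case_sum id pos) c t \<noteq> {}}) \<le> 2 * \<Gamma> / \<alpha> + 1"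
    "\<forall>c\<in>C. \<forall>t\<in>S. visited_in (case_sum id pos) c t \<noteq> {} \<longrightarrow>
       \<alpha> * real k \<le> real (card (visited_in (case_sum id pos) c t))"
    "cvrp_cost w S = 2 * R.cost q"
    by blast
  have "cvrp_cost w S \<le> (1 + \<epsilon>) * (2 * R.cost \<tau>)" using S(6) q(2) by simp
  also have "\<dots> \<le> (1 + \<epsilon>) * cvrp_opt V E w r k V'" using opt assms(1) by (intro mult_left_mono) auto
  finally show ?thesis using S(1-5) by blast
qed

end
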